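(* Let $0<\varepsilon\le 1$. There is a randomized algorithm which, given a $k$-service instance $(C,L,k,d,\ell)$ and $\varepsilon$ (but not any clustering), outputs a list $\mathcal{L}$ of $k$-center-sets of size $(k/\varepsilon)^{O(k\ell^2)}$ such that for any arbitrary clustering $\mathcal{C}=\{C_1,\dots,C_k\}$ of $C$, with probability at least $1/2$ there is a $k$-center-set $S\in\mathcal{L}$ with $\Psi(S,\mathcal{C})\le(3^{\ell}+\varepsilon)\cdot\Psi^*(\mathcal{C})$. The running time is $O\big(n\cdot(k/\varepsilon)^{O(k\ell^2)}\big)$. In the special case $C\subseteq L$, the guarantee improves to $\Psi(S,\mathcal{C})\le(2^{\ell}+\varepsilon)\cdot\Psi^*(\mathcal{C})$.
   Context: A $k$-service instance $(C,L,k,d,\ell)$ consists of a metric space $(\mathcal{X},d)$, a finite set $L\subseteq\mathcal{X}$ of facility locations, a finite set $C\subseteq\mathcal{X}$ of clients, an integer $k>0$ and a real $\ell\ge1$; $n$ denotes the input size (number of points). A $k$-center-set is a set of $k$ distinct elements of $L$. A clustering of $C$ is a partition $\mathcal{C}=\{C_1,\dots,C_k\}$ of $C$. For a $k$-center-set $F=\{f_1,\dots,f_k\}$, $\Psi(F,\mathcal{C})=\min_{\pi}\sum_{i=1}^k\sum_{x\in C_i}d^{\ell}(x,f_{\pi(i)})$ over permutations $\pi$ of $\{1,\dots,k\}$, and $\Psi^*(\mathcal{C})=\min_F\Psi(F,\mathcal{C})$ over all $k$-center-sets $F$. *)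

theory Defs
  imports
    "HOL-Analysis.Abstract_Metric_Spaces"
    "HOL-Probability.Probability_Mass_Function"
    "HOL-Combinatorics.Permutations"
begin

section \<open>The k-service problem\<close>

text \<open>
  The condition \<open>k \<le> card L\<close> says that at least one k-center-set exists; without it the
  minimum defining \<open>Psi_opt\<close> below would range over the empty set.
\<close>

definition k_service_instance ::
  "'a set \<Rightarrow> ('a \<Rightarrow> 'a \<Rightarrow> real) \<Rightarrow> 'a set \<Rightarrow> 'a set \<Rightarrow> nat \<Rightarrow> real \<Rightarrow> bool" where
  "k_service_instance X d C L k l \<longleftrightarrow>
     Metric_space X d \<and> finite L \<and> L \<subseteq> X \<and> finite C \<and> C \<subseteq> X \<and>
     0 < k \<and> k \<le> card L \<and> 1 \<le> l"

definition k_center_set :: "'a set \<Rightarrow> nat \<Rightarrow> 'a set \<Rightarrow> bool" where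
  "k_center_set L k F \<longleftrightarrow> F \<subseteq> L \<and> card F = k"

text \<open>
  A clustering is an indexed family \<open>P 1, \<dots>, P k\<close>.  Parts may be empty, so every partition of
  \<open>C\<close> into \<open>k\<close> nonempty parts is covered as well.
\<close>

definition clustering :: "'a set \<Rightarrow> nat \<Rightarrow> (nat \<Rightarrow> 'a set) \<Rightarrow> bool" where
  "clustering C k P \<longleftrightarrow> disjoint_family_on P {1..k} \<and> (\<Union>i\<in>{1..k}. P i) = C"

definition enumeration :: "nat \<Rightarrow> 'a set \<Rightarrow> nat \<Rightarrow> 'a" where
  "enumeration k F = (SOME f. bij_betw f {1..k} F)"

definition Psi ::
  "('a \<Rightarrow> 'a \<Rightarrow> real) \<Rightarrow> real \<Rightarrow> nat \<Rightarrow> 'a set \<Rightarrow> (nat \<Rightarrow> 'a set) \<Rightarrow> real" where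
  "Psi d l k F P =
     Min {\<Sum>i=1..k. \<Sum>x\<in>P i. d x (enumeration k F (\<pi> i)) powr l | \<pi>. \<pi> permutes {1..k}}"

definition Psi_opt ::
  "('a \<Rightarrow> 'a \<Rightarrow> real) \<Rightarrow> real \<Rightarrow> 'a set \<Rightarrow> nat \<Rightarrow> (nat \<Rightarrow> 'a set) \<Rightarrow> real" where
  "Psi_opt d l L k P = Min {Psi d l k F P | F. k_center_set L k F}"

text \<open>The value of \<open>Psi\<close> does not depend on how the center set is enumerated.\<close>

lemma Psi_eq_of_enumeration:
  assumes f: "bij_betw f {1..k} F"
  shows "Psi d l k F P =
     Min {\<Sum>i=1..k. \<Sum>x\<in>P i. d x (f (\<pi> i)) powr l | \<pi>. \<pi> permutes {1..k}}"
proof -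
  have *: "{\<Sum>i=1..k. \<Sum>x\<in>P i. d x (g (\<pi> i)) powr l | \<pi>. \<pi> permutes {1..k}}
         \<subseteq> {\<Sum>i=1..k. \<Sum>x\<in>P i. d x (h (\<pi> i)) powr l | \<pi>. \<pi> permutes {1..k}}"
    if g: "bij_betw g {1..k} F" and h: "bij_betw h {1..k} F" for g h
  proof clarify
    fix \<pi> assume \<pi>: "\<pi> permutes {1..k}"
    define \<sigma> where "\<sigma> i = (if i \<in> {1..k} then inv_into {1..k} h (g (\<pi> i)) else i)" for i
    have b: "bij_betw (inv_into {1..k} h \<circ> (g \<circ> \<pi>)) {1..k} {1..k}"
      by (meson bij_betw_inv_into bij_betw_trans g h permutes_imp_bij \<pi>)
    have "bij_betw \<sigma> {1..k} {1..k}"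
      using b by (rule bij_betw_cong[THEN iffD1, rotated]) (simp add: \<sigma>_def)
    then have "\<sigma> permutes {1..k}"
      by (rule bij_imp_permutes) (auto simp: \<sigma>_def)
    moreover have "h (\<sigma> i) = g (\<pi> i)" if "i \<in> {1..k}" for i
    proof -
      have "g (\<pi> i) \<in> h ` {1..k}"
        using that g h \<pi> by (metis bij_betw_apply bij_betw_imp_surj_on permutes_imp_bij)
      then show ?thesis using that by (simp add: \<sigma>_def f_inv_into_f)
    qed
    then have "(\<Sum>i=1..k. \<Sum>x\<in>P i. d x (g (\<pi> i)) powr l)
             = (\<Sum>i=1..k. \<Sum>x\<in>P i. d x (h (\<sigma> i)) powr l)"
      by (intro sum.cong) auto
    ultimately show "\<exists>\<pi>'. (\<Sum>i=1..k. \<Sum>x\<in>P i. d x (g (\<pi> i)) powr l)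
             = (\<Sum>i=1..k. \<Sum>x\<in>P i. d x (h (\<pi>' i)) powr l) \<and> \<pi>' permutes {1..k}"
      by blast
  qed
  have e: "bij_betw (enumeration k F) {1..k} F"
    unfolding enumeration_def by (rule someI[where P = "\<lambda>f. bij_betw f {1..k} F", OF f])
  show ?thesis
    unfolding Psi_def using *[OF e f] *[OF f e] by (simp add: subset_antisym)
qed


section \<open>Randomized algorithms on a real RAM with distance queries\<close>

text \<open>
  Algorithms are programs of a small imperative language.  Memory consists of arrays of natural
  numbers and arrays of real numbers; a scalar is the cell with index 0 of an array.  Arithmetic,
  real powers, comparisons, array accesses, distance queries and biased coin flips are unit-cost
  primitives, and there is no conversion (such as rounding) from real to natural numbers.
  A program is fixed before the input is given, so its expressions have constant size and
  evaluating one counts as a single step.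
\<close>

datatype nexp =
    NConst nat
  | NCell string nexp
  | NPlus nexp nexp
  | NMinus nexp nexp
  | NTimes nexp nexp

datatype rexp =
    ROfNat nexp
  | RCell string nexp
  | Dist nexp nexp  \<comment> \<open>distance query for two input points, given by their positions in the input\<close>
  | RPlus rexp rexp
  | RMinus rexp rexp
  | RTimes rexp rexp
  | RDivide rexp rexp
  | RPowr rexp rexp

datatype bexp =
    NLess nexp nexp
  | RLess rexp rexp
  | BNot bexp
  | BAnd bexp bexp

datatype com =
    SKIP
  | NAssign string nexp nexp  \<comment> \<open>array, index, value\<close>
  | RAssign string nexp rexp  \<comment> \<open>array, index, value\<close>
  | Flip string nexp rexp     \<comment> \<open>array, index, probability of storing 1 (otherwise 0 is stored)\<close>
  | Seq com com
  | If bexp com com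
  | While bexp com

record store =
  nats :: "string \<Rightarrow> nat \<Rightarrow> nat"
  reals :: "string \<Rightarrow> nat \<Rightarrow> real"

type_synonym distances = "nat \<Rightarrow> nat \<Rightarrow> real"

primrec nval :: "nexp \<Rightarrow> store \<Rightarrow> nat" where
  "nval (NConst c) s = c"
| "nval (NCell x e) s = nats s x (nval e s)"
| "nval (NPlus e1 e2) s = nval e1 s + nval e2 s"
| "nval (NMinus e1 e2) s = nval e1 s - nval e2 s"
| "nval (NTimes e1 e2) s = nval e1 s * nval e2 s"

primrec rval :: "distances \<Rightarrow> rexp \<Rightarrow> store \<Rightarrow> real" where
  "rval D (ROfNat e) s = real (nval e s)"
| "rval D (RCell x e) s = reals s x (nval e s)"
| "rval D (Dist e1 e2) s = D (nval e1 s) (nval e2 s)"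
| "rval D (RPlus e1 e2) s = rval D e1 s + rval D e2 s"
| "rval D (RMinus e1 e2) s = rval D e1 s - rval D e2 s"
| "rval D (RTimes e1 e2) s = rval D e1 s * rval D e2 s"
| "rval D (RDivide e1 e2) s = rval D e1 s / rval D e2 s"
| "rval D (RPowr e1 e2) s = rval D e1 s powr rval D e2 s"

primrec bval :: "distances \<Rightarrow> bexp \<Rightarrow> store \<Rightarrow> bool" where
  "bval D (NLess e1 e2) s \<longleftrightarrow> nval e1 s < nval e2 s"
| "bval D (RLess e1 e2) s \<longleftrightarrow> rval D e1 s < rval D e2 s"
| "bval D (BNot b) s \<longleftrightarrow> \<not> bval D b s"
| "bval D (BAnd b1 b2) s \<longleftrightarrow> bval D b1 s \<and> bval D b2 s"

definition nat_update :: "string \<Rightarrow> nat \<Rightarrow> nat \<Rightarrow> store \<Rightarrow> store" where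
  "nat_update x i v s = s\<lparr>nats := (nats s)(x := (nats s x)(i := v))\<rparr>"

definition real_update :: "string \<Rightarrow> nat \<Rightarrow> real \<Rightarrow> store \<Rightarrow> store" where
  "real_update x i v s = s\<lparr>reals := (reals s)(x := (reals s x)(i := v))\<rparr>"

text \<open>
  One step of computation.  Distinct coin flips are independent; \<open>bernoulli_pmf\<close> clips its
  parameter to the unit interval.
\<close>

primrec step :: "distances \<Rightarrow> com \<Rightarrow> store \<Rightarrow> (com \<times> store) pmf" where
  "step D SKIP s = return_pmf (SKIP, s)"
| "step D (NAssign x i e) s = return_pmf (SKIP, nat_update x (nval i s) (nval e s) s)"
| "step D (RAssign x i e) s = return_pmf (SKIP, real_update x (nval i s) (rval D e s) s)"
| "step D (Flip x i e) s =
     map_pmf (\<lambda>b. (SKIP, nat_update x (nval i s) (of_bool b) s)) (bernoulli_pmf (rval D e s))"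
| "step D (Seq c1 c2) s =
     (if c1 = SKIP then return_pmf (c2, s)
      else map_pmf (\<lambda>(c1', s'). (Seq c1' c2, s')) (step D c1 s))"
| "step D (If b c1 c2) s = return_pmf (if bval D b s then c1 else c2, s)"
| "step D (While b c) s = return_pmf (if bval D b s then Seq c (While b c) else SKIP, s)"

primrec steps :: "distances \<Rightarrow> nat \<Rightarrow> com \<times> store \<Rightarrow> (com \<times> store) pmf" where
  "steps D 0 cfg = return_pmf cfg"
| "steps D (Suc t) cfg = bind_pmf (step D (fst cfg) (snd cfg)) (steps D t)"

text \<open>Worst-case running time: the program has terminated after \<open>t\<close> steps for all coin flips.\<close>

definition halts_within :: "distances \<Rightarrow> nat \<Rightarrow> com \<times> store \<Rightarrow> bool" where
  "halts_within D t cfg \<longleftrightarrow> (\<forall>cfg'\<in>set_pmf (steps D t cfg). fst cfg' = SKIP)"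


section \<open>Encoding of inputs and outputs\<close>

definition lists_set :: "'a list \<Rightarrow> 'a set \<Rightarrow> bool" where
  "lists_set xs A \<longleftrightarrow> distinct xs \<and> set xs = A"

text \<open>
  The input points are the clients \<open>cs\<close> followed by the facilities \<open>fs\<close>; a point that is both a
  client and a facility has two positions.  The program sees the points only through distance queries.
\<close>

definition dist_query :: "('a \<Rightarrow> 'a \<Rightarrow> real) \<Rightarrow> 'a list \<Rightarrow> 'a list \<Rightarrow> distances" where
  "dist_query d cs fs i j =
     (let ps = cs @ fs in if i < length ps \<and> j < length ps then d (ps ! i) (ps ! j) else 0)"

definition input_store :: "nat \<Rightarrow> nat \<Rightarrow> nat \<Rightarrow> real \<Rightarrow> real \<Rightarrow> store" where
  "input_store m f k l \<epsilon> =
     nat_update ''clients'' 0 m (nat_update ''facilities'' 0 f (nat_update ''k'' 0 k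
       (real_update ''ell'' 0 l (real_update ''eps'' 0 \<epsilon>
         \<lparr>nats = (\<lambda>_ _. 0), reals = (\<lambda>_ _. 0)\<rparr>))))"

definition input_config :: "com \<Rightarrow> 'a list \<Rightarrow> 'a list \<Rightarrow> nat \<Rightarrow> real \<Rightarrow> real \<Rightarrow> com \<times> store" where
  "input_config p cs fs k l \<epsilon> = (p, input_store (length cs) (length fs) k l \<epsilon>)"

text \<open>
  The output is a list of sets of facilities, of length \<open>len\<close>; its \<open>j\<close>-th set consists of the
  facilities whose positions in \<open>fs\<close> are stored in the \<open>j\<close>-th block of \<open>k\<close> cells of \<open>out\<close>.
\<close>

definition output_list :: "'a list \<Rightarrow> nat \<Rightarrow> store \<Rightarrow> 'a set list" where
  "output_list fs k s =
     map (\<lambda>j. (\<lambda>i. fs ! nats s ''out'' (j * k + i)) ` {..<k}) [0..<nats s ''len'' 0]"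

definition output_after ::
  "com \<Rightarrow> nat \<Rightarrow> ('a \<Rightarrow> 'a \<Rightarrow> real) \<Rightarrow> 'a list \<Rightarrow> 'a list \<Rightarrow> nat \<Rightarrow> real \<Rightarrow> real \<Rightarrow> 'a set list pmf" where
  "output_after p t d cs fs k l \<epsilon> =
     map_pmf (\<lambda>cfg. output_list fs k (snd cfg))
       (steps (dist_query d cs fs) t (input_config p cs fs k l \<epsilon>))"

text \<open>
  The base \<open>k/\<epsilon>\<close> of bounds of the form \<open>(k/\<epsilon>)\<^bsup>O(\<cdot>)\<^esup>\<close>, kept away from 1, as is usual in the
  reading of such asymptotic bounds: it differs from \<open>k/\<epsilon>\<close> only for \<open>k = 1\<close> and \<open>\<epsilon> > 1/2\<close>.
\<close>

definition bound_base :: "nat \<Rightarrow> real \<Rightarrow> real" where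
  "bound_base k \<epsilon> = max 2 (real k / \<epsilon>)"

end

theory Submission
  imports Defs
begin

text \<open>
  Adaptive \<open>D\<^sup>l\<close>-sampling: starting from an arbitrary input point, repeatedly draw a client with
  probability proportional to the \<open>l\<close>-th power of its distance to the sample \<open>T\<close> obtained so far.
  Call a cluster covered if some point of \<open>T\<close> is very close to a client of the cluster whose
  distance to the optimal center is at most about average.  The clusters that are covered have small
  cost with respect to \<open>T\<close>, so as long as some cluster is uncovered a sample covers a new one
  with probability at least \<open>q = (k/\<epsilon>)\<^bsup>-O(l\<^sup>2)\<^esup>\<close>.  Hence the expected number of uncovered
  clusters shrinks by the factor \<open>1 - q/k\<close> in each round and is at most \<open>1/2\<close> after
  \<open>(k/\<epsilon>)\<^bsup>O(l\<^sup>2)\<^esup>\<close> rounds; no approximate solution is needed to start from.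

  Every \<open>k\<close>-tuple of sample points then yields a center set by giving each point in turn the
  nearest facility that is still free.  Suppose that the points of the tuple represent the clusters,
  and consider any distinct target facilities, one for each cluster (the optimal centers, or clients
  of the clusters if \<open>C \<subseteq> L\<close>).  By a top-trading-cycle argument some order of the tuple gives every
  sample point a facility at least as near as its target, and the triangle inequality together with
  the convexity of \<open>x\<^sup>l\<close> bounds the cost.
\<close>

section \<open>Expected values of terminating runs\<close>

text \<open>The machine shapes the program: it has biased coins but no rounding and no integer
  division, so clients are drawn by reservoir sampling, digits are split off by subtraction, and the
  number of rounds is fixed by comparing a counter with a real threshold. The term
  \<open>opt / k\<close> in \<open>covered\<close> is what keeps the success probability up. Without
  it an uncovered cluster of tiny cost could carry negligible weight beside the covered ones. With
  it the core of an uncovered cluster has weight comparable to \<open>opt / k\<close>, while the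
  \<open>k\<close> extra terms add up to a single \<open>opt\<close>, which \<tau> scales below
  \<epsilon>. The constants 3 and 2 count legs of a path: a client goes to its optimal center, from
  there to a core client, and on by a short detour through the sample point to a facility about as
  near to the core client as its target. With the optimal center as target the core client
  contributes two distances, each about average; if \<open>C \<subseteq> L\<close> it is its own
  target and contributes one. The probability 1/2 is Markov's inequality: the number of uncovered
  clusters is an integer, so its expectation bounds the probability that it is not 0.\<close>

text \<open>
  Runs that have not terminated after \<open>t\<close> steps count as \<open>top\<close>, so a finite value also certifies
  the worst-case time bound \<open>t\<close>, and a value \<open>top\<close> of \<open>G\<close> marks stores that must not be reached.
\<close>

definition ev :: "distances \<Rightarrow> nat \<Rightarrow> com \<Rightarrow> (store \<Rightarrow> ennreal) \<Rightarrow> store \<Rightarrow> ennreal" where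
  "ev D t c G s =
     (\<integral>\<^sup>+cfg. (if fst cfg = SKIP then G (snd cfg) else top) \<partial>measure_pmf (steps D t (c, s)))"

lemma ev_0: "ev D 0 c G s = (if c = SKIP then G s else top)"
  by (simp add: ev_def)

lemma ev_Suc: "ev D (Suc t) c G s = (\<integral>\<^sup>+cfg. ev D t (fst cfg) G (snd cfg) \<partial>measure_pmf (step D c s))"
  by (simp add: ev_def)

lemma ev_SKIP [simp]: "ev D t SKIP G s = G s"
  by (induction t) (simp_all add: ev_0 ev_Suc)

lemma ev_mono: "(\<And>s. G s \<le> H s) \<Longrightarrow> ev D t c G s \<le> ev D t c H s"
  unfolding ev_def by (intro nn_integral_mono) auto

text \<open>\<open>SKIP\<close> is a fixed point of \<open>step\<close>, so more time can only turn
  unfinished runs, which count as \<open>top\<close>, into finished ones.\<close>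

lemma ev_Suc_le: "ev D (Suc t) c G s \<le> ev D t c G s"
proof (induction t arbitrary: c s)
  case 0
  then show ?case by (cases "c = SKIP") (simp_all add: ev_0)
next
  case (Suc t)
  show ?case
    by (subst (1 2) ev_Suc, intro nn_integral_mono) (rule Suc.IH)
qed

lemma ev_antimono: "t \<le> t' \<Longrightarrow> ev D t' c G s \<le> ev D t c G s"
  by (rule lift_Suc_antimono_le[of "\<lambda>t. ev D t c G s"]) (rule ev_Suc_le)

text \<open>The extra step is the one that rewrites \<open>Seq SKIP c2\<close> to \<open>c2\<close>.
  Only an inequality is claimed because runs in which \<open>c1\<close> stops early leave more than
  \<open>t2\<close> steps for \<open>c2\<close>.\<close>

lemma ev_Seq: "ev D (t1 + 1 + t2) (Seq c1 c2) G s \<le> ev D t1 c1 (ev D t2 c2 G) s"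
proof (induction t1 arbitrary: c1 s)
  case 0
  then show ?case by (cases "c1 = SKIP") (simp_all add: ev_0 ev_Suc)
next
  case (Suc t1)
  show ?case
  proof (cases "c1 = SKIP")
    case True
    then show ?thesis using ev_antimono[of t2 "Suc t1 + t2" D c2 G s] by (simp add: ev_Suc)
  next
    case False
    then have "ev D (Suc (t1 + 1 + t2)) (Seq c1 c2) G s
        = (\<integral>\<^sup>+cfg. ev D (t1 + 1 + t2) (Seq (fst cfg) c2) G (snd cfg) \<partial>measure_pmf (step D c1 s))"
      by (subst ev_Suc) (simp add: case_prod_beta)
    also have "\<dots> \<le> (\<integral>\<^sup>+cfg. ev D t1 (fst cfg) (ev D t2 c2 G) (snd cfg) \<partial>measure_pmf (step D c1 s))"
      by (intro nn_integral_mono) (rule Suc.IH)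
    also have "\<dots> = ev D (Suc t1) c1 (ev D t2 c2 G) s"
      by (simp add: ev_Suc)
    finally show ?thesis by simp
  qed
qed

lemma ev_SeqI:
  assumes "ev D t1 c1 H s \<le> B" and "\<And>s'. ev D t2 c2 G s' \<le> H s'" and "t1 + 1 + t2 \<le> t"
  shows "ev D t (Seq c1 c2) G s \<le> B"
proof -
  have "ev D t (Seq c1 c2) G s \<le> ev D (t1 + 1 + t2) (Seq c1 c2) G s"
    by (rule ev_antimono[OF assms(3)])
  also have "\<dots> \<le> ev D t1 c1 (ev D t2 c2 G) s" by (rule ev_Seq)
  also have "\<dots> \<le> ev D t1 c1 H s" by (rule ev_mono[OF assms(2)])
  finally show ?thesis using assms(1) by simp
qed

text \<open>A finite integral forces a finite integrand almost everywhere, which for a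
  \<open>pmf\<close> means at every point of the support. This turns an expectation bound into
  worst-case statements over all coin flips.\<close>

lemma ev_finite_imp:
  assumes "ev D t c G s < top"
  shows "halts_within D t (c, s)" and "cfg \<in> set_pmf (steps D t (c, s)) \<Longrightarrow> G (snd cfg) < top"
proof -
  have "AE cfg in measure_pmf (steps D t (c, s)). (if fst cfg = SKIP then G (snd cfg) else top) \<noteq> top"
    using assms nn_integral_noteq_infinite[of _ "measure_pmf (steps D t (c, s))"]
    unfolding ev_def infinity_ennreal_def by (simp add: less_top)
  then have *: "(if fst cfg = SKIP then G (snd cfg) else top) \<noteq> top"
    if "cfg \<in> set_pmf (steps D t (c, s))" for cfg
    using that by (simp add: AE_measure_pmf_iff)
  show "halts_within D t (c, s)"
    unfolding halts_within_def using * by (metis)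
  show "G (snd cfg) < top" if "cfg \<in> set_pmf (steps D t (c, s))"
    using *[OF that] by (auto simp: less_top split: if_splits)
qed

lemma ev_eq_nn_integral:
  assumes "halts_within D t (c, s)"
  shows "ev D t c G s = (\<integral>\<^sup>+cfg. G (snd cfg) \<partial>measure_pmf (steps D t (c, s)))"
  unfolding ev_def using assms
  by (intro nn_integral_cong_AE) (simp add: AE_measure_pmf_iff halts_within_def)

text \<open>Weakest pre-expectations, meant for loop-free code. A loop gets the vacuous value
  \<open>top\<close>, so that \<open>ev_wpe\<close> stays true for every program; loops are treated
  by \<open>ev_While\<close>.\<close>

primrec wpe :: "distances \<Rightarrow> com \<Rightarrow> (store \<Rightarrow> ennreal) \<Rightarrow> store \<Rightarrow> ennreal" where
  "wpe D SKIP G s = G s"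
| "wpe D (NAssign x i e) G s = G (nat_update x (nval i s) (nval e s) s)"
| "wpe D (RAssign x i e) G s = G (real_update x (nval i s) (rval D e s) s)"
| "wpe D (Flip x i e) G s =
     (\<integral>\<^sup>+b. G (nat_update x (nval i s) (of_bool b) s) \<partial>measure_pmf (bernoulli_pmf (rval D e s)))"
| "wpe D (Seq c1 c2) G s = wpe D c1 (wpe D c2 G) s"
| "wpe D (If b c1 c2) G s = (if bval D b s then wpe D c1 G s else wpe D c2 G s)"
| "wpe D (While b c) G s = top"

primrec tm :: "com \<Rightarrow> nat" where
  "tm SKIP = 0"
| "tm (NAssign x i e) = 1"
| "tm (RAssign x i e) = 1"
| "tm (Flip x i e) = 1"
| "tm (Seq c1 c2) = tm c1 + 1 + tm c2"
| "tm (If b c1 c2) = 1 + max (tm c1) (tm c2)"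
| "tm (While b c) = 0"

lemma ev_wpe: "ev D (tm c) c G s \<le> wpe D c G s"
proof (induction c arbitrary: G s)
  case (Seq c1 c2)
  show ?case using ev_SeqI[OF Seq.IH(1) Seq.IH(2) order_refl] by simp
next
  case (If b c1 c2)
  have "ev D (max (tm c1) (tm c2)) c1 G s \<le> wpe D c1 G s" "ev D (max (tm c1) (tm c2)) c2 G s \<le> wpe D c2 G s"
    using If.IH ev_antimono order_trans max.cobounded1 max.cobounded2 by metis+
  then show ?case by (simp add: ev_Suc)
qed (simp_all add: ev_Suc)

lemma ev_wpeI: "wpe D c G s \<le> B \<Longrightarrow> tm c \<le> t \<Longrightarrow> ev D t c G s \<le> B"
  using ev_wpe ev_antimono order_trans by metis

text \<open>\<open>F n\<close> is an expectation bound and an invariant in one: stores where it is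
  \<open>top\<close> are excluded at iteration \<open>n\<close>. An iteration costs
  \<open>tb\<close> steps, one for unfolding the loop and one for discarding \<open>SKIP\<close>;
  the final test costs one more.\<close>

lemma ev_While:
  assumes body: "\<And>n s. n < N \<Longrightarrow> F n s < top \<Longrightarrow> bval D b s \<and> ev D tb c (F (Suc n)) s \<le> F n s"
    and exit: "\<And>s. F N s < top \<Longrightarrow> \<not> bval D b s"
  shows "ev D (N * (tb + 2) + 1) (While b c) (F N) s \<le> F 0 s"
proof -
  have "ev D ((N - n) * (tb + 2) + 1) (While b c) (F N) s \<le> F n s" if "n \<le> N" for n s
    using that
  proof (induction n arbitrary: s rule: inc_induct)
    case base
    then show ?case
    proof (cases "F N s < top")
      case True
      then show ?thesis using exit by (simp add: ev_Suc)
    qed (simp add: less_top[symmetric])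
  next
    case (step n)
    then show ?case
    proof (cases "F n s < top")
      case True
      have e: "(N - n) * (tb + 2) + 1 = Suc (tb + 1 + ((N - Suc n) * (tb + 2) + 1))"
        using step.hyps by (simp add: Suc_diff_Suc[symmetric])
      have "ev D (tb + 1 + ((N - Suc n) * (tb + 2) + 1)) (Seq c (While b c)) (F N) s \<le> F n s"
        by (rule ev_SeqI[OF _ step.IH order_refl]) (use body True step.hyps in blast)
      then show ?thesis
        unfolding e using body[OF _ True] step.hyps by (simp add: ev_Suc)
    qed (simp add: less_top[symmetric])
  qed
  from this[of 0 s] show ?thesis by simp
qed

text \<open>A postcondition becomes an expectation with values 0 and \<open>top\<close>. Total
  correctness within \<open>t\<close> steps (\<open>ok\<close>) is then the case of expectation 0
  and inherits the rules for \<open>ev\<close>.\<close>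

definition emb :: "(store \<Rightarrow> bool) \<Rightarrow> store \<Rightarrow> ennreal" where
  "emb Q s = (if Q s then 0 else top)"

lemma emb_simps [simp]: "emb Q s = 0 \<longleftrightarrow> Q s" "emb Q s \<le> 0 \<longleftrightarrow> Q s" "emb Q s < top \<longleftrightarrow> Q s" "emb Q s = top \<longleftrightarrow> \<not> Q s"
  by (auto simp: emb_def)

definition ok :: "distances \<Rightarrow> nat \<Rightarrow> com \<Rightarrow> (store \<Rightarrow> bool) \<Rightarrow> store \<Rightarrow> bool" where
  "ok D t c Q s \<longleftrightarrow> ev D t c (emb Q) s = 0"

text \<open>The bridge between the two styles: program pieces with a determined effect are verified
  with \<open>ok\<close>, and their result enters the probabilistic argument here.\<close>

lemma ok_ev:
  assumes "ok D t c Q s" and "\<And>s'. Q s' \<Longrightarrow> G s' \<le> B"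
  shows "ev D t c G s \<le> B"
proof -
  have fin: "ev D t c (emb Q) s < top" using assms(1) by (simp add: ok_def)
  have h: "halts_within D t (c, s)" by (rule ev_finite_imp(1)[OF fin])
  have "(\<integral>\<^sup>+cfg. G (snd cfg) \<partial>measure_pmf (steps D t (c, s))) \<le> (\<integral>\<^sup>+cfg. B \<partial>measure_pmf (steps D t (c, s)))"
    by (intro nn_integral_mono_AE)
      (use ev_finite_imp(2)[OF fin] assms(2) in \<open>auto simp: AE_measure_pmf_iff\<close>)
  then show ?thesis by (simp add: ev_eq_nn_integral[OF h])
qed

lemma ok_weaken:
  assumes "ok D t c R s" and "\<And>s'. R s' \<Longrightarrow> Q s'" and "t \<le> t'"
  shows "ok D t' c Q s"
proof -
  have "ev D t' c (emb Q) s \<le> ev D t c (emb Q) s" by (rule ev_antimono[OF assms(3)])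
  also have "\<dots> \<le> 0" by (rule ok_ev[OF assms(1)]) (use assms(2) in auto)
  finally show ?thesis by (simp add: ok_def)
qed

lemma ok_wpe: "wpe D c (emb Q) s = 0 \<Longrightarrow> tm c \<le> t \<Longrightarrow> ok D t c Q s"
  unfolding ok_def using ev_wpeI[of D c "emb Q" s 0 t] by simp

lemma ok_Seq:
  assumes "ok D t1 c1 R s" and "\<And>s'. R s' \<Longrightarrow> ok D t2 c2 Q s'" and "t1 + 1 + t2 \<le> t"
  shows "ok D t (Seq c1 c2) Q s"
proof -
  have "ev D t (Seq c1 c2) (emb Q) s \<le> 0"
  proof (rule ev_SeqI[OF _ _ assms(3)])
    show "ev D t1 c1 (emb R) s \<le> 0" using assms(1) by (simp add: ok_def)
    show "ev D t2 c2 (emb Q) s' \<le> emb R s'" for s'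
      using assms(2) by (cases "R s'") (auto simp: ok_def emb_def)
  qed
  then show ?thesis by (simp add: ok_def)
qed

lemma ok_While:
  assumes "I 0 s"
    and body: "\<And>n s. n < N \<Longrightarrow> I n s \<Longrightarrow> bval D b s \<and> ok D tb c (I (Suc n)) s"
    and exit: "\<And>s. I N s \<Longrightarrow> \<not> bval D b s"
  shows "ok D (N * (tb + 2) + 1) (While b c) (I N) s"
proof -
  have "ev D (N * (tb + 2) + 1) (While b c) (emb (I N)) s \<le> emb (I 0) s"
    by (rule ev_While[where F = "\<lambda>n. emb (I n)"]) (use body exit in \<open>auto simp: ok_def\<close>)
  then show ?thesis using assms(1) by (simp add: ok_def emb_def)
qed

section \<open>Counting loops\<close>

abbreviation nvar :: "string \<Rightarrow> nexp" where "nvar x \<equiv> NCell x (NConst 0)"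
abbreviation rvar :: "string \<Rightarrow> rexp" where "rvar x \<equiv> RCell x (NConst 0)"
abbreviation nset :: "string \<Rightarrow> nexp \<Rightarrow> com" where "nset x \<equiv> NAssign x (NConst 0)"
abbreviation rset :: "string \<Rightarrow> rexp \<Rightarrow> com" where "rset x \<equiv> RAssign x (NConst 0)"

definition For :: "string \<Rightarrow> nexp \<Rightarrow> com \<Rightarrow> com" where
  "For i e c = Seq (nset i (NConst 0))
     (While (NLess (nvar i) e) (Seq c (nset i (NPlus (nvar i) (NConst 1)))))"

lemma nats_nat_update [simp]: "nats (nat_update x i v s) = (nats s)(x := (nats s x)(i := v))"
  and reals_nat_update [simp]: "reals (nat_update x i v s) = reals s"
  and nats_real_update [simp]: "nats (real_update x i w s) = nats s"
  and reals_real_update [simp]: "reals (real_update x i w s) = (reals s)(x := (reals s x)(i := w))"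
  by (simp_all add: nat_update_def real_update_def)

text \<open>A body that changes the counter is charged \<open>top\<close>, and since the limit
  \<open>e\<close> is evaluated anew at every test, it must keep the value \<open>N\<close>. Of the
  4 extra steps per iteration, 2 belong to \<open>While\<close> and 2 to the increment and its
  \<open>Seq\<close>.\<close>

lemma ev_For:
  assumes body: "\<And>n s. n < N \<Longrightarrow> nats s i 0 = n \<Longrightarrow> F n s < top \<Longrightarrow>
      ev D tb c (\<lambda>s'. if nats s' i 0 = n then F (Suc n) (nat_update i 0 (Suc n) s') else top) s \<le> F n s"
    and bound: "\<And>n s. n \<le> N \<Longrightarrow> nats s i 0 = n \<Longrightarrow> F n s < top \<Longrightarrow> nval e s = N"
    and init: "F 0 (nat_update i 0 0 s) \<le> B"
    and t: "N * (tb + 4) + 3 \<le> t"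
  shows "ev D t (For i e c) (F N) s \<le> B"
proof -
  let ?F = "\<lambda>n s. if nats s i 0 = n then F n s else top"
  let ?body = "Seq c (nset i (NPlus (nvar i) (NConst 1)))"
  have "ev D (N * ((tb + 2) + 2) + 1) (While (NLess (nvar i) e) ?body) (?F N) s \<le> ?F 0 s" for s
  proof (rule ev_While)
    fix n s assume n: "n < N" and fin: "?F n s < top"
    then have i: "nats s i 0 = n" by (auto split: if_splits)
    have "ev D (tb + 2) ?body (?F (Suc n)) s \<le> F n s"
    proof (rule ev_SeqI[of _ tb _ _ _ _ 1])
      show "ev D tb c (\<lambda>s'. if nats s' i 0 = n then F (Suc n) (nat_update i 0 (Suc n) s') else top) s \<le> F n s"
        by (rule body) (use n i fin in auto)
      show "ev D 1 (nset i (NPlus (nvar i) (NConst 1))) (?F (Suc n)) s'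
         \<le> (if nats s' i 0 = n then F (Suc n) (nat_update i 0 (Suc n) s') else top)" for s'
        by (rule ev_wpeI) auto
    qed simp
    then show "bval D (NLess (nvar i) e) s \<and> ev D (tb + 2) ?body (?F (Suc n)) s \<le> ?F n s"
      using i n bound[of n s] fin by simp
  next
    fix s assume fin: "?F N s < top"
    then show "\<not> bval D (NLess (nvar i) e) s"
      using bound[of N s] by (auto split: if_splits)
  qed
  then have w: "ev D (N * ((tb + 2) + 2) + 1) (While (NLess (nvar i) e) ?body) (F N) s \<le> ?F 0 s" for s
    by (rule order_trans[OF ev_mono, rotated]) auto
  show ?thesis
    unfolding For_def
  proof (rule ev_SeqI[OF _ w])
    show "ev D 1 (nset i (NConst 0)) (?F 0) s \<le> B"
      by (rule ev_wpeI) (use init in auto)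
  qed (use t in \<open>simp add: algebra_simps\<close>)
qed

lemma ok_For:
  assumes body: "\<And>n s. n < N \<Longrightarrow> nats s i 0 = n \<Longrightarrow> I n s \<Longrightarrow>
      ok D tb c (\<lambda>s'. nats s' i 0 = n \<and> I (Suc n) (nat_update i 0 (Suc n) s')) s"
    and bound: "\<And>n s. n \<le> N \<Longrightarrow> nats s i 0 = n \<Longrightarrow> I n s \<Longrightarrow> nval e s = N"
    and init: "I 0 (nat_update i 0 0 s)"
    and t: "N * (tb + 4) + 3 \<le> t"
  shows "ok D t (For i e c) (I N) s"
proof -
  have "ev D t (For i e c) (emb (I N)) s \<le> 0"
  proof (rule ev_For[OF _ _ _ t])
    fix n s assume "n < N" "nats s i 0 = n" "emb (I n) s < top"
    then show "ev D tb c (\<lambda>s'. if nats s' i 0 = n then emb (I (Suc n)) (nat_update i 0 (Suc n) s') else top) s \<le> emb (I n) s"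
      by (intro order_trans[OF ok_ev[OF body, where B = 0]]) (simp_all, simp add: emb_def)
  qed (use bound init in auto)
  then show ?thesis by (simp add: ok_def)
qed

section \<open>Greedy assignment of facilities\<close>

text \<open>The value \<open>f\<close>, which is no facility index, stands for "no free facility
  seen yet". The recursion copies the scan performed by \<open>find_nearest\<close>, with ties going
  to the smaller index.\<close>

primrec near :: "nat \<Rightarrow> (nat \<Rightarrow> real) \<Rightarrow> nat set \<Rightarrow> nat \<Rightarrow> nat" where
  "near f c U 0 = f"
| "near f c U (Suc g) =
     (if g \<notin> U \<and> (near f c U g = f \<or> c g < c (near f c U g)) then g else near f c U g)"

lemma near_cases:
  "n \<le> f \<Longrightarrow> near f c U n = f \<and> {..<n} \<subseteq> U \<or>
     near f c U n < n \<and> near f c U n \<notin> U \<and> (\<forall>g<n. g \<notin> U \<longrightarrow> c (near f c U n) \<le> c g)"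
proof (induction n)
  case (Suc n)
  then have "near f c U n = f \<and> {..<n} \<subseteq> U \<or>
     near f c U n < n \<and> near f c U n \<notin> U \<and> (\<forall>g<n. g \<notin> U \<longrightarrow> c (near f c U n) \<le> c g)" by simp
  then show ?case
  proof
    assume *: "near f c U n = f \<and> {..<n} \<subseteq> U"
    then show ?thesis by (auto simp: less_Suc_eq lessThan_Suc)
  next
    assume *: "near f c U n < n \<and> near f c U n \<notin> U \<and> (\<forall>g<n. g \<notin> U \<longrightarrow> c (near f c U n) \<le> c g)"
    moreover have "near f c U n \<noteq> f" using * Suc.prems by auto
    ultimately show ?thesis
      by (cases "n \<notin> U \<and> c n < c (near f c U n)") (force simp: less_Suc_eq)+
  qed
qed simp

lemma near_free:
  assumes "g < f" "g \<notin> U"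
  shows "near f c U f < f" "near f c U f \<notin> U" "c (near f c U f) \<le> c g"
  using near_cases[of f f c U] assms by auto

primrec greedy :: "nat \<Rightarrow> (nat \<Rightarrow> real) list \<Rightarrow> nat set \<Rightarrow> nat list" where
  "greedy f [] U = []"
| "greedy f (c # cs) U = near f c U f # greedy f cs (insert (near f c U f) U)"

lemma length_greedy [simp]: "length (greedy f cs U) = length cs"
  by (induction cs arbitrary: U) auto

lemma greedy_snoc:
  "greedy f (cs @ [c]) U = greedy f cs U @ [near f c (U \<union> set (greedy f cs U)) f]"
  by (induction cs arbitrary: U) auto

lemma take_greedy: "take i (greedy f cs U) = greedy f (take i cs) U"
proof (induction cs arbitrary: i U)
  case (Cons c cs)
  then show ?case by (cases i) simp_all
qed simp

text \<open>The recursion peels the greedy list at its head; this form extends it at its end, as a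
  loop that chooses one center at a time does.\<close>

lemma take_Suc_greedy:
  assumes "i < length cs"
  shows "take (Suc i) (greedy f cs U) =
    take i (greedy f cs U) @ [near f (cs ! i) (U \<union> set (take i (greedy f cs U))) f]"
  using assms by (simp add: take_greedy take_Suc_conv_app_nth greedy_snoc)

lemma greedy_distinct:
  assumes "U \<subseteq> {..<f}" and "card U + length cs \<le> f"
  shows "distinct (greedy f cs U) \<and> set (greedy f cs U) \<subseteq> {..<f} - U"
  using assms
proof (induction cs arbitrary: U)
  case (Cons c cs)
  have fin: "finite U" using Cons.prems(1) finite_subset by blast
  have "card U < card {..<f}" using Cons.prems by simp
  then obtain g where "g < f" "g \<notin> U"
    by (metis lessThan_iff subsetI card_mono fin leD)
  then have n: "near f c U f < f" "near f c U f \<notin> U" by (rule near_free)+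
  have "distinct (greedy f cs (insert (near f c U f) U)) \<and>
      set (greedy f cs (insert (near f c U f) U)) \<subseteq> {..<f} - insert (near f c U f) U"
    by (rule Cons.IH) (use Cons.prems n fin in auto)
  then show ?case using n by auto
qed simp

text \<open>Take a nonempty invariant subset of least cardinality: its image is again such a subset,
  so no element can be lost. It plays the role of a cycle in a finite functional graph.\<close>

lemma exists_invariant_subset_inj_on:
  assumes "finite I" "I \<noteq> {}" "s ` I \<subseteq> I"
  shows "\<exists>A\<subseteq>I. A \<noteq> {} \<and> s ` A = A \<and> inj_on s A"
proof -
  let ?Q = "\<lambda>A. A \<noteq> {} \<and> A \<subseteq> I \<and> s ` A \<subseteq> A"
  have "?Q I" using assms by auto
  then obtain A where A: "?Q A" and min: "\<And>B. ?Q B \<Longrightarrow> card A \<le> card B"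
    using ex_has_least_nat[of ?Q I card] by metis
  have fin: "finite A" using A assms(1) finite_subset by blast
  have "?Q (s ` A)" using A by auto
  then have "card A \<le> card (s ` A)" by (rule min)
  then have "inj_on s A" by (metis card_image_le eq_card_imp_inj_on fin le_antisym)
  moreover have "s ` A = A"
    using A \<open>card A \<le> card (s ` A)\<close> by (metis card_seteq fin)
  ultimately show ?thesis using A by blast
qed

text \<open>
  Top trading cycles: if everyone's favourite is the target of somebody else, then reassigning
  targets along a cycle of ``my favourite is your target'' gives somebody her favourite.
\<close>

lemma exists_favourite_assignment:
  assumes "finite I" "I \<noteq> {}" "inj_on t I"
  shows "\<exists>t' i. i \<in> I \<and> inj_on t' I \<and> t' ` I \<subseteq> t ` I \<and> b i \<notin> t' ` (I - {i}) \<and>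
           (\<forall>j\<in>I. t' j = t j \<or> t' j = b j)"
proof (cases "\<exists>i\<in>I. b i \<notin> t ` (I - {i})")
  case True
  then show ?thesis using assms(3) by (metis order_refl)
next
  case False
  then have "\<forall>i\<in>I. \<exists>j. j \<in> I \<and> b i = t j" by auto
  then obtain s where s: "\<And>i. i \<in> I \<Longrightarrow> s i \<in> I \<and> b i = t (s i)" by metis
  then have "s ` I \<subseteq> I" by auto
  then obtain A where A: "A \<subseteq> I" "A \<noteq> {}" "s ` A = A" "inj_on s A"
    using exists_invariant_subset_inj_on[OF assms(1,2)] by metis
  define s' where "s' i = (if i \<in> A then s i else i)" for i
  have "inj_on s' I"
    using A(3,4) unfolding inj_on_def s'_def by (metis imageI)
  moreover have im: "s' ` I \<subseteq> I" using s by (auto simp: s'_def)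
  ultimately have inj: "inj_on (t \<circ> s') I"
    using assms(3) by (meson comp_inj_on inj_on_subset)
  obtain i where i: "i \<in> A" using A(2) by blast
  have ti: "(t \<circ> s') i = b i" using i A(1) s by (auto simp: s'_def)
  have "b i \<notin> (t \<circ> s') ` (I - {i})"
    unfolding ti[symmetric] using inj i A(1) by (auto simp: inj_on_def)
  moreover have "(t \<circ> s') ` I \<subseteq> t ` I" using im by auto
  moreover have "\<forall>j\<in>I. (t \<circ> s') j = t j \<or> (t \<circ> s') j = b j"
    using s A(1) by (auto simp: s'_def)
  ultimately show ?thesis using inj i A(1) by blast
qed

text \<open>After the targets are rearranged, some \<open>i\<close> has a favourite that nobody else
  is assigned. It goes first, and the others follow by induction with this facility marked as used;
  hence targets and used set vary in the induction.\<close>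

lemma exists_greedy_order:
  assumes "finite I" "inj_on t I" "t ` I \<subseteq> {..<f} - U" "U \<subseteq> {..<f}"
  shows "\<exists>js. distinct js \<and> set js = I \<and>
    (\<forall>j<length js. c (js ! j) (greedy f (map c js) U ! j) \<le> c (js ! j) (t (js ! j)))"
  using assms
proof (induction "card I" arbitrary: I t U)
  case 0
  then show ?case by (intro exI[of _ "[]"]) auto
next
  case (Suc n)
  let ?b = "\<lambda>i. near f (c i) U f"
  have "I \<noteq> {}" using Suc.hyps(2) by auto
  from exists_favourite_assignment[OF Suc.prems(1) this Suc.prems(2), of ?b]
  obtain t' i where t': "i \<in> I" "inj_on t' I" "t' ` I \<subseteq> t ` I" "?b i \<notin> t' ` (I - {i})"
    "\<And>j. j \<in> I \<Longrightarrow> t' j = t j \<or> t' j = ?b j" by blast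
  have tfree: "t j < f" "t j \<notin> U" if "j \<in> I" for j using Suc.prems(3) that by auto
  have best: "c j (?b j) \<le> c j (t j)" if "j \<in> I" for j
    using near_free(3)[OF tfree[OF that]] .
  \<comment> \<open>A rearranged target is the old one or the favourite, and the favourite is at
    least as near as any free facility.\<close>
  then have le: "c j (t' j) \<le> c j (t j)" if "j \<in> I" for j using t'(5) that by force
  have "\<exists>js. distinct js \<and> set js = I - {i} \<and>
    (\<forall>j<length js. c (js ! j) (greedy f (map c js) (insert (?b i) U) ! j) \<le> c (js ! j) (t' (js ! j)))"
  proof (rule Suc.hyps(1))
    show "n = card (I - {i})" using Suc.hyps(2) Suc.prems(1) t'(1) by simp
    show "inj_on t' (I - {i})" using t'(2) by (rule inj_on_subset) auto
    show "t' ` (I - {i}) \<subseteq> {..<f} - insert (?b i) U" using t'(3,4) Suc.prems(3) by blast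
    show "insert (?b i) U \<subseteq> {..<f}" using near_free(1)[OF tfree[OF t'(1)]] Suc.prems(4) by auto
  qed (use Suc.prems in auto)
  then obtain "js" where js: "distinct js" "set js = I - {i}"
    "\<And>j. j < length js \<Longrightarrow> c (js ! j) (greedy f (map c js) (insert (?b i) U) ! j) \<le> c (js ! j) (t' (js ! j))"
    by blast
  have "c ((i # js) ! j) (greedy f (map c (i # js)) U ! j) \<le> c ((i # js) ! j) (t ((i # js) ! j))"
    if "j < length (i # js)" for j
  proof (cases j)
    case 0
    then show ?thesis using best t'(1) by simp
  next
    case (Suc j')
    then have j': "j' < length js" using that by simp
    then have "js ! j' \<in> I" using js(2) nth_mem by blast
    then show ?thesis using js(3)[OF j'] le[of "js ! j'"] Suc by simp
  qed
  then show ?case using js(1,2) t'(1) by (intro exI[of _ "i # js"]) auto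
qed

text \<open>Base-\<open>K\<close> digits, least significant first: counting \<open>j\<close> up to
  \<open>K ^ k\<close> runs through all \<open>k\<close>-tuples, which replaces nested loops of
  variable depth.\<close>

lemma exists_digits:
  assumes "\<And>i. i < k \<Longrightarrow> a i < (K::nat)"
  shows "\<exists>j<K ^ k. \<forall>i<k. j div K ^ i mod K = a i"
  using assms
proof (induction k arbitrary: a)
  case (Suc k)
  then obtain j where j: "j < K ^ k" "\<And>i. i < k \<Longrightarrow> j div K ^ i mod K = a (Suc i)"
    using Suc.IH[of "\<lambda>i. a (Suc i)"] Suc.prems by (metis Suc_less_eq)
  have a0: "a 0 < K" using Suc.prems by simp
  have "K * j + a 0 < K * Suc j" using a0 by simp
  also have "\<dots> \<le> K ^ Suc k" using j(1) by (simp only: power_Suc, intro mult_le_mono) auto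
  finally have "K * j + a 0 < K ^ Suc k" .
  moreover have "(K * j + a 0) div K ^ i mod K = a i" if "i < Suc k" for i
    using that j(2) a0 by (cases i) (simp_all add: div_mult2_eq)
  ultimately show ?case by blast
qed simp

section \<open>Covering clusters by sampling\<close>

lemma convex_on_powr_nonneg:
  assumes "1 \<le> (p::real)"
  shows "convex_on {0..} (\<lambda>x. x powr p)"
proof (rule convex_onI)
  fix t x y :: real
  assume t: "0 < t" "t < 1" and xy: "x \<in> {0..}" "y \<in> {0..}"
  \<comment> \<open>Distances may be 0. With an endpoint 0, convexity reduces to
    \<open>u powr p \<le> u\<close> for \<open>0 < u < 1\<close>.\<close>
  have shrink: "(u * z) powr p \<le> u * z powr p" if "0 < u" "u < 1" "0 \<le> z" for u z :: real
  proof -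
    have "u powr p \<le> u powr 1" using that assms by (intro powr_mono') auto
    then have "u powr p * z powr p \<le> u * z powr p" using that by (intro mult_right_mono) auto
    then show ?thesis using that by (simp add: powr_mult)
  qed
  show "((1 - t) *\<^sub>R x + t *\<^sub>R y) powr p \<le> (1 - t) * x powr p + t * y powr p"
  proof (cases "x = 0 \<or> y = 0")
    case True
    then show ?thesis using shrink[of t y] shrink[of "1 - t" x] t xy assms by auto
  next
    case False
    then show ?thesis
      using convex_onD[OF powr_convex[OF assms], of t x y] t xy by auto
  qed
qed simp

lemma powr_jensen3:
  fixes l a b c \<alpha> \<beta> \<gamma> :: real
  assumes "1 \<le> l" "0 \<le> a" "0 \<le> b" "0 \<le> c" "0 \<le> \<alpha>" "0 \<le> \<beta>" "0 \<le> \<gamma>" "\<alpha> + \<beta> + \<gamma> = 1"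
  shows "(\<alpha> * a + \<beta> * b + \<gamma> * c) powr l \<le> \<alpha> * a powr l + \<beta> * b powr l + \<gamma> * c powr l"
proof -
  let ?w = "\<lambda>i::nat. if i = 0 then \<alpha> else if i = 1 then \<beta> else \<gamma>"
  let ?z = "\<lambda>i::nat. if i = 0 then a else if i = 1 then b else c"
  have "(\<Sum>i\<in>{0,1,2}. ?w i *\<^sub>R ?z i) powr l \<le> (\<Sum>i\<in>{0,1,2}. ?w i * ?z i powr l)"
    by (rule convex_on_sum[OF _ _ convex_on_powr_nonneg[OF assms(1)]]) (use assms in auto)
  then show ?thesis by (simp add: add.assoc)
qed

lemma powr_sum3_le:
  fixes l a b c :: real
  assumes "0 \<le> l" "0 \<le> a" "0 \<le> b" "0 \<le> c"
  shows "(a + b + c) powr l \<le> 3 powr l * (a powr l + b powr l + c powr l)"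
proof -
  let ?M = "max a (max b c)"
  have "(a + b + c) powr l \<le> (3 * ?M) powr l" using assms by (intro powr_mono2) auto
  also have "\<dots> = 3 powr l * ?M powr l" using assms by (subst powr_mult) auto
  also have "\<dots> \<le> 3 powr l * (a powr l + b powr l + c powr l)"
    by (intro mult_left_mono) (auto simp: max_def)
  finally show ?thesis .
qed

locale clustered_instance = Metric_space X d
  for X :: "'a set" and d :: "'a \<Rightarrow> 'a \<Rightarrow> real" +
  fixes C :: "'a set" and P :: "nat \<Rightarrow> 'a set" and ctr :: "nat \<Rightarrow> 'a" and k :: nat and l \<epsilon> :: real
  assumes finC: "finite C" and CX: "C \<subseteq> X" and k: "0 < k" and l: "1 \<le> l" and \<epsilon>: "0 < \<epsilon>" "\<epsilon> \<le> 1"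
    and ctr: "\<And>i. i \<in> {1..k} \<Longrightarrow> ctr i \<in> X" and P: "clustering C k P"
begin

text \<open>
  All parameters are powers of \<open>R \<ge> 2\<close>; since \<open>k\<close>, \<open>1/\<epsilon>\<close>, \<open>l\<close> and \<open>3\<^sup>l\<close> are also bounded by powers of
  \<open>R\<close>, every inequality between them reduces to one between exponents.  The exponent \<open>l\<^sup>2\<close> of \<open>\<tau>\<close>
  comes from the factor \<open>\<theta>\<^bsup>1 - l\<^esup>\<close> that splitting off a term of weight \<open>\<theta>\<close> by convexity costs.
\<close>

definition "R = 1 + real k / \<epsilon>"
definition "\<delta> = R powr (- 5 * l)"
definition "\<theta> = R powr (- 8 * l)"
definition "\<tau> = R powr (- 8 * l\<^sup>2)"
definition "q = R powr (- 38 * l\<^sup>2)"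

definition "cost i = (\<Sum>x\<in>P i. d x (ctr i) powr l)"
definition "opt = (\<Sum>i=1..k. cost i)"
definition "csize i = real (card (P i))"
definition "wt T x = Min ((\<lambda>p. d x p powr l) ` T)"
text \<open>The inequality is multiplied by the cluster size, so that no average over a possibly
  empty cluster has to be formed.\<close>

definition "core i = {x \<in> P i. csize i * d x (ctr i) powr l \<le> (1 + \<delta>) * cost i}"
text \<open>The quantity \<open>csize i * d x p powr l\<close> is what the cluster pays if each of
  its clients makes the detour from \<open>x\<close> to \<open>p\<close>. Empty clusters cost
  nothing and need no representative.\<close>

definition "covered T i \<longleftrightarrow> P i = {} \<or>
  (\<exists>p\<in>T. \<exists>x\<in>core i. csize i * d x p powr l \<le> \<tau> * (cost i + opt / k))"
definition "uncovered T = card {i \<in> {1..k}. \<not> covered T i}"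

section \<open>Inequalities between the parameters\<close>

lemma R_ge: "2 \<le> R" "1 / \<epsilon> \<le> R" "real k \<le> R"
proof -
  have k1: "1 \<le> real k" using k by simp
  have a: "1 / \<epsilon> \<le> real k / \<epsilon>" using k1 \<epsilon> by (intro divide_right_mono) auto
  have b: "real k \<le> real k / \<epsilon>" using k1 \<epsilon> by (simp add: field_simps)
  show "1 / \<epsilon> \<le> R" "real k \<le> R" "2 \<le> R" using a b k1 unfolding R_def by linarith+
qed

lemma R_pos: "0 < R" "1 \<le> R" using R_ge by auto

lemma R_powr_mono: "a \<le> b \<Longrightarrow> R powr a \<le> R powr b"
  using R_pos by (intro powr_mono) auto

lemma l_sq: "l \<le> l\<^sup>2" "1 \<le> l\<^sup>2"
proof -
  show "l \<le> l\<^sup>2" using l by (simp add: power2_eq_square)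
  then show "1 \<le> l\<^sup>2" using l by linarith
qed

lemma three_powr_le: "3 powr l \<le> R powr (2 * l)"
proof -
  have "(3::real) \<le> 2 powr 2" by simp
  also have "\<dots> \<le> R powr 2" using R_ge by (intro powr_mono2) auto
  finally have "3 powr l \<le> (R powr 2) powr l" using l by (intro powr_mono2) auto
  then show ?thesis by (simp add: powr_powr)
qed

lemma const_le: "c \<le> 2 ^ n \<Longrightarrow> c \<le> R powr (real n)"
proof -
  assume "c \<le> 2 ^ n"
  also have "(2::real) ^ n \<le> R ^ n" using R_ge by (intro power_mono) auto
  finally show ?thesis using R_pos by (simp add: powr_realpow)
qed

lemma params_pos: "0 < \<delta>" "0 < \<theta>" "0 < \<tau>" "0 < q"
  using R_pos by (auto simp: \<delta>_def \<theta>_def \<tau>_def q_def)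

lemma eps_ge: "R powr (- 1) \<le> \<epsilon>"
proof -
  have "1 \<le> R * \<epsilon>" using R_ge(2) \<epsilon> by (simp add: field_simps)
  then show ?thesis using R_pos by (simp add: powr_minus field_simps)
qed

text \<open>Two factors \<open>1 + \<delta>\<close> arise, one from the definition of
  \<open>core\<close> and one from \<open>theta_bounds\<close>. Their product is at most
  \<open>1 + 3 * \<delta>\<close>, which spends three quarters of \<epsilon>.\<close>

lemma delta_bounds: "\<delta> \<le> 1 / 2" "3 powr l * (3 * \<delta>) \<le> 3 / 4 * \<epsilon>"
proof -
  have "\<delta> \<le> R powr (- 1)" unfolding \<delta>_def using l by (intro R_powr_mono) auto
  also have "\<dots> \<le> 1 / 2" using R_ge by (simp add: powr_minus field_simps)
  finally show "\<delta> \<le> 1 / 2" .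
  have "4 * (3 powr l * \<delta>) \<le> R powr 2 * (R powr (2 * l) * R powr (- 5 * l))"
    unfolding \<delta>_def using three_powr_le const_le[of 4 2] by (intro mult_mono) auto
  also have "\<dots> = R powr (2 + (2 * l + (- 5 * l)))" by (simp only: powr_add)
  also have "\<dots> \<le> R powr (- 1)" using l by (intro R_powr_mono) auto
  also have "\<dots> \<le> \<epsilon>" by (rule eps_ge)
  finally have "4 * (3 powr l * \<delta>) \<le> \<epsilon>" .
  moreover have "3 powr l * (3 * \<delta>) = 3 * (3 powr l * \<delta>)" by simp
  ultimately show "3 powr l * (3 * \<delta>) \<le> 3 / 4 * \<epsilon>" by linarith
qed

lemma l_le_R_powr: "l \<le> R powr l"
proof -
  have "1 + l * ln 2 \<le> exp (l * ln 2)" by (rule exp_ge_add_one_self)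
  moreover have "exp (l * ln 2) = 2 powr l" by (simp add: powr_def)
  moreover have "l * (1/2) \<le> l * ln 2" using l ln2_ge_two_thirds by (intro mult_left_mono) auto
  ultimately have "1 + l / 2 \<le> 2 powr l" by linarith
  have "l \<le> 2 powr l"
  proof (cases "l \<le> 2")
    case True
    have "2 powr 1 \<le> 2 powr l" using l by (intro powr_mono) auto
    then show ?thesis using True by simp
  next
    case False
    \<comment> \<open>The square root of \<open>2 powr l\<close> is at least
      \<open>1 + l / 3\<close>, and the square of this linear bound already exceeds
      \<open>l\<close>.\<close>
    have "1 + (l / 2) * ln 2 \<le> exp ((l / 2) * ln 2)" by (rule exp_ge_add_one_self)
    moreover have "(l / 2) * (2/3) \<le> (l / 2) * ln 2" using l ln2_ge_two_thirds by (intro mult_left_mono) auto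
    ultimately have h: "1 + l / 3 \<le> exp ((l / 2) * ln 2)" by linarith
    have "(1 + l / 3)\<^sup>2 \<le> (exp ((l / 2) * ln 2))\<^sup>2" using h l by (intro power_mono) auto
    also have "\<dots> = exp (2 * ((l / 2) * ln 2))" by (rule exp_double[symmetric])
    also have "\<dots> = 2 powr l" by (simp add: powr_def)
    finally have "(1 + l / 3)\<^sup>2 \<le> 2 powr l" .
    moreover have "l \<le> (1 + l / 3)\<^sup>2"
    proof -
      have "(1 + l / 3)\<^sup>2 - l = (l / 3 - 1/2)\<^sup>2 + 3/4" by (simp add: power2_eq_square field_simps)
      then show ?thesis using zero_le_power2[of "l / 3 - 1/2"] by linarith
    qed
    ultimately show ?thesis by linarith
  qed
  also have "2 powr l \<le> R powr l" using R_ge l by (intro powr_mono2) auto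
  finally show ?thesis .
qed

text \<open>Giving the main terms only the total weight \<open>1 - \<theta>\<close> in a convex
  combination costs the factor \<open>(1 - \<theta>) powr (1 - l)\<close>. Its logarithm is at most
  \<open>2 * l * \<theta>\<close>, so \<theta> must be smaller than \<delta> by a factor of order
  \<open>l\<close>.\<close>

lemma theta_bounds: "4 * l * \<theta> \<le> \<delta>" "\<theta> \<le> 1 / 2" "(1 - \<theta>) powr (1 - l) \<le> 1 + \<delta>"
proof -
  have "4 * l * \<theta> \<le> R powr 2 * R powr l * R powr (- 8 * l)"
    unfolding \<theta>_def using l_le_R_powr const_le[of 4 2] l by (intro mult_mono) auto
  also have "\<dots> = R powr (2 + l + (- 8 * l))" by (simp only: powr_add)
  also have "\<dots> \<le> \<delta>" unfolding \<delta>_def using l by (intro R_powr_mono) auto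
  finally show th: "4 * l * \<theta> \<le> \<delta>" .
  have "\<theta> \<le> l * \<theta>" using l params_pos by simp
  then show th2: "\<theta> \<le> 1 / 2" using th delta_bounds params_pos by linarith
  have "- \<theta> - 2 * \<theta>\<^sup>2 \<le> ln (1 - \<theta>)"
    using ln_one_minus_pos_lower_bound[of \<theta>] th2 params_pos by simp
  moreover have "2 * \<theta>\<^sup>2 \<le> \<theta>" using th2 params_pos by (simp add: power2_eq_square)
  ultimately have a: "- ln (1 - \<theta>) \<le> 2 * \<theta>" by linarith
  have "(1 - l) * ln (1 - \<theta>) = (l - 1) * (- ln (1 - \<theta>))" by (simp add: algebra_simps)
  also have "\<dots> \<le> (l - 1) * (2 * \<theta>)" using a l by (intro mult_left_mono) auto
  also have "\<dots> \<le> 2 * (l * \<theta>)" using params_pos by (simp add: algebra_simps)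
  also have "\<dots> \<le> \<delta> / 2" using th by simp
  also have "\<dots> \<le> \<delta> - \<delta>\<^sup>2" using delta_bounds params_pos by (simp add: power2_eq_square)
  also have "\<dots> \<le> ln (1 + \<delta>)"
    using ln_one_plus_pos_lower_bound[of \<delta>] delta_bounds params_pos by simp
  finally have "exp ((1 - l) * ln (1 - \<theta>)) \<le> exp (ln (1 + \<delta>))" by simp
  then show "(1 - \<theta>) powr (1 - l) \<le> 1 + \<delta>" using th2 params_pos by (simp add: powr_def)
qed

text \<open>The left side prices the detour through the sample point. Summing
  \<open>cost i + opt / k\<close> over the clusters gives \<open>2 * opt\<close>, so \<epsilon> / 8
  here uses up the last quarter of \<epsilon>.\<close>

lemma tau_bound: "\<theta> * (2 / \<theta>) powr l * \<tau> \<le> \<epsilon> / 8"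
proof -
  have "\<theta> * (2 / \<theta>) powr l = 2 powr l * \<theta> powr (1 - l)"
    using params_pos by (simp add: powr_divide powr_diff field_simps)
  also have "\<theta> powr (1 - l) = R powr (8 * l\<^sup>2 - 8 * l)"
    unfolding \<theta>_def by (simp add: powr_powr power2_eq_square algebra_simps)
  finally have "8 * (\<theta> * (2 / \<theta>) powr l * \<tau>) = 8 * (2 powr l * R powr (8 * l\<^sup>2 - 8 * l) * R powr (- 8 * l\<^sup>2))"
    unfolding \<tau>_def by simp
  also have "\<dots> \<le> R powr 3 * (R powr l * R powr (8 * l\<^sup>2 - 8 * l) * R powr (- 8 * l\<^sup>2))"
    using const_le[of 8 3] powr_mono2[of l 2 R] R_ge l by (intro mult_mono) auto
  also have "\<dots> = R powr (3 + (l + (8 * l\<^sup>2 - 8 * l) + (- 8 * l\<^sup>2)))" by (simp only: powr_add)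
  also have "\<dots> \<le> R powr (- 1)" using l by (intro R_powr_mono) auto
  also have "\<dots> \<le> \<epsilon>" by (rule eps_ge)
  finally show ?thesis by simp
qed

section \<open>Weights of covered and uncovered clusters\<close>

lemma disj: "disjoint_family_on P {1..k}" and UP: "(\<Union>i\<in>{1..k}. P i) = C"
  using P by (auto simp: clustering_def)

lemma PX: "i \<in> {1..k} \<Longrightarrow> P i \<subseteq> X" and PC: "i \<in> {1..k} \<Longrightarrow> P i \<subseteq> C"
  and finP: "i \<in> {1..k} \<Longrightarrow> finite (P i)"
proof -
  assume i: "i \<in> {1..k}"
  then show "P i \<subseteq> C" using UP by blast
  then show "P i \<subseteq> X" "finite (P i)" using CX finC finite_subset by auto
qed

lemma sum_clusters: "(\<Sum>x\<in>C. h x) = (\<Sum>i=1..k. \<Sum>x\<in>P i. h x)"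
  unfolding UP[symmetric]
  by (rule sum.UNION_disjoint) (use disj finP in \<open>auto simp: disjoint_family_on_def\<close>)

lemma cost_nonneg: "0 \<le> cost i" "0 \<le> opt" "0 \<le> csize i"
  by (auto simp: cost_def opt_def csize_def intro!: sum_nonneg)

lemma sum_avg_cost: "(\<Sum>i=1..k. a * cost i + opt / k) = (a + 1) * opt"
  using k by (simp add: sum.distrib sum_distrib_left[symmetric] opt_def algebra_simps)

lemma wt_le: "finite T \<Longrightarrow> p \<in> T \<Longrightarrow> wt T x \<le> d x p powr l"
  unfolding wt_def by (intro Min_le) auto

lemma wt_attained: "finite T \<Longrightarrow> T \<noteq> {} \<Longrightarrow> \<exists>p\<in>T. wt T x = d x p powr l"
proof -
  assume "finite T" "T \<noteq> {}"
  then have "Min ((\<lambda>p. d x p powr l) ` T) \<in> (\<lambda>p. d x p powr l) ` T" by (intro Min_in) auto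
  then show ?thesis unfolding wt_def by (rule imageE) blast
qed

lemma wt_nonneg: "finite T \<Longrightarrow> T \<noteq> {} \<Longrightarrow> 0 \<le> wt T x"
  using wt_attained[of T x] by auto

lemma uncovered_mono:
  assumes "T \<subseteq> T'" shows "uncovered T' \<le> uncovered T"
  unfolding uncovered_def using assms by (intro card_mono) (auto simp: covered_def)

lemma uncovered_le: "uncovered T \<le> k"
proof -
  have "card {i \<in> {1..k}. \<not> covered T i} \<le> card {1..k}" by (intro card_mono) auto
  then show ?thesis by (simp add: uncovered_def)
qed

lemma core_subset: "core i \<subseteq> P i" by (auto simp: core_def)

text \<open>Markov's inequality: a client outside the core costs more than
  \<open>1 + \<delta>\<close> times the average, so at least the fraction \<delta> / (1 + \<delta>)
  \<ge> \<delta> / 2 of the cluster lies inside. A cluster of cost 0 is its own core.\<close>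

lemma card_core:
  assumes i: "i \<in> {1..k}"
  shows "\<delta> / 2 * csize i \<le> card (core i)"
proof -
  have fin: "finite (P i)" using finP i by auto
  let ?N = "P i - core i"
  have cN: "real (card ?N) = csize i - card (core i)"
    using core_subset[of i] fin by (simp add: csize_def card_Diff_subset finite_subset of_nat_diff card_mono)
  show ?thesis
  proof (cases "csize i = 0")
    case False
    then have s: "0 < csize i" using cost_nonneg(3)[of i] by linarith
    show ?thesis
    proof (cases "cost i = 0")
      case True
      then have "\<forall>x\<in>P i. d x (ctr i) powr l = 0"
        unfolding cost_def using fin by (subst (asm) sum_nonneg_eq_0_iff) auto
      then have "core i = P i" using True by (auto simp: core_def)
      then show ?thesis using delta_bounds s by (simp add: csize_def)
    next
      case False
      then have c: "0 < cost i" using cost_nonneg(1)[of i] by linarith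
      have "card ?N * ((1 + \<delta>) * cost i) \<le> (\<Sum>x\<in>?N. csize i * d x (ctr i) powr l)"
        by (rule sum_bounded_below) (auto simp: core_def)
      also have "\<dots> = csize i * (\<Sum>x\<in>?N. d x (ctr i) powr l)" by (simp add: sum_distrib_left)
      also have "\<dots> \<le> csize i * cost i"
        unfolding cost_def using fin s by (intro mult_left_mono sum_mono2) auto
      finally have "card ?N * (1 + \<delta>) \<le> csize i" using c by (simp add: mult.assoc[symmetric])
      then have "\<delta> * csize i \<le> (1 + \<delta>) * card (core i)" unfolding cN by (simp add: algebra_simps)
      also have "\<dots> \<le> 2 * real (card (core i))" using delta_bounds by (intro mult_right_mono) auto
      finally show ?thesis by simp
    qed
  qed simp
qed

text \<open>Every client of the cluster reaches \<open>p\<close> by way of the center and the core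
  client \<open>x\<close>, whose own cost is at most twice the average.\<close>

lemma cluster_weight_le:
  assumes i: "i \<in> {1..k}" and T: "finite T" "T \<subseteq> X" "p \<in> T" and x: "x \<in> core i"
  shows "(\<Sum>y\<in>P i. wt T y) \<le> 3 powr l * (3 * cost i + csize i * d x p powr l)"
proof -
  have xP: "x \<in> P i" using x core_subset by auto
  have X: "x \<in> X" "ctr i \<in> X" "p \<in> X" using xP PX[OF i] ctr[OF i] T by auto
  have "(\<Sum>y\<in>P i. wt T y) \<le> (\<Sum>y\<in>P i. 3 powr l * (d y (ctr i) powr l + d x (ctr i) powr l + d x p powr l))"
  proof (rule sum_mono)
    fix y assume "y \<in> P i"
    then have y: "y \<in> X" using PX[OF i] by auto
    have "d y p \<le> d y (ctr i) + d (ctr i) p" using triangle y X by auto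
    also have "d (ctr i) p \<le> d (ctr i) x + d x p" using triangle X by auto
    finally have tr: "d y p \<le> d y (ctr i) + d x (ctr i) + d x p" by (simp add: commute)
    have "wt T y \<le> d y p powr l" using T by (intro wt_le)
    also have "\<dots> \<le> (d y (ctr i) + d x (ctr i) + d x p) powr l"
      using tr l by (intro powr_mono2) auto
    also have "\<dots> \<le> 3 powr l * (d y (ctr i) powr l + d x (ctr i) powr l + d x p powr l)"
      using l by (intro powr_sum3_le) auto
    finally show "wt T y \<le> \<dots>" .
  qed
  also have "\<dots> = 3 powr l * (cost i + csize i * d x (ctr i) powr l + csize i * d x p powr l)"
    by (simp add: sum_distrib_left[symmetric] sum.distrib cost_def csize_def)
  also have "\<dots> \<le> 3 powr l * (3 * cost i + csize i * d x p powr l)"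
  proof -
    have "csize i * d x (ctr i) powr l \<le> (1 + \<delta>) * cost i" using x by (simp add: core_def)
    also have "\<dots> \<le> 2 * cost i" using delta_bounds cost_nonneg(1)[of i] by (intro mult_right_mono) auto
    finally show ?thesis by (intro mult_left_mono) auto
  qed
  finally show ?thesis .
qed

lemma covered_weight_le:
  assumes i: "i \<in> {1..k}" and T: "finite T" "T \<subseteq> X" and c: "covered T i"
  shows "(\<Sum>y\<in>P i. wt T y) \<le> 3 powr l * (4 * cost i + opt / k)"
proof (cases "P i = {}")
  case True
  then show ?thesis using cost_nonneg by simp
next
  case False
  then obtain p x where p: "p \<in> T" "x \<in> core i" "csize i * d x p powr l \<le> \<tau> * (cost i + opt / k)"
    using c by (auto simp: covered_def)
  have t1: "\<tau> \<le> 1" unfolding \<tau>_def using R_powr_mono[of "- 8 * l\<^sup>2" 0] l_sq R_pos by auto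
  have "\<tau> * (cost i + opt / k) \<le> 1 * (cost i + opt / k)"
    using t1 cost_nonneg by (intro mult_right_mono add_nonneg_nonneg) auto
  with p(3) have "csize i * d x p powr l \<le> cost i + opt / k" by simp
  then have "3 * cost i + csize i * d x p powr l \<le> 4 * cost i + opt / k" by simp
  then have "3 powr l * (3 * cost i + csize i * d x p powr l) \<le> 3 powr l * (4 * cost i + opt / k)"
    by (intro mult_left_mono) auto
  then show ?thesis using cluster_weight_le[OF i T p(1,2)] by linarith
qed

lemma uncovered_wt_gt:
  assumes "finite T" "T \<noteq> {}" and "\<not> covered T i" "x \<in> core i"
  shows "\<tau> * (cost i + opt / k) < csize i * wt T x"
proof -
  obtain p where "p \<in> T" "wt T x = d x p powr l" using wt_attained[OF assms(1,2)] by blast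
  then show ?thesis using assms(3,4) by (auto simp: covered_def not_le)
qed

text \<open>Used with the sample point nearest to \<open>x\<close>, \<open>cluster_weight_le\<close>
  bounds the weight of the cluster by a multiple of \<open>csize i * wt T x\<close>, because in an
  uncovered cluster this product also dominates \<open>\<tau> * cost i\<close>. Averaging over the
  core gives a share of the cluster's own weight; the term \<open>opt / k\<close> gives an absolute
  lower bound, for comparison with the covered clusters.\<close>

lemma uncovered_core_weight:
  assumes i: "i \<in> {1..k}" and T: "finite T" "T \<noteq> {}" "T \<subseteq> X" and u: "\<not> covered T i"
  shows "\<delta> / 2 * (\<Sum>y\<in>P i. wt T y) \<le> 3 powr l * (4 / \<tau>) * (\<Sum>x\<in>core i. wt T x)"
    and "\<delta> / 2 * \<tau> * (opt / k) \<le> (\<Sum>x\<in>core i. wt T x)"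
    and "0 < (\<Sum>x\<in>core i. wt T x)"
proof -
  have s: "0 < csize i" using u finP[OF i] by (auto simp: covered_def csize_def card_gt_0_iff)
  have cc: "\<delta> / 2 * csize i \<le> card (core i)" by (rule card_core[OF i])
  moreover have "0 < \<delta> / 2 * csize i" using s params_pos by simp
  ultimately have "0 < real (card (core i))" by linarith
  then have ne: "core i \<noteq> {}" by auto
  have fin: "finite (core i)" using finP[OF i] core_subset finite_subset by blast
  let ?W = "\<Sum>y\<in>P i. wt T y"
  let ?S = "\<Sum>x\<in>core i. wt T x"
  have W0: "0 \<le> ?W" using wt_nonneg[OF T(1,2)] by (intro sum_nonneg) auto
  have each: "?W \<le> 3 powr l * (4 / \<tau>) * (csize i * wt T x)" if x: "x \<in> core i" for x
  proof -
    obtain p where p: "p \<in> T" "wt T x = d x p powr l" using wt_attained[OF T(1,2)] by blast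
    have ok0: "0 \<le> opt / k" using cost_nonneg by auto
    have "\<tau> * cost i \<le> \<tau> * (cost i + opt / k)" using params_pos ok0 by simp
    then have "\<tau> * cost i \<le> csize i * wt T x" using uncovered_wt_gt[OF T(1,2) u x] by linarith
    then have c: "cost i \<le> 1 / \<tau> * (csize i * wt T x)" using params_pos by (simp add: field_simps)
    have t1: "1 \<le> 1 / \<tau>" unfolding \<tau>_def using R_powr_mono[of "- 8 * l\<^sup>2" 0] l_sq R_pos by auto
    have "1 * (csize i * wt T x) \<le> 1 / \<tau> * (csize i * wt T x)"
      using t1 s wt_nonneg[OF T(1,2), of x] by (intro mult_right_mono) auto
    then have "3 * cost i + csize i * wt T x \<le> 4 / \<tau> * (csize i * wt T x)" using c by simp
    then have "3 powr l * (3 * cost i + csize i * wt T x) \<le> 3 powr l * (4 / \<tau> * (csize i * wt T x))"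
      by (intro mult_left_mono) auto
    moreover have "?W \<le> 3 powr l * (3 * cost i + csize i * wt T x)"
      using cluster_weight_le[OF i T(1,3) p(1) x] p(2) by simp
    ultimately show ?thesis by (simp add: mult.assoc)
  qed
  have "\<delta> / 2 * csize i * ?W \<le> card (core i) * ?W" by (rule mult_right_mono[OF cc W0])
  also have "\<dots> \<le> (\<Sum>x\<in>core i. 3 powr l * (4 / \<tau>) * (csize i * wt T x))"
    by (rule sum_bounded_below) (rule each)
  also have "\<dots> = csize i * (3 powr l * (4 / \<tau>) * ?S)" by (simp only: sum_distrib_left mult_ac)
  finally have "csize i * (\<delta> / 2 * ?W) \<le> csize i * (3 powr l * (4 / \<tau>) * ?S)" by (simp add: mult_ac)
  then show "\<delta> / 2 * ?W \<le> 3 powr l * (4 / \<tau>) * ?S"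
    by (simp only: mult_le_cancel_left_pos[OF s])
  have "\<delta> / 2 * csize i * (\<tau> * (opt / k)) \<le> card (core i) * (\<tau> * (opt / k))"
    using params_pos cost_nonneg by (intro mult_right_mono[OF cc]) auto
  also have "\<dots> \<le> (\<Sum>x\<in>core i. csize i * wt T x)"
  proof (rule sum_bounded_below)
    fix x assume "x \<in> core i"
    from uncovered_wt_gt[OF T(1,2) u this] show "\<tau> * (opt / k) \<le> csize i * wt T x"
      using params_pos cost_nonneg(1)[of i] by (smt (verit, best) mult_left_mono)
  qed
  also have "\<dots> = csize i * ?S" by (simp add: sum_distrib_left)
  finally have "csize i * (\<delta> / 2 * \<tau> * (opt / k)) \<le> csize i * ?S" by (simp add: mult_ac)
  then show "\<delta> / 2 * \<tau> * (opt / k) \<le> ?S"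
    by (simp only: mult_le_cancel_left_pos[OF s])
  show "0 < ?S"
  proof (rule sum_pos[OF fin ne])
    fix x assume "x \<in> core i"
    from uncovered_wt_gt[OF T(1,2) u this] have "0 < csize i * wt T x"
      using params_pos cost_nonneg
      by (smt (verit, best) mult_nonneg_nonneg divide_nonneg_nonneg of_nat_0_le_iff)
    then show "0 < wt T x" using s by (simp add: zero_less_mult_iff)
  qed
qed

text \<open>The uncovered clusters are controlled by their own cores. The covered ones weigh at most
  \<open>5 * 3 powr l * opt\<close> together, and the core of any single uncovered cluster pays for
  \<open>opt\<close>.\<close>

lemma uncovered_core_total:
  assumes T: "finite T" "T \<noteq> {}" "T \<subseteq> X"
    and U: "U = {i \<in> {1..k}. \<not> covered T i}" "U \<noteq> {}"
  shows "q * (\<Sum>x\<in>C. wt T x) \<le> (\<Sum>i\<in>U. \<Sum>x\<in>core i. wt T x)"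
proof -
  let ?w = "\<lambda>i. \<Sum>y\<in>P i. wt T y"
  let ?c = "\<lambda>i. \<Sum>x\<in>core i. wt T x"
  let ?S = "\<Sum>i\<in>U. ?c i"
  define V where "V = {i \<in> {1..k}. covered T i}"
  have UV: "{1..k} = U \<union> V" "U \<inter> V = {}" "finite U" "finite V" by (auto simp: U V_def)
  have c0: "0 \<le> ?c i" for i using wt_nonneg[OF T(1,2)] by (intro sum_nonneg) auto
  have pos: "0 < \<delta> * \<tau>" using params_pos by simp
  have "(\<Sum>i\<in>U. ?w i) \<le> (\<Sum>i\<in>U. 8 * 3 powr l / (\<delta> * \<tau>) * ?c i)"
  proof (rule sum_mono)
    fix i assume "i \<in> U"
    then have "\<delta> / 2 * ?w i \<le> 3 powr l * (4 / \<tau>) * ?c i"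
      using uncovered_core_weight(1)[OF _ T] by (auto simp: U)
    then show "?w i \<le> 8 * 3 powr l / (\<delta> * \<tau>) * ?c i" using params_pos by (simp add: field_simps)
  qed
  then have U1: "(\<Sum>i\<in>U. ?w i) \<le> 8 * 3 powr l / (\<delta> * \<tau>) * ?S" by (simp add: sum_distrib_left)
  obtain i0 where i0: "i0 \<in> U" using U(2) by blast
  have "\<delta> / 2 * \<tau> * (opt / k) \<le> ?c i0" using uncovered_core_weight(2)[OF _ T] i0 by (auto simp: U)
  also have "\<dots> \<le> ?S" using i0 UV(3) c0 by (intro member_le_sum) auto
  finally have opt: "opt \<le> 2 * k / (\<delta> * \<tau>) * ?S" using params_pos k by (simp add: field_simps)
  have "(\<Sum>i\<in>V. ?w i) \<le> (\<Sum>i\<in>V. 3 powr l * (4 * cost i + opt / k))"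
    by (intro sum_mono covered_weight_le) (use T in \<open>auto simp: V_def\<close>)
  also have "\<dots> \<le> (\<Sum>i\<in>{1..k}. 3 powr l * (4 * cost i + opt / k))"
    using UV cost_nonneg by (intro sum_mono2) auto
  also have "\<dots> = 3 powr l * (5 * opt)"
    unfolding sum_distrib_left[symmetric] sum_avg_cost by simp
  also have "\<dots> \<le> 3 powr l * (5 * (2 * k / (\<delta> * \<tau>) * ?S))"
    by (intro mult_left_mono opt) auto
  finally have V1: "(\<Sum>i\<in>V. ?w i) \<le> 10 * 3 powr l * k / (\<delta> * \<tau>) * ?S" by (simp add: mult_ac)
  have "(\<Sum>x\<in>C. wt T x) = (\<Sum>i\<in>U. ?w i) + (\<Sum>i\<in>V. ?w i)"
    unfolding sum_clusters UV(1) using UV by (subst sum.union_disjoint) auto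
  also have "\<dots> \<le> (8 * 3 powr l + 10 * 3 powr l * k) / (\<delta> * \<tau>) * ?S"
    using U1 V1 by (simp add: add_divide_distrib distrib_right)
  also have "\<dots> \<le> 18 * 3 powr l * k / (\<delta> * \<tau>) * ?S"
    using k pos by (intro mult_right_mono divide_right_mono sum_nonneg[OF c0]) auto
  finally have W: "(\<Sum>x\<in>C. wt T x) \<le> 18 * 3 powr l * k / (\<delta> * \<tau>) * ?S" .
  \<comment> \<open>In powers of \<open>R\<close> the factor beside \<open>q\<close> has exponent at
    most \<open>5 + 2 * l + 1 + 5 * l + 8 * l\<^sup>2\<close>, which stays below the
    \<open>38 * l\<^sup>2\<close> of \<open>q\<close> since \<open>1 \<le> l\<close>.\<close>
  have "q * (18 * 3 powr l * k / (\<delta> * \<tau>)) = q * (18 * 3 powr l * k * R powr (5 * l) * R powr (8 * l\<^sup>2))"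
    by (simp add: \<delta>_def \<tau>_def powr_minus field_simps)
  also have "\<dots> \<le> R powr (- 38 * l\<^sup>2) * (R powr 5 * R powr (2 * l) * R powr 1 * R powr (5 * l) * R powr (8 * l\<^sup>2))"
    unfolding q_def using three_powr_le const_le[of 18 5] R_ge R_pos
    by (intro mult_left_mono mult_right_mono mult_mono) auto
  also have "\<dots> = R powr (- 38 * l\<^sup>2 + (5 + 2 * l + 1 + 5 * l + 8 * l\<^sup>2))" by (simp only: powr_add)
  also have "\<dots> \<le> R powr 0" using l_sq by (intro R_powr_mono) auto
  finally have q1: "q * (18 * 3 powr l * k / (\<delta> * \<tau>)) \<le> 1" using R_pos by simp
  have "q * (\<Sum>x\<in>C. wt T x) \<le> q * (18 * 3 powr l * k / (\<delta> * \<tau>)) * ?S"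
    using mult_left_mono[OF W, of q] params_pos by (simp add: mult.assoc)
  also have "\<dots> \<le> 1 * ?S" using q1 by (intro mult_right_mono sum_nonneg[OF c0]) auto
  finally show ?thesis by simp
qed

section \<open>Decrease of the expected number of uncovered clusters\<close>

lemma weight_pos:
  assumes T: "finite T" "T \<noteq> {}" "T \<subseteq> X" and u: "0 < uncovered T"
  shows "0 < (\<Sum>x\<in>C. wt T x)"
proof -
  obtain i where i: "i \<in> {1..k}" "\<not> covered T i"
    using u by (auto simp: uncovered_def card_gt_0_iff)
  have "0 < (\<Sum>x\<in>core i. wt T x)" by (rule uncovered_core_weight(3)[OF i(1) T i(2)])
  also have "\<dots> \<le> (\<Sum>x\<in>C. wt T x)"
    using core_subset[of i] PC[OF i(1)] finC wt_nonneg[OF T(1,2)] by (intro sum_mono2) auto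
  finally show ?thesis .
qed

text \<open>Drawing a core client of an uncovered cluster covers that cluster, at distance 0. The
  expectation is left unnormalised, with the total weight on the right, so that nothing is divided
  by a sum that may vanish.\<close>

lemma sampling_step:
  assumes T: "finite T" "T \<noteq> {}" "T \<subseteq> X"
  shows "(\<Sum>x\<in>C. wt T x * uncovered (insert x T)) \<le> (1 - q / k) * uncovered T * (\<Sum>x\<in>C. wt T x)"
proof (cases "uncovered T = 0")
  case True
  then have "uncovered (insert x T) = 0" for x
    using uncovered_mono[of T "insert x T"] by auto
  then show ?thesis using True by simp
next
  case uT: False
  define U where "U = {i \<in> {1..k}. \<not> covered T i}"
  have Une: "U \<noteq> {}" using uT by (auto simp: uncovered_def U_def)
  have finU: "finite U" by (auto simp: U_def)
  define B where "B = (\<Union>i\<in>U. core i)"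
  let ?W = "\<Sum>x\<in>C. wt T x"
  have BC: "B \<subseteq> C" using core_subset PC by (fastforce simp: B_def U_def)
  have W0: "0 \<le> ?W" using wt_nonneg[OF T(1,2)] by (intro sum_nonneg) auto
  have drop: "real (uncovered (insert x T)) \<le> real (uncovered T) - (if x \<in> B then 1 else 0)" for x
  proof (cases "x \<in> B")
    case True
    then obtain i where i: "i \<in> U" "x \<in> core i" by (auto simp: B_def)
    then have "i \<in> {1..k}" "x \<in> X" using core_subset PX by (fastforce simp: U_def)+
    then have "d x x powr l = 0" by simp
    then have "covered (insert x T) i"
      unfolding covered_def using i(2) cost_nonneg params_pos by (intro disjI2 bexI[of _ x]) auto
    then have "{i \<in> {1..k}. \<not> covered (insert x T) i} \<subseteq> U - {i}"
      by (auto simp: U_def covered_def)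
    then have "uncovered (insert x T) \<le> card (U - {i})"
      unfolding uncovered_def using finU by (intro card_mono) auto
    also have "\<dots> = uncovered T - 1" using i(1) finU by (simp add: uncovered_def U_def)
    finally have "uncovered (insert x T) + 1 \<le> uncovered T" using uT by linarith
    then show ?thesis using True by auto
  next
    case False
    then show ?thesis using uncovered_mono[of T "insert x T"] by auto
  qed
  have "(\<Sum>x\<in>C. wt T x * uncovered (insert x T)) \<le> (\<Sum>x\<in>C. wt T x * (real (uncovered T) - (if x \<in> B then 1 else 0)))"
    using drop wt_nonneg[OF T(1,2)] by (intro sum_mono mult_left_mono) auto
  also have "\<dots> = (\<Sum>x\<in>C. real (uncovered T) * wt T x - (if x \<in> B then wt T x else 0))"
    by (intro sum.cong) (auto simp: algebra_simps)
  also have "\<dots> = uncovered T * ?W - (\<Sum>x\<in>B. wt T x)"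
    using BC finC by (simp add: sum_subtractf sum_distrib_left sum.inter_restrict[symmetric] Int_absorb1)
  also have "(\<Sum>x\<in>B. wt T x) = (\<Sum>i\<in>U. \<Sum>x\<in>core i. wt T x)"
    unfolding B_def
  proof (rule sum.UNION_disjoint[OF finU])
    show "\<forall>i\<in>U. finite (core i)" using finP core_subset finite_subset by (fastforce simp: U_def)
    show "\<forall>i\<in>U. \<forall>j\<in>U. i \<noteq> j \<longrightarrow> core i \<inter> core j = {}"
      using disj core_subset unfolding disjoint_family_on_def U_def by fastforce
  qed
  also have "uncovered T * ?W - \<dots> \<le> uncovered T * ?W - q * ?W"
    using uncovered_core_total[OF T U_def Une] by simp
  \<comment> \<open>The additive gain \<open>q\<close> is weakened to a multiplicative one, using
    that at most \<open>k\<close> clusters are uncovered, because a constant factor can be iterated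
    over the rounds.\<close>
  also have "\<dots> \<le> (1 - q / k) * uncovered T * ?W"
  proof -
    have "real (uncovered T) / k \<le> 1" using uncovered_le[of T] k by simp
    then have "q * ?W * (uncovered T / k) \<le> q * ?W * 1"
      using params_pos W0 by (intro mult_left_mono) auto
    then show ?thesis by (simp add: algebra_simps)
  qed
  finally show ?thesis .
qed

lemma q_bounds: "q \<le> 1" "0 \<le> 1 - q / k" "1 - q / k \<le> 1"
proof -
  show q1: "q \<le> 1" unfolding q_def using R_powr_mono[of "- 38 * l\<^sup>2" 0] l_sq R_pos by auto
  have "q / k \<le> q / 1" using params_pos k by (intro divide_left_mono) auto
  then show "0 \<le> 1 - q / k" "1 - q / k \<le> 1" using q1 params_pos by auto
qed

text \<open>After \<open>2 * k * k / q\<close> rounds the expectation is at most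
  \<open>k * exp (- 2 * k)\<close>, and \<open>R powr (41 * l\<^sup>2)\<close> is at least this
  number of rounds. The further factor of at least \<open>R\<close> in the threshold absorbs the
  passage from \<open>Suc N\<close> to \<open>N\<close>.\<close>

lemma sampling_rounds:
  assumes N: "R powr (42 * l\<^sup>2) \<le> real (Suc N)"
  shows "(1 - q / k) ^ N * k \<le> 1 / 2"
proof -
  have "2 * R powr (41 * l\<^sup>2) \<le> R powr 1 * R powr (41 * l\<^sup>2)"
    using R_ge by (intro mult_right_mono) auto
  also have "\<dots> = R powr (1 + 41 * l\<^sup>2)" by (simp only: powr_add)
  also have "\<dots> \<le> R powr (42 * l\<^sup>2)" using l_sq by (intro R_powr_mono) auto
  finally have "2 * R powr (41 * l\<^sup>2) \<le> real N + 1" using N by simp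
  moreover have "1 \<le> R powr (41 * l\<^sup>2)" using R_pos l_sq by (intro ge_one_powr_ge_zero) auto
  ultimately have N1: "R powr (41 * l\<^sup>2) \<le> N" by linarith
  have k1: "1 \<le> real k" using k by simp
  have "2 * real k * real k \<le> R powr 1 * R powr 1 * R powr 1"
    using R_ge R_pos by (intro mult_mono) auto
  also have "\<dots> = R powr 3" by (simp only: powr_add[symmetric]) simp
  finally have "2 * real k * real k * R powr (38 * l\<^sup>2) \<le> R powr 3 * R powr (38 * l\<^sup>2)"
    by (intro mult_right_mono) auto
  also have "\<dots> = R powr (3 + 38 * l\<^sup>2)" by (simp only: powr_add)
  also have "\<dots> \<le> R powr (41 * l\<^sup>2)" using l_sq by (intro R_powr_mono) auto
  also have "\<dots> \<le> N" by (rule N1)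
  finally have N2: "2 * real k * real k * R powr (38 * l\<^sup>2) \<le> N" .
  have "q * R powr (38 * l\<^sup>2) = 1" unfolding q_def using R_pos by (simp add: powr_add[symmetric])
  then have "2 * real k * real k \<le> q * N"
    using mult_left_mono[OF N2, of q] params_pos by (simp add: mult_ac)
  then have N3: "2 * real k \<le> q / k * N" using k1 by (simp add: field_simps)
  have "(1 - q / k) ^ N \<le> exp (- (q / k)) ^ N"
    using q_bounds exp_ge_add_one_self[of "- (q / k)"] by (intro power_mono) auto
  also have "\<dots> = exp (- (q / k * N))" by (simp add: exp_of_nat_mult[symmetric] mult_ac)
  also have "\<dots> \<le> exp (- (2 * real k))" using N3 by simp
  finally have "(1 - q / k) ^ N * k \<le> exp (- (2 * real k)) * k" using k1 by (intro mult_right_mono) auto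
  also have "\<dots> \<le> 1 / 2"
  proof -
    have "2 * real k \<le> exp (2 * real k)" using exp_ge_add_one_self[of "2 * real k"] by linarith
    then show ?thesis by (simp add: exp_minus field_simps)
  qed
  finally show ?thesis .
qed

section \<open>Cost of the constructed center set\<close>

lemma three_term_bound:
  assumes "h = 1 + s" "0 \<le> s" "0 \<le> a" "0 \<le> b" "0 \<le> c"
  shows "(a + s * b + 2 * c) powr l
     \<le> (1 - \<theta>) / h * (h / (1 - \<theta>)) powr l * (a powr l + s * b powr l) + \<theta> * (2 / \<theta>) powr l * c powr l"
proof -
  have h: "0 < h" and t: "0 < 1 - \<theta>" "0 < \<theta>" using assms theta_bounds params_pos by auto
  let ?r = "h / (1 - \<theta>)"
  have w: "(1 - \<theta>) / h + (1 - \<theta>) / h * s + \<theta> = 1"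
  proof -
    have "(1 - \<theta>) / h + (1 - \<theta>) / h * s = (1 - \<theta>) * (1 + s) / h"
      by (simp add: add_divide_distrib[symmetric] algebra_simps)
    then show ?thesis using h assms(1) by simp
  qed
  \<comment> \<open>Jensen with weight \<theta> on the detour and the rest shared in the ratio
    \<open>1 : s\<close>; the arguments are scaled so that the weighted mean is the original sum.
    The resulting factor of the main terms is close to \<open>h powr (l - 1)\<close>.\<close>
  have "((1 - \<theta>) / h * (?r * a) + (1 - \<theta>) / h * s * (?r * b) + \<theta> * (2 / \<theta> * c)) powr l
     \<le> (1 - \<theta>) / h * (?r * a) powr l + (1 - \<theta>) / h * s * (?r * b) powr l + \<theta> * (2 / \<theta> * c) powr l"
    by (rule powr_jensen3) (use assms l h t w in auto)
  moreover have "(1 - \<theta>) / h * (?r * a) + (1 - \<theta>) / h * s * (?r * b) + \<theta> * (2 / \<theta> * c) = a + s * b + 2 * c"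
    using h t by simp
  moreover have "(?r * a) powr l = ?r powr l * a powr l" "(?r * b) powr l = ?r powr l * b powr l"
    "(2 / \<theta> * c) powr l = (2 / \<theta>) powr l * c powr l"
    using h t assms by (subst powr_mult[symmetric]; simp)+
  moreover have "K * (r * a') + K * s * (r * b') + z * c' = K * r * (a' + s * b') + z * c'" for K r a' b' c' z
    by (simp add: algebra_simps)
  ultimately show ?thesis by (simp only: times_divide_eq_left[symmetric] mult.assoc[of \<theta>, symmetric])
qed

text \<open>Since \<open>x\<close> lies in the core, the middle term costs the whole cluster about
  \<open>s * cost i\<close>, so the convexity factor of order \<open>h powr (l - 1)\<close> grows to
  \<open>h powr l\<close>. The case \<open>s = 2\<close> is the general one, \<open>s = 1\<close>
  serves \<open>C \<subseteq> L\<close>.\<close>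

lemma covered_cost_bound:
  assumes s: "s \<in> {1, 2}"
    and g: "\<And>i. i \<in> {1..k} \<Longrightarrow> P i \<noteq> {} \<Longrightarrow> \<exists>c. \<exists>x\<in>core i. 0 \<le> c \<and>
        csize i * c powr l \<le> \<tau> * (cost i + opt / k) \<and>
        (\<forall>y\<in>P i. 0 \<le> d y (g i) \<and> d y (g i) \<le> d y (ctr i) + s * d x (ctr i) + 2 * c)"
  shows "(\<Sum>i=1..k. \<Sum>y\<in>P i. d y (g i) powr l) \<le> ((1 + s) powr l + \<epsilon>) * opt"
proof -
  define h where "h = 1 + s"
  have hs: "0 < h" "0 \<le> s" "h \<le> 3" using s by (auto simp: h_def)
  have t: "0 < 1 - \<theta>" "0 < \<theta>" using theta_bounds params_pos by auto
  define H where "H = (1 - \<theta>) / h * (h / (1 - \<theta>)) powr l"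
  define Z where "Z = \<theta> * (2 / \<theta>) powr l"
  have H0: "0 \<le> H" and Z0: "0 \<le> Z" using hs t by (auto simp: H_def Z_def)
  have Hh: "H * h \<le> h powr l * (1 + \<delta>)"
  proof -
    have "H * h = h powr l * (1 - \<theta>) powr (1 - l)"
      unfolding H_def using hs t by (simp add: powr_divide powr_diff field_simps)
    then show ?thesis using theta_bounds(3) hs by (simp add: mult_left_mono)
  qed
  have hl: "h powr l * (1 + \<delta>) * (1 + \<delta>) \<le> h powr l + 3 / 4 * \<epsilon>"
  proof -
    have "(1 + \<delta>) * (1 + \<delta>) = 1 + (2 + \<delta>) * \<delta>" by (simp add: algebra_simps)
    also have "\<dots> \<le> 1 + 3 * \<delta>"
      using delta_bounds params_pos by (intro add_left_mono mult_right_mono) auto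
    finally have "h powr l * ((1 + \<delta>) * (1 + \<delta>)) \<le> h powr l * (1 + 3 * \<delta>)"
      by (intro mult_left_mono) auto
    also have "\<dots> = h powr l + h powr l * (3 * \<delta>)" by (simp add: algebra_simps)
    also have "h powr l * (3 * \<delta>) \<le> 3 powr l * (3 * \<delta>)"
      using hs l params_pos by (intro mult_right_mono powr_mono2) auto
    also have "\<dots> \<le> 3 / 4 * \<epsilon>" by (rule delta_bounds)
    finally show ?thesis by (simp add: mult.assoc)
  qed
  have each: "(\<Sum>y\<in>P i. d y (g i) powr l) \<le> (h powr l + 3 / 4 * \<epsilon>) * cost i + \<epsilon> / 8 * (cost i + opt / k)"
    if i: "i \<in> {1..k}" for i
  proof (cases "P i = {}")
    case True
    have "0 \<le> opt / k" using cost_nonneg by auto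
    then show ?thesis using True cost_nonneg(1)[of i] \<epsilon> by (auto intro!: add_nonneg_nonneg mult_nonneg_nonneg)
  next
    case False
    then obtain c x where x: "x \<in> core i" "0 \<le> c" "csize i * c powr l \<le> \<tau> * (cost i + opt / k)"
      and y: "\<And>y. y \<in> P i \<Longrightarrow> 0 \<le> d y (g i) \<and> d y (g i) \<le> d y (ctr i) + s * d x (ctr i) + 2 * c"
      using g[OF i False] by blast
    have "(\<Sum>y\<in>P i. d y (g i) powr l) \<le> (\<Sum>y\<in>P i. H * (d y (ctr i) powr l + s * d x (ctr i) powr l) + Z * c powr l)"
    proof (rule sum_mono)
      fix y assume "y \<in> P i"
      then have "d y (g i) powr l \<le> (d y (ctr i) + s * d x (ctr i) + 2 * c) powr l"
        using y l by (intro powr_mono2) auto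
      also have "\<dots> \<le> H * (d y (ctr i) powr l + s * d x (ctr i) powr l) + Z * c powr l"
        unfolding H_def Z_def by (rule three_term_bound) (use hs x h_def in auto)
      finally show "d y (g i) powr l \<le> \<dots>" .
    qed
    also have "\<dots> = H * (cost i + s * (csize i * d x (ctr i) powr l)) + Z * (csize i * c powr l)"
      by (simp add: sum.distrib sum_distrib_left[symmetric] cost_def csize_def algebra_simps)
    also have "\<dots> \<le> H * (cost i + s * ((1 + \<delta>) * cost i)) + Z * (\<tau> * (cost i + opt / k))"
      using x H0 Z0 hs by (intro add_mono mult_left_mono) (auto simp: core_def)
    also have "H * (cost i + s * ((1 + \<delta>) * cost i)) \<le> H * (h * ((1 + \<delta>) * cost i))"
      using H0 params_pos cost_nonneg(1)[of i]
      by (intro mult_left_mono) (auto simp: h_def algebra_simps)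
    also have "\<dots> \<le> h powr l * (1 + \<delta>) * ((1 + \<delta>) * cost i)"
      unfolding mult.assoc[symmetric, of H h] using params_pos cost_nonneg(1)[of i]
      by (intro mult_right_mono[OF Hh]) auto
    also have "\<dots> = h powr l * (1 + \<delta>) * (1 + \<delta>) * cost i" by simp
    also have "\<dots> \<le> (h powr l + 3 / 4 * \<epsilon>) * cost i" by (rule mult_right_mono[OF hl cost_nonneg(1)])
    also have "Z * (\<tau> * (cost i + opt / k)) \<le> \<epsilon> / 8 * (cost i + opt / k)"
      unfolding mult.assoc[symmetric] Z_def using cost_nonneg
      by (intro mult_right_mono[OF tau_bound]) auto
    finally show ?thesis by simp
  qed
  have "(\<Sum>i=1..k. \<Sum>y\<in>P i. d y (g i) powr l)
     \<le> (\<Sum>i=1..k. (h powr l + 3 / 4 * \<epsilon>) * cost i + \<epsilon> / 8 * (cost i + opt / k))"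
    by (rule sum_mono) (rule each)
  also have "\<dots> = (h powr l + 3 / 4 * \<epsilon>) * opt + \<epsilon> / 8 * (opt + opt)"
    using sum_avg_cost[of 1] by (simp only: sum.distrib[of "\<lambda>i. _ * cost i"] sum_distrib_left[symmetric] opt_def[symmetric] mult_1_left) simp
  also have "\<dots> = (h powr l + \<epsilon>) * opt" by (simp add: algebra_simps)
  finally show ?thesis by (simp add: h_def)
qed

end

section \<open>The program\<close>

abbreviation seqc :: "com \<Rightarrow> com \<Rightarrow> com" (infixr ";;" 55) where "c1 ;; c2 \<equiv> Seq c1 c2"

definition dist_pow :: "nexp \<Rightarrow> nexp \<Rightarrow> rexp" where
  "dist_pow a b = RPowr (Dist a b) (rvar ''ell'')"

definition init_weights :: com where
  "init_weights = For ''i'' (nvar ''clients'')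
     (RAssign ''w'' (nvar ''i'') (dist_pow (nvar ''i'') (NConst 0)))"

text \<open>Kept as a real number: the sampling loop compares its counter with it, so no conversion
  to a natural number occurs.\<close>

definition threshold :: com where
  "threshold = rset ''thr'' (RPowr (RPlus (ROfNat (NConst 1)) (RDivide (ROfNat (nvar ''k'')) (rvar ''eps'')))
     (RTimes (ROfNat (NConst 42)) (RTimes (rvar ''ell'') (rvar ''ell''))))"

text \<open>One pass of weighted reservoir sampling: each client replaces the selection with
  probability its weight over the partial sum so far. While this sum is 0 the quotient 0 / 0 is 0
  and the flip fails, so with all weights 0 the selection stays at position 0.\<close>

definition reservoir :: com where
  "reservoir = For ''i'' (nvar ''clients'')
     (rset ''W'' (RPlus (rvar ''W'') (RCell ''w'' (nvar ''i''))) ;;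
      Flip ''r'' (NConst 0) (RDivide (RCell ''w'' (nvar ''i'')) (rvar ''W'')) ;;
      If (NLess (NConst 0) (nvar ''r'')) (nset ''sel'' (nvar ''i'')) SKIP)"

definition update_weights :: com where
  "update_weights = For ''i'' (nvar ''clients'')
     (If (RLess (dist_pow (nvar ''i'') (nvar ''sel'')) (RCell ''w'' (nvar ''i'')))
        (RAssign ''w'' (nvar ''i'') (dist_pow (nvar ''i'') (nvar ''sel''))) SKIP)"

definition sample :: com where
  "sample = (rset ''W'' (ROfNat (NConst 0)) ;; nset ''sel'' (NConst 0)) ;; reservoir ;;
     (NAssign ''T'' (nvar ''cnt'') (nvar ''sel'') ;; nset ''cnt'' (NPlus (nvar ''cnt'') (NConst 1))) ;;
     update_weights"

definition sampling :: com where
  "sampling = While (RLess (ROfNat (nvar ''cnt'')) (rvar ''thr'')) sample"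

text \<open>Division with remainder by repeated subtraction. The up to \<open>j\<close> iterations
  make the enumeration quadratic in the length of the output list.\<close>

definition split_digit :: com where
  "split_digit = While (BNot (NLess (nvar ''rem'') (nvar ''cnt'')))
     (nset ''rem'' (NMinus (nvar ''rem'') (nvar ''cnt'')) ;; nset ''quot'' (NPlus (nvar ''quot'') (NConst 1)))"

text \<open>
  A facility \<open>g\<close> is already in the current center set iff \<open>mark g = j + 1\<close>; earlier center sets
  leave smaller stamps, so the array is never cleared.
\<close>

definition find_nearest :: com where
  "find_nearest = For ''g'' (nvar ''facilities'')
     (If (BAnd (NLess (NCell ''mark'' (nvar ''g'')) (NPlus (nvar ''j'') (NConst 1)))
            (BNot (BAnd (NLess (nvar ''best'') (nvar ''facilities''))
              (BNot (RLess (Dist (nvar ''p'') (NPlus (nvar ''clients'') (nvar ''g'')))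
                           (Dist (nvar ''p'') (NPlus (nvar ''clients'') (nvar ''best''))))))))
        (nset ''best'' (nvar ''g'')) SKIP)"

definition next_center :: com where
  "next_center = nset ''quot'' (NConst 0) ;; split_digit ;;
     (nset ''p'' (NCell ''T'' (nvar ''rem'')) ;; nset ''best'' (nvar ''facilities'')) ;;
     find_nearest ;;
     (NAssign ''out'' (NPlus (NTimes (nvar ''j'') (nvar ''k'')) (nvar ''i'')) (nvar ''best'') ;;
      NAssign ''mark'' (nvar ''best'') (NPlus (nvar ''j'') (NConst 1)) ;;
      nset ''rem'' (nvar ''quot''))"

definition enumerate_centers :: com where
  "enumerate_centers = For ''j'' (nvar ''pw'')
     (nset ''rem'' (nvar ''j'') ;; For ''i'' (nvar ''k'') next_center)"

definition power_count :: com where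
  "power_count = nset ''pw'' (NConst 1) ;;
     For ''i'' (nvar ''k'') (nset ''pw'' (NTimes (nvar ''pw'') (nvar ''cnt'')))"

definition algorithm :: com where
  "algorithm = (init_weights ;; nset ''cnt'' (NConst 1) ;; threshold) ;; sampling ;;
     power_count ;; enumerate_centers ;; nset ''len'' (nvar ''pw'')"

text \<open>A branch of probability 0 may carry the value \<open>top\<close>, because
  \<open>top * 0 = 0\<close>.\<close>

lemma mult_ennreal_eq:
  fixes p y :: real
  assumes "0 \<le> p" "0 \<le> y" "p \<noteq> 0 \<Longrightarrow> x = ennreal y"
  shows "x * ennreal p = ennreal (p * y)"
  using assms by (cases "p = 0") (simp_all add: ennreal_mult mult.commute)

section \<open>Correctness of initialisation and sampling\<close>

locale machine =
  fixes D :: distances and m f k :: nat and l \<epsilon> :: real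
begin

definition "bound = (1 + real k / \<epsilon>) powr (42 * l\<^sup>2)"

definition env :: "store \<Rightarrow> bool" where
  "env s \<longleftrightarrow> nats s ''clients'' 0 = m \<and> nats s ''facilities'' 0 = f \<and> nats s ''k'' 0 = k \<and>
     reals s ''ell'' 0 = l \<and> (\<forall>g. nats s ''mark'' g = 0)"

definition "wgt T j = Min ((\<lambda>p. D j p powr l) ` set T)"

definition sampled :: "nat list \<Rightarrow> store \<Rightarrow> bool" where
  "sampled T s \<longleftrightarrow> env s \<and> reals s ''thr'' 0 = bound \<and> nats s ''cnt'' 0 = length T \<and>
     (\<forall>a<length T. nats s ''T'' a = T ! a) \<and> (\<forall>j<m. reals s ''w'' j = wgt T j)"

lemma wgt_single: "wgt [p] j = D j p powr l"
  by (simp add: wgt_def)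

lemma wgt_snoc: "T \<noteq> [] \<Longrightarrow> wgt (T @ [p]) j = min (D j p powr l) (wgt T j)"
  by (simp add: wgt_def)

lemma wgt_nonneg: "T \<noteq> [] \<Longrightarrow> 0 \<le> wgt T j"
  by (simp add: wgt_def)

lemma sampled_frame [simp]:
  "sampled T (nat_update ''i'' a v s) = sampled T s"
  "sampled T (nat_update ''r'' a v s) = sampled T s"
  "sampled T (nat_update ''sel'' a v s) = sampled T s"
  "sampled T (nat_update ''pw'' a v s) = sampled T s"
  "sampled T (real_update ''W'' a x s) = sampled T s"
  by (simp_all add: sampled_def env_def)

text \<open>The starting sample is position 0, and as memory is initially 0 it is already present in
  cell 0 of \<open>T\<close>.\<close>

lemma init_ok:
  assumes "env s" "reals s ''eps'' 0 = \<epsilon>" "nats s ''T'' 0 = 0"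
    and t: "m * 5 + 3 + 1 + 3 \<le> t"
  shows "ok D t (init_weights ;; (nset ''cnt'' (NConst 1) ;; threshold)) (sampled [0]) s"
proof (rule ok_Seq[where ?t1.0 = "m * 5 + 3" and ?t2.0 = 3])
  let ?I = "\<lambda>n s. env s \<and> reals s ''eps'' 0 = \<epsilon> \<and> nats s ''T'' 0 = 0 \<and> (\<forall>j<n. reals s ''w'' j = wgt [0] j)"
  show "ok D (m * 5 + 3) init_weights (?I m) s"
    unfolding init_weights_def
  proof (rule ok_For[where tb = 1 and N = m and I = ?I])
    show "ok D 1 (RAssign ''w'' (nvar ''i'') (dist_pow (nvar ''i'') (NConst 0)))
        (\<lambda>s'. nats s' ''i'' 0 = n \<and> ?I (Suc n) (nat_update ''i'' 0 (Suc n) s')) s"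
      if "nats s ''i'' 0 = n" "?I n s" for n s
      by (rule ok_wpe) (use that in \<open>simp_all add: env_def dist_pow_def wgt_single less_Suc_eq\<close>)
  qed (use assms in \<open>simp_all add: env_def\<close>)
  show "ok D 3 (nset ''cnt'' (NConst 1) ;; threshold) (sampled [0]) s'" if "?I m s'" for s'
    by (rule ok_wpe)
      (use that in \<open>simp_all add: env_def threshold_def bound_def sampled_def power2_eq_square\<close>)
qed (use t in simp)

lemma record_ok:
  assumes s: "sampled T s" "T \<noteq> []" and a: "nats s ''sel'' 0 = a"
  shows "ok D (3 + 1 + (m * 6 + 3))
    ((NAssign ''T'' (nvar ''cnt'') (nvar ''sel'') ;; nset ''cnt'' (NPlus (nvar ''cnt'') (NConst 1))) ;;
     update_weights) (sampled (T @ [a])) s"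
proof (rule ok_Seq[OF _ _ order_refl])
  define T' where "T' = T @ [a]"
  have snoc: "wgt T' j = min (D j a powr l) (wgt T j)" for j
    using wgt_snoc[OF s(2)] by (simp add: T'_def)
  let ?J = "\<lambda>s. env s \<and> reals s ''thr'' 0 = bound \<and> nats s ''cnt'' 0 = length T' \<and>
     (\<forall>b<length T'. nats s ''T'' b = T' ! b) \<and> nats s ''sel'' 0 = a"
  let ?I = "\<lambda>n s. ?J s \<and> (\<forall>j<m. reals s ''w'' j = wgt (if j < n then T' else T) j)"
  have "nats s ''T'' b = T ! b" if "b < length T" for b using s(1) that by (simp add: sampled_def)
  then have "((nats s ''T'')(length T := a)) b = T' ! b" if "b < length T'" for b
    using that by (cases "b = length T") (auto simp: T'_def nth_append)
  then show "ok D 3 (NAssign ''T'' (nvar ''cnt'') (nvar ''sel'') ;; nset ''cnt'' (NPlus (nvar ''cnt'') (NConst 1))) (?I 0) s"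
    using s(1) a by (intro ok_wpe) (simp_all add: sampled_def env_def T'_def)
  fix s' assume I0: "?I 0 s'"
  have "ok D (m * 6 + 3) update_weights (?I m) s'"
    unfolding update_weights_def
  proof (rule ok_For[where tb = 2 and N = m and I = ?I])
    fix n s assume n: "n < m" "nats s ''i'' 0 = n" and I: "?I n s"
    show "ok D 2 (If (RLess (dist_pow (nvar ''i'') (nvar ''sel'')) (RCell ''w'' (nvar ''i'')))
        (RAssign ''w'' (nvar ''i'') (dist_pow (nvar ''i'') (nvar ''sel''))) SKIP)
        (\<lambda>s'. nats s' ''i'' 0 = n \<and> ?I (Suc n) (nat_update ''i'' 0 (Suc n) s')) s"
      by (rule ok_wpe) (use n I in \<open>simp_all add: env_def dist_pow_def snoc less_Suc_eq\<close>)
  qed (use I0 in \<open>simp_all add: env_def\<close>)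
  then show "ok D (m * 6 + 3) update_weights (sampled (T @ [a])) s'"
    by (rule ok_weaken) (simp_all add: sampled_def T'_def[symmetric])
qed

text \<open>
  The expectation of \<open>h\<close> at the client finally selected is a martingale of reservoir sampling.
\<close>

lemma reservoir_ev:
  assumes s: "sampled T s" "T \<noteq> []" "reals s ''W'' 0 = 0" "nats s ''sel'' 0 = 0"
    and h: "\<And>j. 0 \<le> h j"
    and pos: "0 < (\<Sum>j<m. wgt T j) \<Longrightarrow> (\<Sum>j<m. wgt T j * h j) \<le> B * (\<Sum>j<m. wgt T j)"
    and zero: "(\<Sum>j<m. wgt T j) = 0 \<Longrightarrow> h 0 \<le> B"
    and G: "\<And>s' a. a < m \<or> a = 0 \<Longrightarrow> sampled T s' \<Longrightarrow> nats s' ''sel'' 0 = a \<Longrightarrow> G s' \<le> ennreal (h a)"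
  shows "ev D (m * 10 + 3) reservoir G s \<le> ennreal B"
proof -
  define w where "w = wgt T"
  define S where "S n = (\<Sum>j<n. w j)" for n
  have w0: "0 \<le> w j" for j using wgt_nonneg[OF s(2)] by (simp add: w_def)
  have S0: "0 \<le> S n" for n using w0 by (simp add: S_def sum_nonneg)
  have S_Suc: "S (Suc n) = S n + w n" for n by (simp add: S_def)
  \<comment> \<open>The conditional expectation of \<open>h\<close> at the final selection when
    \<open>a\<close> is selected after \<open>n\<close> clients: \<open>a\<close> survives with
    probability \<open>S n / S m\<close>, and a later client \<open>j\<close> is the final selection
    with probability \<open>w j / S m\<close>. With total weight 0 the selection is always
    0.\<close>
  define \<phi> where "\<phi> n a = (if S m = 0 then h 0 else (S n * h a + (\<Sum>j=n..<m. w j * h j)) / S m)" for n a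
  let ?I = "\<lambda>n s. sampled T s \<and> reals s ''W'' 0 = S n \<and> (nats s ''sel'' 0 < m \<or> nats s ''sel'' 0 = 0) \<and>
     (S m = 0 \<longrightarrow> nats s ''sel'' 0 = 0)"
  let ?F = "\<lambda>n s. if ?I n s then ennreal (\<phi> n (nats s ''sel'' 0)) else top"
  have \<phi>0: "0 \<le> \<phi> n a" for n a using h S0 w0 by (auto simp: \<phi>_def intro!: divide_nonneg_nonneg add_nonneg_nonneg sum_nonneg)
  have step: "w n / S (Suc n) * \<phi> (Suc n) n + (1 - w n / S (Suc n)) * \<phi> (Suc n) a = \<phi> n a"
    if n: "n < m" for n a
  proof (cases "S m = 0")
    case False
    have sum: "(\<Sum>j=n..<m. w j * h j) = w n * h n + (\<Sum>j=Suc n..<m. w j * h j)"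
      using n by (rule sum.atLeast_Suc_lessThan)
    show ?thesis
    proof (cases "S (Suc n) = 0")
      case True
      then have "S n = 0" "w n = 0" using S_Suc[of n] S0[of n] w0[of n] by auto
      then show ?thesis using True False by (simp add: \<phi>_def sum)
    next
      case S1: False
      let ?R = "\<Sum>j=Suc n..<m. w j * h j"
      have "S (Suc n) * (w n / S (Suc n) * (S (Suc n) * h n + ?R) + (1 - w n / S (Suc n)) * (S (Suc n) * h a + ?R))
        = S (Suc n) * (S n * h a + (w n * h n + ?R))"
      proof -
        have "S (Suc n) * (1 - w n / S (Suc n)) = S n" using S1 S_Suc[of n] by (simp add: right_diff_distrib)
        moreover have "S (Suc n) * (w n / S (Suc n)) = w n" using S1 by simp
        ultimately have "S (Suc n) * (w n / S (Suc n) * (S (Suc n) * h n + ?R) + (1 - w n / S (Suc n)) * (S (Suc n) * h a + ?R))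
          = w n * (S (Suc n) * h n + ?R) + S n * (S (Suc n) * h a + ?R)"
          by (simp only: distrib_left mult.assoc[symmetric])
        then show ?thesis using S_Suc[of n] by (simp add: algebra_simps)
      qed
      then have "w n / S (Suc n) * (S (Suc n) * h n + ?R) + (1 - w n / S (Suc n)) * (S (Suc n) * h a + ?R)
        = S n * h a + (w n * h n + ?R)" using S1 by simp
      then show ?thesis using False
        by (simp only: \<phi>_def sum if_False times_divide_eq_right add_divide_distrib[symmetric])
    qed
  qed (simp add: \<phi>_def algebra_simps)
  have main: "ev D (m * 10 + 3) reservoir (?F m) s \<le> ennreal B"
    unfolding reservoir_def
  proof (rule ev_For[where tb = 6 and N = m and F = ?F])
    fix n s assume n: "n < m" and i: "nats s ''i'' 0 = n" and fin: "?F n s < top"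
    have I: "?I n s" using fin by (auto split: if_splits)
    have W: "reals s ''W'' 0 + w n = S (Suc n)" "reals s ''w'' n = w n"
      using I n by (auto simp: S_Suc sampled_def w_def)
    have p: "0 \<le> w n / S (Suc n)" "w n / S (Suc n) \<le> 1"
      using w0[of n] S0[of "Suc n"] S0[of n] S_Suc[of n] by (auto simp: divide_le_eq_1)
    \<comment> \<open>If the total weight is 0, the branch that selects client \<open>n\<close> has
      probability 0, so the store it leads to may violate the invariant.\<close>
    have wz: "w n / S (Suc n) = 0" if "S m = 0"
    proof -
      have "S m = S n + (\<Sum>j=n..<m. w j)" unfolding S_def using n sum.atLeastLessThan_concat[of 0 n m w] by (simp add: lessThan_atLeast0)
      moreover have "w n \<le> (\<Sum>j=n..<m. w j)" using n w0 by (intro member_le_sum) auto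
      ultimately have "w n = 0" using that S0[of n] w0[of n] by linarith
      then show ?thesis by simp
    qed
    define a where "a = nats s ''sel'' 0"
    let ?G = "\<lambda>s'. if nats s' ''i'' 0 = n then ?F (Suc n) (nat_update ''i'' 0 (Suc n) s') else top"
    let ?s1 = "real_update ''W'' 0 (S (Suc n)) s"
    let ?body = "rset ''W'' (RPlus (rvar ''W'') (RCell ''w'' (nvar ''i''))) ;;
      Flip ''r'' (NConst 0) (RDivide (RCell ''w'' (nvar ''i'')) (rvar ''W'')) ;;
      If (NLess (NConst 0) (nvar ''r'')) (nset ''sel'' (nvar ''i'')) SKIP"
    let ?sT = "nat_update ''sel'' 0 n (nat_update ''r'' 0 1 ?s1)"
    let ?sF = "nat_update ''r'' 0 0 ?s1"
    have wpe: "wpe D ?body H s = H ?sT * ennreal (w n / S (Suc n)) + H ?sF * ennreal (1 - w n / S (Suc n))" for H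
      using p by (simp add: i W)
    have iT: "nats ?sT ''i'' 0 = n" "nats ?sF ''i'' 0 = n" using i by simp_all
    have "?I (Suc n) (nat_update ''i'' 0 (Suc n) ?sT)" if "S m \<noteq> 0" using that I n by simp
    then have gT0: "?G ?sT = ennreal (\<phi> (Suc n) n)" if "S m \<noteq> 0" using that iT(1) by simp
    have gT: "?G ?sT = ennreal (\<phi> (Suc n) n)" if "w n / S (Suc n) \<noteq> 0"
      by (rule gT0) (rule contrapos_nn[OF that wz])
    have G1: "?G ?sT * ennreal (w n / S (Suc n)) = ennreal (w n / S (Suc n) * \<phi> (Suc n) n)"
      by (rule mult_ennreal_eq[OF p(1) \<phi>0 gT])
    have "?I (Suc n) (nat_update ''i'' 0 (Suc n) ?sF)" using I n by simp
    then have gF: "?G ?sF = ennreal (\<phi> (Suc n) a)" using iT(2) by (simp add: a_def)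
    have G0: "?G ?sF * ennreal (1 - w n / S (Suc n)) = ennreal ((1 - w n / S (Suc n)) * \<phi> (Suc n) a)"
      by (rule mult_ennreal_eq[OF _ \<phi>0 gF]) (use p in simp)
    have nnT: "0 \<le> w n / S (Suc n) * \<phi> (Suc n) n" by (rule mult_nonneg_nonneg[OF p(1) \<phi>0])
    have nnF: "0 \<le> (1 - w n / S (Suc n)) * \<phi> (Suc n) a"
      by (rule mult_nonneg_nonneg[OF _ \<phi>0]) (use p in simp)
    have "ev D 6 ?body ?G s \<le> wpe D ?body ?G s" by (rule ev_wpeI) simp_all
    also have "\<dots> = ?G ?sT * ennreal (w n / S (Suc n)) + ?G ?sF * ennreal (1 - w n / S (Suc n))"
      by (rule wpe)
    also have "\<dots> = ennreal (\<phi> n a)"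
      unfolding G1 G0 ennreal_plus[OF nnT nnF, symmetric] step[OF n] by (rule refl)
    also have "\<dots> = ?F n s" using I by (simp add: a_def)
    finally show "ev D 6 ?body ?G s \<le> ?F n s" .
  next
    fix n s assume "?F n s < top"
    then show "nval (nvar ''clients'') s = m" by (auto simp: sampled_def env_def split: if_splits)
  next
    have "\<phi> 0 0 \<le> B"
    proof (cases "S m = 0")
      case True
      then show ?thesis using zero by (simp add: \<phi>_def S_def w_def)
    next
      case False
      then have "0 < S m" using S0[of m] by linarith
      then show ?thesis using pos
        by (simp add: \<phi>_def S_def w_def lessThan_atLeast0 pos_divide_le_eq)
    qed
    moreover have "?I 0 (nat_update ''i'' 0 0 s)" using s by (auto simp: sampled_def env_def S_def)
    ultimately show "?F 0 (nat_update ''i'' 0 0 s) \<le> ennreal B"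
      using s(4) by (simp add: ennreal_leI)
  qed simp
  have "G s' \<le> ?F m s'" for s'
  proof (cases "?I m s'")
    case True
    then have "\<phi> m (nats s' ''sel'' 0) = h (nats s' ''sel'' 0)" by (auto simp: \<phi>_def)
    moreover have "G s' \<le> ennreal (h (nats s' ''sel'' 0))" using True by (intro G) auto
    ultimately show ?thesis using True by simp
  qed auto
  then have "ev D (m * 10 + 3) reservoir G s \<le> ev D (m * 10 + 3) reservoir (?F m) s"
    by (rule ev_mono)
  with main show ?thesis by (rule order_trans[rotated])
qed

lemma sample_ev:
  assumes s: "sampled T s" "T \<noteq> []"
    and h: "\<And>j. 0 \<le> h j"
    and pos: "0 < (\<Sum>j<m. wgt T j) \<Longrightarrow> (\<Sum>j<m. wgt T j * h j) \<le> B * (\<Sum>j<m. wgt T j)"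
    and zero: "(\<Sum>j<m. wgt T j) = 0 \<Longrightarrow> h 0 \<le> B"
    and G: "\<And>s' a. a < m \<or> a = 0 \<Longrightarrow> sampled (T @ [a]) s' \<Longrightarrow> G s' \<le> ennreal (h a)"
  shows "ev D (m * 16 + 15) sample G s \<le> ennreal B"
  unfolding sample_def
proof (rule ev_SeqI[where ?t1.0 = 3, OF _ order_refl])
  let ?rest = "(NAssign ''T'' (nvar ''cnt'') (nvar ''sel'') ;; nset ''cnt'' (NPlus (nvar ''cnt'') (NConst 1))) ;;
     update_weights"
  let ?H = "ev D (m * 16 + 11) (reservoir ;; ?rest) G"
  have "?H s' \<le> ennreal B"
    if s': "sampled T s'" "reals s' ''W'' 0 = 0" "nats s' ''sel'' 0 = 0" for s'
  proof (rule ev_SeqI[where ?t1.0 = "m * 10 + 3" and ?t2.0 = "3 + 1 + (m * 6 + 3)", OF _ order_refl])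
    show "ev D (m * 10 + 3) reservoir (ev D (3 + 1 + (m * 6 + 3)) ?rest G) s' \<le> ennreal B"
    proof (rule reservoir_ev[OF s'(1) s(2) s'(2,3), where h = h])
      fix s'' a assume a: "a < m \<or> a = 0" and "sampled T s''" "nats s'' ''sel'' 0 = a"
      then have "ok D (3 + 1 + (m * 6 + 3)) ?rest (sampled (T @ [a])) s''"
        using s(2) by (intro record_ok)
      then show "ev D (3 + 1 + (m * 6 + 3)) ?rest G s'' \<le> ennreal (h a)"
        by (rule ok_ev) (rule G[OF a])
    qed (use h pos zero in auto)
  qed simp
  then show "ev D 3 (rset ''W'' (ROfNat (NConst 0)) ;; nset ''sel'' (NConst 0)) ?H s \<le> ennreal B"
    by (intro ev_wpeI) (use s in \<open>auto simp: sampled_def env_def\<close>)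
qed simp

text \<open>Reads the sample back from the store: the invariants passed to \<open>ev_While\<close>
  depend on the store alone, while the sample is random.\<close>

definition "centers s = map (nats s ''T'') [0..<nats s ''cnt'' 0]"

lemma centers_sampled: "sampled T s \<Longrightarrow> centers s = T"
  by (auto simp: sampled_def centers_def intro!: nth_equalityI)

text \<open>The function \<open>r ^ (N - n) * pot\<close> of the current sample is a supermartingale
  over the rounds. Round \<open>n\<close> starts with \<open>Suc n\<close> points, which is why the
  test \<open>Suc n < bound\<close> decides whether it takes place.\<close>

lemma sampling_ev:
  assumes s: "sampled [0] s"
    and N: "\<And>n. real (Suc n) < bound \<longleftrightarrow> n < N"
    and pot: "\<And>T. 0 \<le> pot T" and r: "0 \<le> r"
    and pos: "\<And>T. T \<noteq> [] \<Longrightarrow> set T \<subseteq> insert 0 {..<m} \<Longrightarrow> 0 < (\<Sum>j<m. wgt T j) \<Longrightarrow>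
      (\<Sum>j<m. wgt T j * pot (T @ [j])) \<le> r * pot T * (\<Sum>j<m. wgt T j)"
    and zero: "\<And>T. T \<noteq> [] \<Longrightarrow> set T \<subseteq> insert 0 {..<m} \<Longrightarrow> (\<Sum>j<m. wgt T j) = 0 \<Longrightarrow> pot (T @ [0]) \<le> r * pot T"
    and G: "\<And>T s'. sampled T s' \<Longrightarrow> length T = Suc N \<Longrightarrow> set T \<subseteq> insert 0 {..<m} \<Longrightarrow> G s' \<le> ennreal (pot T)"
  shows "ev D (N * (m * 16 + 15 + 2) + 1) sampling G s \<le> ennreal (r ^ N * pot [0])"
proof -
  let ?I = "\<lambda>n s. sampled (centers s) s \<and> length (centers s) = Suc n \<and> set (centers s) \<subseteq> insert 0 {..<m}"
  let ?F = "\<lambda>n s. if ?I n s then ennreal (r ^ (N - n) * pot (centers s)) else top"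
  have "ev D (N * (m * 16 + 15 + 2) + 1) sampling G s \<le> ev D (N * (m * 16 + 15 + 2) + 1) sampling (?F N) s"
    by (rule ev_mono) (use G in auto)
  also have "ev D (N * ((m * 16 + 15) + 2) + 1) sampling (?F N) s \<le> ?F 0 s"
    unfolding sampling_def
  proof (rule ev_While)
    fix n s assume n: "n < N" and "?F n s < top"
    then have I: "?I n s" by (auto split: if_splits)
    define T where "T = centers s"
    have T: "sampled T s" "length T = Suc n" "set T \<subseteq> insert 0 {..<m}" "T \<noteq> []"
      using I by (auto simp: T_def)
    have "ev D (m * 16 + 15) sample (?F (Suc n)) s \<le> ennreal (r ^ (N - n) * pot T)"
    proof (rule sample_ev[OF T(1,4), where h = "\<lambda>j. r ^ (N - Suc n) * pot (T @ [j])"])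
      have e: "r ^ (N - n) = r ^ (N - Suc n) * r" using n by (metis Suc_diff_Suc power_Suc2)
      show "0 \<le> r ^ (N - Suc n) * pot (T @ [j])" for j using pot r by simp
      show "(\<Sum>j<m. wgt T j * (r ^ (N - Suc n) * pot (T @ [j]))) \<le> r ^ (N - n) * pot T * (\<Sum>j<m. wgt T j)"
        if "0 < (\<Sum>j<m. wgt T j)"
      proof -
        have "(\<Sum>j<m. wgt T j * (r ^ (N - Suc n) * pot (T @ [j]))) = r ^ (N - Suc n) * (\<Sum>j<m. wgt T j * pot (T @ [j]))"
          by (simp add: sum_distrib_left mult_ac)
        also have "\<dots> \<le> r ^ (N - Suc n) * (r * pot T * (\<Sum>j<m. wgt T j))"
          using r by (intro mult_left_mono pos T that) auto
        finally show ?thesis by (simp add: e mult_ac)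
      qed
      show "r ^ (N - Suc n) * pot (T @ [0]) \<le> r ^ (N - n) * pot T" if "(\<Sum>j<m. wgt T j) = 0"
        using mult_left_mono[OF zero[OF T(4,3) that], of "r ^ (N - Suc n)"] r by (simp add: e mult_ac)
      show "?F (Suc n) s' \<le> ennreal (r ^ (N - Suc n) * pot (T @ [a]))"
        if "a < m \<or> a = 0" "sampled (T @ [a]) s'" for s' a
        using that centers_sampled[OF that(2)] T by auto
    qed
    then have "ev D (m * 16 + 15) sample (?F (Suc n)) s \<le> ?F n s" using I by (simp add: T_def)
    then show "bval D (RLess (ROfNat (nvar ''cnt'')) (rvar ''thr'')) s \<and> ev D (m * 16 + 15) sample (?F (Suc n)) s \<le> ?F n s"
      using T N[of n] n by (simp add: sampled_def)
  next
    fix s assume "?F N s < top"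
    then have I: "?I N s" by (auto split: if_splits)
    then show "\<not> bval D (RLess (ROfNat (nvar ''cnt'')) (rvar ''thr'')) s"
      using N[of N] by (auto simp: sampled_def)
  qed
  also have "?F 0 s = ennreal (r ^ N * pot [0])"
    using s centers_sampled[OF s] by simp
  finally show ?thesis .
qed

section \<open>Enumeration of the center sets\<close>

definition "position_cost p g = D p (m + g)"

definition "center_list T j =
  greedy f (map (\<lambda>i. position_cost (T ! (j div length T ^ i mod length T))) [0..<k]) {}"

text \<open>Unlike \<open>env\<close> it says nothing about \<open>mark\<close>, which the
  enumeration fills with stamps.\<close>

definition enum_base :: "nat list \<Rightarrow> store \<Rightarrow> bool" where
  "enum_base T s \<longleftrightarrow> nats s ''clients'' 0 = m \<and> nats s ''facilities'' 0 = f \<and> nats s ''k'' 0 = k \<and>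
     nats s ''cnt'' 0 = length T \<and> (\<forall>a<length T. nats s ''T'' a = T ! a) \<and>
     nats s ''pw'' 0 = length T ^ k"

definition enum_outer :: "nat list \<Rightarrow> nat \<Rightarrow> store \<Rightarrow> bool" where
  "enum_outer T j s \<longleftrightarrow> enum_base T s \<and> (\<forall>g. nats s ''mark'' g \<le> j) \<and>
     (\<forall>j'<j. \<forall>i<k. nats s ''out'' (j' * k + i) = center_list T j' ! i)"

definition enum_inner :: "nat list \<Rightarrow> nat \<Rightarrow> nat \<Rightarrow> store \<Rightarrow> bool" where
  "enum_inner T j i s \<longleftrightarrow> enum_base T s \<and> nats s ''j'' 0 = j \<and>
     nats s ''rem'' 0 = j div length T ^ i \<and>
     (\<forall>g. nats s ''mark'' g \<le> Suc j) \<and>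
     {g. nats s ''mark'' g = Suc j} = set (take i (center_list T j)) \<and>
     (\<forall>j'<j. \<forall>i'<k. nats s ''out'' (j' * k + i') = center_list T j' ! i') \<and>
     (\<forall>i'<i. nats s ''out'' (j * k + i') = center_list T j ! i')"

lemma length_center_list [simp]: "length (center_list T j) = k"
  by (simp add: center_list_def)

lemma nat_update_same [simp]: "nat_update x i v (nat_update x i w s) = nat_update x i v s"
  by (simp add: nat_update_def)

lemma nat_update_commute: "x \<noteq> y \<Longrightarrow> nat_update x i v (nat_update y j w s) = nat_update y j w (nat_update x i v s)"
  by (simp add: nat_update_def fun_upd_twist)

lemma nat_update_id: "nats s x i = v \<Longrightarrow> nat_update x i v s = s"
  by (simp add: nat_update_def fun_upd_idem)

lemma split_digit_ok:
  assumes s: "nats s ''cnt'' 0 = K" "0 < K" "nats s ''rem'' 0 = x" "nats s ''quot'' 0 = 0"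
    and t: "x div K * 5 + 1 \<le> t"
  shows "ok D t split_digit (\<lambda>s'. s' = nat_update ''quot'' 0 (x div K) (nat_update ''rem'' 0 (x mod K) s)) s"
proof -
  let ?I = "\<lambda>n s'. s' = nat_update ''quot'' 0 n (nat_update ''rem'' 0 (x - n * K) s)"
  have "ok D (x div K * (3 + 2) + 1) split_digit (?I (x div K)) s"
    unfolding split_digit_def
  proof (rule ok_While[where N = "x div K" and I = ?I])
    show "?I 0 s" using s by (simp add: nat_update_id)
  next
    fix n s' assume n: "n < x div K" and I: "?I n s'"
    have "Suc n * K \<le> x div K * K" using n by (intro mult_right_mono) auto
    also have "\<dots> \<le> x" by simp
    finally have le: "K \<le> x - n * K" by simp
    have "wpe D (nset ''rem'' (NMinus (nvar ''rem'') (nvar ''cnt'')) ;; nset ''quot'' (NPlus (nvar ''quot'') (NConst 1)))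
        (emb (?I (Suc n))) s' = 0"
      using I s(1) by (simp add: nat_update_commute[of "''rem''" "''quot''"] diff_diff_left add.commute)
    then show "bval D (BNot (NLess (nvar ''rem'') (nvar ''cnt''))) s' \<and>
        ok D 3 (nset ''rem'' (NMinus (nvar ''rem'') (nvar ''cnt'')) ;; nset ''quot'' (NPlus (nvar ''quot'') (NConst 1)))
          (?I (Suc n)) s'"
      using I s(1) le by (intro conjI ok_wpe) simp_all
  next
    fix s' assume "?I (x div K) s'"
    then show "\<not> bval D (BNot (NLess (nvar ''rem'') (nvar ''cnt''))) s'"
      using s(1,2) by (simp add: minus_div_mult_eq_mod)
  qed
  then show ?thesis by (rule ok_weaken) (use t in \<open>simp_all add: minus_div_mult_eq_mod\<close>)
qed

text \<open>The scan follows the recursion of \<open>near\<close>. As no stamp exceeds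
  \<open>Suc j\<close>, the program's test that the stamp is below \<open>j + 1\<close> amounts to
  the facility being free.\<close>

lemma find_nearest_ok:
  assumes s: "nats s ''clients'' 0 = m" "nats s ''facilities'' 0 = f" "nats s ''j'' 0 = j" "nats s ''p'' 0 = p"
    "nats s ''best'' 0 = f" "\<And>g. nats s ''mark'' g \<le> Suc j"
  shows "ok D (f * 6 + 3) find_nearest
    (\<lambda>s'. s' = nat_update ''g'' 0 f (nat_update ''best'' 0 (near f (position_cost p) {g. nats s ''mark'' g = Suc j} f) s)) s"
proof -
  define b where "b = near f (position_cost p) {g. nats s ''mark'' g = Suc j}"
  have b_le: "n \<le> f \<Longrightarrow> b n \<le> f" for n
    using near_cases[of n f "position_cost p" "{g. nats s ''mark'' g = Suc j}"] by (auto simp: b_def)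
  have b_Suc: "b (Suc n) = (if nats s ''mark'' n < Suc j \<and> (b n < f \<longrightarrow> D p (m + n) < D p (m + b n)) then n else b n)"
    if "n < f" for n
    using b_le[of n] that s(6)[of n] by (auto simp: b_def position_cost_def)
  let ?I = "\<lambda>n s'. s' = nat_update ''g'' 0 n (nat_update ''best'' 0 (b n) s)"
  have "ok D (f * 6 + 3) find_nearest (?I f) s"
    unfolding find_nearest_def
  proof (rule ok_For[where tb = 2 and N = f and I = ?I])
    fix n s' assume n: "n < f" and I: "?I n s'"
    show "ok D 2 (If (BAnd (NLess (NCell ''mark'' (nvar ''g'')) (NPlus (nvar ''j'') (NConst 1)))
            (BNot (BAnd (NLess (nvar ''best'') (nvar ''facilities''))
              (BNot (RLess (Dist (nvar ''p'') (NPlus (nvar ''clients'') (nvar ''g'')))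
                           (Dist (nvar ''p'') (NPlus (nvar ''clients'') (nvar ''best''))))))))
        (nset ''best'' (nvar ''g'')) SKIP)
        (\<lambda>s'. nats s' ''g'' 0 = n \<and> ?I (Suc n) (nat_update ''g'' 0 (Suc n) s')) s'"
      by (rule ok_wpe)
        (use s I in \<open>auto simp: b_Suc[OF n] nat_update_commute[of "''best''" "''g''"]\<close>)
  next
    show "?I 0 (nat_update ''g'' 0 0 s)" using s(5) by (simp add: b_def nat_update_id)
  qed (use s in simp_all)
  then show ?thesis by (simp add: b_def)
qed

lemma block_index_neq: "j' < j \<Longrightarrow> i' < k \<Longrightarrow> j' * k + i' \<noteq> j * k + (i::nat)"
proof -
  assume "j' < j" "i' < k"
  then have "Suc j' * k \<le> j * k" by (intro mult_right_mono) auto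
  then show ?thesis using \<open>i' < k\<close> by simp
qed

text \<open>Each piece has a single possible final store, so the proof follows the explicit stores
  \<open>s1\<close> to \<open>s5\<close> and re-establishes the invariant only once, at the
  end.\<close>

lemma next_center_ok:
  assumes T: "T \<noteq> []" and j: "j < length T ^ k" and i: "i < k" "nats s ''i'' 0 = i" and s: "enum_inner T j i s"
  shows "ok D (length T ^ k * 5 + f * 6 + 17) next_center
    (\<lambda>s'. nats s' ''i'' 0 = i \<and> enum_inner T j (Suc i) (nat_update ''i'' 0 (Suc i) s')) s"
proof -
  define K where "K = length T"
  define x where "x = j div K ^ i"
  define M where "M = set (take i (center_list T j))"
  define b where "b = near f (position_cost (T ! (x mod K))) M f"
  have K: "0 < K" using T by (simp add: K_def)
  note s' = s[unfolded enum_inner_def enum_base_def, folded K_def, folded x_def M_def]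
  have xm: "nats s ''T'' (x mod K) = T ! (x mod K)" using K s' by simp
  have "take (Suc i) (center_list T j) = take i (center_list T j) @ [b]"
    using i(1) by (simp add: center_list_def take_Suc_greedy b_def M_def x_def K_def)
  then have snoc: "set (take (Suc i) (center_list T j)) = insert b M" "center_list T j ! i = b"
    using i(1) by (simp_all add: M_def take_Suc_conv_app_nth)
  have xK: "x div K = j div K ^ Suc i" by (simp add: x_def div_mult2_eq mult.commute[of K])
  have "x div K \<le> j" by (metis xK div_le_dividend)
  then have xt: "x div K * 5 + 1 \<le> K ^ k * 5 + 1" using j by (simp add: K_def)
  define s1 where "s1 = nat_update ''quot'' 0 0 s"
  define s2 where "s2 = nat_update ''quot'' 0 (x div K) (nat_update ''rem'' 0 (x mod K) s1)"
  define s3 where "s3 = nat_update ''best'' 0 f (nat_update ''p'' 0 (T ! (x mod K)) s2)"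
  define s4 where "s4 = nat_update ''g'' 0 f (nat_update ''best'' 0 b s3)"
  define s5 where "s5 = nat_update ''rem'' 0 (x div K) (nat_update ''mark'' b (Suc j) (nat_update ''out'' (j * k + i) b s4))"
  have frame4: "nats s4 y = nats s y" if "y \<notin> {''quot'', ''rem'', ''best'', ''p'', ''g''}" for y
    using that by (simp add: s4_def s3_def s2_def s1_def)
  have val4: "nats s4 ''quot'' 0 = x div K" "nats s4 ''best'' 0 = b"
    by (simp_all add: s4_def s3_def s2_def s1_def)
  let ?rest3 = "NAssign ''out'' (NPlus (NTimes (nvar ''j'') (nvar ''k'')) (nvar ''i'')) (nvar ''best'') ;;
      NAssign ''mark'' (nvar ''best'') (NPlus (nvar ''j'') (NConst 1)) ;;
      nset ''rem'' (nvar ''quot'')"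
  let ?rest2 = "find_nearest ;; ?rest3"
  let ?rest1 = "(nset ''p'' (NCell ''T'' (nvar ''rem'')) ;; nset ''best'' (nvar ''facilities'')) ;; ?rest2"
  have r3: "ok D 5 ?rest3 (\<lambda>s'. s' = s5) s4"
    by (rule ok_wpe) (use s' i(2) in \<open>simp_all add: s5_def frame4 val4\<close>)
  have "ok D (f * 6 + 3) find_nearest (\<lambda>s'. s' = nat_update ''g'' 0 f (nat_update ''best'' 0
      (near f (position_cost (T ! (x mod K))) {g. nats s3 ''mark'' g = Suc j} f) s3)) s3"
    by (rule find_nearest_ok) (use s' in \<open>simp_all add: s3_def s2_def s1_def\<close>)
  moreover have "{g. nats s3 ''mark'' g = Suc j} = M" using s' by (simp add: s3_def s2_def s1_def)
  ultimately have r2': "ok D (f * 6 + 3) find_nearest (\<lambda>s'. s' = s4) s3"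
    by (simp add: s4_def b_def)
  have r2: "ok D (f * 6 + 9) ?rest2 (\<lambda>s'. s' = s5) s3"
    by (rule ok_Seq[OF r2', where ?t2.0 = 5]) (use r3 in simp_all)
  have r1': "ok D 3 (nset ''p'' (NCell ''T'' (nvar ''rem'')) ;; nset ''best'' (nvar ''facilities'')) (\<lambda>s'. s' = s3) s2"
    by (rule ok_wpe) (use s' xm in \<open>simp_all add: s3_def s2_def s1_def\<close>)
  have r1: "ok D (f * 6 + 13) ?rest1 (\<lambda>s'. s' = s5) s2"
    by (rule ok_Seq[OF r1', where ?t2.0 = "f * 6 + 9"]) (use r2 in simp_all)
  have r0': "ok D (K ^ k * 5 + 1) split_digit (\<lambda>s'. s' = s2) s1"
    unfolding s2_def by (rule split_digit_ok[OF _ K _ _ xt]) (use s' in \<open>simp_all add: s1_def\<close>)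
  have r0: "ok D (K ^ k * 5 + f * 6 + 15) (split_digit ;; ?rest1) (\<lambda>s'. s' = s5) s1"
    by (rule ok_Seq[OF r0', where ?t2.0 = "f * 6 + 13"]) (use r1 in simp_all)
  have "ok D 1 (nset ''quot'' (NConst 0)) (\<lambda>s'. s' = s1) s"
    by (rule ok_wpe) (simp_all add: s1_def)
  then have all: "ok D (K ^ k * 5 + f * 6 + 17) next_center (\<lambda>s'. s' = s5) s"
    unfolding next_center_def by (rule ok_Seq[where ?t2.0 = "K ^ k * 5 + f * 6 + 15"]) (use r0 in simp_all)
  let ?s6 = "nat_update ''i'' 0 (Suc i) s5"
  have out: "nats ?s6 ''out'' = (nats s ''out'')(j * k + i := b)"
    and mark: "nats ?s6 ''mark'' = (nats s ''mark'')(b := Suc j)"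
    by (simp_all add: s5_def frame4)
  have base: "enum_base T ?s6" "nats ?s6 ''j'' 0 = j" "nats ?s6 ''rem'' 0 = j div K ^ Suc i" "nats s5 ''i'' 0 = i"
    using s' i(2) unfolding xK[symmetric] by (simp_all add: enum_base_def s5_def frame4 K_def)
  have "{g. nats ?s6 ''mark'' g = Suc j} = insert b M" unfolding mark using s' by auto
  moreover have "nats ?s6 ''mark'' g \<le> Suc j" for g unfolding mark using s' by simp
  moreover have "nats ?s6 ''out'' (j' * k + i') = center_list T j' ! i'" if "j' < j" "i' < k" for j' i'
    unfolding out using s' that block_index_neq[OF that] by simp
  moreover have "nats ?s6 ''out'' (j * k + i') = center_list T j ! i'" if "i' < Suc i" for i'
    unfolding out using s' that snoc(2) by (cases "i' = i") simp_all
  ultimately have "enum_inner T j (Suc i) ?s6"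
    unfolding enum_inner_def snoc(1) using base by (simp only: K_def) blast
  then show ?thesis
    using base(4) by (intro ok_weaken[OF all]) (simp_all add: K_def)
qed

lemma enumerate_centers_ok:
  assumes T: "T \<noteq> []" and s: "enum_outer T 0 s"
  shows "ok D (length T ^ k * (k * (length T ^ k * 5 + f * 6 + 21) + 9) + 3) enumerate_centers
    (enum_outer T (length T ^ k)) s"
proof -
  let ?t = "length T ^ k * 5 + f * 6 + 17"
  have frame: "enum_base T (nat_update y 0 v s) = enum_base T s" if "y \<in> {''i'', ''j'', ''rem''}" for y v s
    using that by (auto simp: enum_base_def)
  have "ok D (length T ^ k * ((k * (?t + 4) + 5) + 4) + 3) enumerate_centers (enum_outer T (length T ^ k)) s"
    unfolding enumerate_centers_def
  proof (rule ok_For[where N = "length T ^ k" and I = "enum_outer T" and tb = "k * (?t + 4) + 5"])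
    fix j s assume j: "j < length T ^ k" "nats s ''j'' 0 = j" and I: "enum_outer T j s"
    let ?s1 = "nat_update ''rem'' 0 j s"
    \<comment> \<open>All stamps are at most \<open>j\<close>, so the new block starts with every
      facility free.\<close>
    have "{g. nats s ''mark'' g = Suc j} = {}" using I unfolding enum_outer_def by (auto, metis Suc_n_not_le_n)
    then have I1: "enum_inner T j 0 (nat_update ''i'' 0 0 ?s1)"
      using I j(2) by (simp add: enum_inner_def enum_outer_def frame le_SucI)
    have "ok D (k * (?t + 4) + 3) (For ''i'' (nvar ''k'') next_center) (enum_inner T j k) ?s1"
    proof (rule ok_For[where N = k and I = "enum_inner T j" and tb = ?t])
      show "ok D ?t next_center (\<lambda>s'. nats s' ''i'' 0 = n \<and> enum_inner T j (Suc n) (nat_update ''i'' 0 (Suc n) s')) s"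
        if "n < k" "nats s ''i'' 0 = n" "enum_inner T j n s" for n s
        by (rule next_center_ok[OF T j(1) that])
    qed (use I1 in \<open>simp_all add: enum_inner_def enum_base_def\<close>)
    then have loop: "ok D (k * (?t + 4) + 3) (For ''i'' (nvar ''k'') next_center)
        (\<lambda>s'. nats s' ''j'' 0 = j \<and> enum_outer T (Suc j) (nat_update ''j'' 0 (Suc j) s')) ?s1"
    proof (rule ok_weaken)
      fix s' assume "enum_inner T j k s'"
      then show "nats s' ''j'' 0 = j \<and> enum_outer T (Suc j) (nat_update ''j'' 0 (Suc j) s')"
        by (simp add: enum_inner_def enum_outer_def frame less_Suc_eq)
    qed simp
    have "ok D 1 (nset ''rem'' (nvar ''j'')) (\<lambda>s'. s' = ?s1) s"
      by (rule ok_wpe) (use j(2) in simp_all)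
    then show "ok D (k * (?t + 4) + 5) (nset ''rem'' (nvar ''j'') ;; For ''i'' (nvar ''k'') next_center)
        (\<lambda>s'. nats s' ''j'' 0 = j \<and> enum_outer T (Suc j) (nat_update ''j'' 0 (Suc j) s')) s"
      by (rule ok_Seq[where ?t2.0 = "k * (?t + 4) + 3"]) (use loop in simp_all)
  next
    show "enum_outer T 0 (nat_update ''j'' 0 0 s)"
      using s by (simp add: enum_outer_def frame)
  qed (simp_all add: enum_outer_def enum_base_def)
  then show ?thesis by (simp add: algebra_simps)
qed

definition enumerated :: "nat list \<Rightarrow> store \<Rightarrow> bool" where
  "enumerated T s \<longleftrightarrow> nats s ''len'' 0 = length T ^ k \<and>
     (\<forall>j<length T ^ k. \<forall>i<k. nats s ''out'' (j * k + i) = center_list T j ! i)"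

lemma enumeration_ok:
  assumes T: "T \<noteq> []" and s: "sampled T s"
  shows "ok D (length T ^ k * (k * (length T ^ k * 5 + f * 6 + 21) + 9) + 5 * k + 11)
    (power_count ;; enumerate_centers ;; nset ''len'' (nvar ''pw'')) (enumerated T) s"
proof -
  let ?K = "length T"
  let ?I = "\<lambda>n s. sampled T s \<and> nats s ''pw'' 0 = ?K ^ n"
  let ?te = "?K ^ k * (k * (?K ^ k * 5 + f * 6 + 21) + 9) + 3"
  have "ok D (k * 5 + 3) (For ''i'' (nvar ''k'') (nset ''pw'' (NTimes (nvar ''pw'') (nvar ''cnt'')))) (?I k)
      (nat_update ''pw'' 0 1 s)"
  proof (rule ok_For[where N = k and I = ?I and tb = 1])
    show "ok D 1 (nset ''pw'' (NTimes (nvar ''pw'') (nvar ''cnt'')))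
       (\<lambda>s'. nats s' ''i'' 0 = n \<and> ?I (Suc n) (nat_update ''i'' 0 (Suc n) s')) s'"
      if "nats s' ''i'' 0 = n" "?I n s'" for n s'
      by (rule ok_wpe) (use that in \<open>simp_all, simp add: sampled_def mult.commute\<close>)
    show "nval (nvar ''k'') s' = k" if "?I n s'" for n s'
      using that by (simp add: sampled_def env_def)
  qed (use s in simp_all)
  moreover have "ok D 1 (nset ''pw'' (NConst 1)) (\<lambda>s'. s' = nat_update ''pw'' 0 1 s) s"
    by (rule ok_wpe) simp_all
  ultimately have pc: "ok D (k * 5 + 5) power_count (?I k) s"
    unfolding power_count_def by (elim ok_Seq[where ?t2.0 = "k * 5 + 3"]) auto
  have ec: "ok D (?te + 2) (enumerate_centers ;; nset ''len'' (nvar ''pw'')) (enumerated T) s'" if "?I k s'" for s'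
  proof (rule ok_Seq[where ?t2.0 = 1])
    show "ok D ?te enumerate_centers (enum_outer T (?K ^ k)) s'"
      by (rule enumerate_centers_ok[OF T])
        (use that in \<open>simp add: sampled_def env_def enum_outer_def enum_base_def\<close>)
    show "ok D 1 (nset ''len'' (nvar ''pw'')) (enumerated T) s''" if "enum_outer T (?K ^ k) s''" for s''
      by (rule ok_wpe) (use that in \<open>simp_all add: enumerated_def enum_outer_def enum_base_def\<close>)
  qed simp
  show ?thesis by (rule ok_Seq[OF pc ec]) auto
qed

end

section \<open>Success probability and running time\<close>

definition run_time :: "nat \<Rightarrow> nat \<Rightarrow> nat \<Rightarrow> nat \<Rightarrow> nat" where
  "run_time m f k N = m * 5 + 7 + 1 + ((N * (m * 16 + 15 + 2) + 1) + 1 +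
     (Suc N ^ k * (k * (Suc N ^ k * 5 + f * 6 + 21) + 9) + 5 * k + 11))"

lemma (in machine) algorithm_ev:
  assumes N: "\<And>n. real (Suc n) < bound \<longleftrightarrow> n < N"
    and pot: "\<And>T. 0 \<le> pot T" and r: "0 \<le> r"
    and pos: "\<And>T. T \<noteq> [] \<Longrightarrow> set T \<subseteq> insert 0 {..<m} \<Longrightarrow> 0 < (\<Sum>j<m. wgt T j) \<Longrightarrow>
      (\<Sum>j<m. wgt T j * pot (T @ [j])) \<le> r * pot T * (\<Sum>j<m. wgt T j)"
    and zero: "\<And>T. T \<noteq> [] \<Longrightarrow> set T \<subseteq> insert 0 {..<m} \<Longrightarrow> (\<Sum>j<m. wgt T j) = 0 \<Longrightarrow> pot (T @ [0]) \<le> r * pot T"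
    and G: "\<And>T s'. enumerated T s' \<Longrightarrow> length T = Suc N \<Longrightarrow> set T \<subseteq> insert 0 {..<m} \<Longrightarrow> G s' \<le> ennreal (pot T)"
  shows "ev D (run_time m f k N) algorithm G (input_store m f k l \<epsilon>) \<le> ennreal (r ^ N * pot [0])"
proof -
  let ?s = "input_store m f k l \<epsilon>"
  let ?enum = "power_count ;; enumerate_centers ;; nset ''len'' (nvar ''pw'')"
  let ?te = "Suc N ^ k * (k * (Suc N ^ k * 5 + f * 6 + 21) + 9) + 5 * k + 11"
  let ?ts = "N * (m * 16 + 15 + 2) + 1"
  have init: "ok D (m * 5 + 7) (init_weights ;; nset ''cnt'' (NConst 1) ;; threshold) (sampled [0]) ?s"
    by (rule init_ok) (simp_all add: input_store_def env_def)
  have "ev D (?ts + 1 + ?te) (sampling ;; ?enum) G s \<le> ennreal (r ^ N * pot [0])" if "sampled [0] s" for s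
  proof (rule ev_SeqI[OF _ order_refl order_refl])
    show "ev D ?ts sampling (ev D ?te ?enum G) s \<le> ennreal (r ^ N * pot [0])"
    proof (rule sampling_ev[OF that N pot r pos zero])
      fix T s' assume T: "sampled T s'" "length T = Suc N" "set T \<subseteq> insert 0 {..<m}"
      then have "T \<noteq> []" by auto
      from enumeration_ok[OF this T(1)]
      have "ok D ?te ?enum (enumerated T) s'" by (simp only: T(2))
      then show "ev D ?te ?enum G s' \<le> ennreal (pot T)" by (rule ok_ev) (rule G[OF _ T(2,3)])
    qed
  qed
  then have "ev D (m * 5 + 7) (init_weights ;; nset ''cnt'' (NConst 1) ;; threshold)
      (ev D (?ts + 1 + ?te) (sampling ;; ?enum) G) ?s \<le> ennreal (r ^ N * pot [0])"
    by (rule ok_ev[OF init])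
  then show ?thesis
    unfolding algorithm_def run_time_def by (rule ev_SeqI[OF _ order_refl order_refl])
qed

text \<open>The base \<open>N + 2\<close> is at least 2, so the power dominates \<open>k\<close>
  even for \<open>N = 0\<close>. Every monomial of the running time is then at most
  \<open>(m + f) * K ^ 3\<close>, and the coefficients add up to less than 200.\<close>

lemma run_time_le:
  assumes "1 \<le> m + f" and "1 \<le> k"
  shows "run_time m f k N \<le> 200 * (m + f) * (Suc (Suc N) ^ k) ^ 3"
proof -
  define K where "K = Suc (Suc N) ^ k"
  have "Suc N ^ k \<le> K" unfolding K_def by (intro power_mono) auto
  moreover have "N \<le> K" "1 \<le> K" "k \<le> K"
  proof -
    have "Suc (Suc N) ^ 1 \<le> K" unfolding K_def using assms by (intro power_increasing) auto
    then show "N \<le> K" "1 \<le> K" by auto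
    have "k < 2 ^ k" by (rule less_exp)
    also have "2 ^ k \<le> K" unfolding K_def by (intro power_mono) auto
    finally show "k \<le> K" by simp
  qed
  ultimately have K: "Suc N ^ k \<le> K" "N \<le> K" "1 \<le> K" "k \<le> K" by auto
  define M where "M = Suc N ^ k"
  have M: "M \<le> K" using K(1) by (simp add: M_def)
  let ?Q = "(m + f) * K * K * K"
  have b: "a * x * y * z \<le> ?Q" if "a \<le> m + f" "x \<le> K" "y \<le> K" "z \<le> K" for a x y z
    using that by (intro mult_le_mono) auto
  have "run_time m f k N = 5 * (m * 1 * 1 * 1) + 16 * (m * N * 1 * 1) + 17 * (1 * N * 1 * 1)
    + 5 * (1 * M * k * M) + 6 * (f * M * k * 1) + 21 * (1 * M * k * 1) + 9 * (1 * M * 1 * 1)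
    + 5 * (1 * k * 1 * 1) + 21 * (1 * 1 * 1 * 1)"
    unfolding run_time_def M_def[symmetric] by (simp add: algebra_simps)
  also have "\<dots> \<le> 5 * ?Q + 16 * ?Q + 17 * ?Q + 5 * ?Q + 6 * ?Q + 21 * ?Q + 9 * ?Q + 5 * ?Q + 21 * ?Q"
    by (intro add_mono mult_le_mono2 b) (use assms K(2-) M in auto)
  also have "\<dots> \<le> 200 * (m + f) * K ^ 3" by (simp add: power3_eq_cube)
  finally show ?thesis by (simp add: K_def)
qed

section \<open>Optimal centers and assignments of facilities to clusters\<close>

lemma Psi_opt_attained:
  assumes "finite L" "k \<le> card L"
  obtains ctr where "inj_on ctr {1..k}" "ctr ` {1..k} \<subseteq> L"
    "Psi_opt d l L k P = (\<Sum>i=1..k. \<Sum>x\<in>P i. d x (ctr i) powr l)"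
proof -
  let ?A = "{Psi d l k F P | F. k_center_set L k F}"
  have "finite {F. k_center_set L k F}"
    by (rule finite_subset[of _ "Pow L"]) (use assms in \<open>auto simp: k_center_set_def\<close>)
  then have fin: "finite ?A" by (simp add: setcompr_eq_image)
  obtain F0 where "F0 \<subseteq> L" "card F0 = k" using assms by (meson obtain_subset_with_card_n)
  then have "?A \<noteq> {}" by (auto simp: k_center_set_def)
  then have "Psi_opt d l L k P \<in> ?A" unfolding Psi_opt_def by (rule Min_in[OF fin])
  then obtain F where F: "F \<subseteq> L" "card F = k" "Psi_opt d l L k P = Psi d l k F P"
    by (auto simp: k_center_set_def)
  have "finite F" using F(1) assms(1) finite_subset by blast
  then obtain e where e: "bij_betw e {1..k} F"
    using F(2) by (metis ex_bij_betw_nat_finite_1)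
  let ?B = "{\<Sum>i=1..k. \<Sum>x\<in>P i. d x (e (\<pi> i)) powr l | \<pi>. \<pi> permutes {1..k}}"
  have "finite ?B" using finite_permutations[of "{1..k}"] by (simp add: setcompr_eq_image)
  moreover have "?B \<noteq> {}" using permutes_id by blast
  ultimately have "Min ?B \<in> ?B" by (rule Min_in)
  then have "Psi d l k F P \<in> ?B" unfolding Psi_eq_of_enumeration[OF e] .
  then obtain \<pi> where \<pi>: "\<pi> permutes {1..k}"
    "Psi d l k F P = (\<Sum>i=1..k. \<Sum>x\<in>P i. d x (e (\<pi> i)) powr l)" by auto
  \<comment> \<open>The minimising permutation is absorbed into the enumeration, so that cluster
    \<open>i\<close> is served by \<open>ctr i\<close>.\<close>
  have "bij_betw (e \<circ> \<pi>) {1..k} F" using e \<pi>(1) permutes_imp_bij bij_betw_trans by blast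
  then have "inj_on (e \<circ> \<pi>) {1..k}" "(e \<circ> \<pi>) ` {1..k} \<subseteq> L" using F(1) by (auto simp: bij_betw_def)
  then show ?thesis using that[of "e \<circ> \<pi>"] F(3) \<pi>(2) by simp
qed

lemma Psi_le:
  assumes "inj_on g {1..k}"
  shows "Psi d l k (g ` {1..k}) P \<le> (\<Sum>i=1..k. \<Sum>x\<in>P i. d x (g i) powr l)"
proof -
  have g: "bij_betw g {1..k} (g ` {1..k})" using assms by (simp add: bij_betw_def)
  let ?B = "{\<Sum>i=1..k. \<Sum>x\<in>P i. d x (g (\<pi> i)) powr l | \<pi>. \<pi> permutes {1..k}}"
  have "finite ?B" using finite_permutations[of "{1..k}"] by (simp add: setcompr_eq_image)
  moreover have "(\<Sum>i=1..k. \<Sum>x\<in>P i. d x (g i) powr l) \<in> ?B"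
    using permutes_id[of "{1..k}"] by (intro CollectI exI[of _ id]) auto
  ultimately show ?thesis unfolding Psi_eq_of_enumeration[OF g] by (rule Min_le)
qed

text \<open>For targets that are defined on the nonempty clusters only: the empty ones receive
  arbitrary distinct facilities among those left.\<close>

lemma inj_on_extend:
  assumes "finite I" "finite B" "J \<subseteq> I" "inj_on t J" "t ` J \<subseteq> B" "card I \<le> card B"
  obtains t' where "inj_on t' I" "t' ` I \<subseteq> B" "\<And>i. i \<in> J \<Longrightarrow> t' i = t i"
proof -
  have finJ: "finite J" using assms finite_subset by blast
  have "card (I - J) \<le> card (B - t ` J)"
    using assms finJ by (simp add: card_Diff_subset card_image)
  then obtain e where e: "e ` (I - J) \<subseteq> B - t ` J" "inj_on e (I - J)"
    using card_le_inj[of "I - J" "B - t ` J"] assms by auto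
  let ?t = "\<lambda>i. if i \<in> J then t i else e i"
  have "inj_on ?t I"
  proof (rule inj_onI)
    fix x y assume "x \<in> I" "y \<in> I" "?t x = ?t y"
    then show "x = y" using e assms(4) by (auto simp: inj_on_def split: if_splits)
  qed
  then show ?thesis using that[of ?t] e(1) assms(5) by auto
qed

section \<open>From positions in the input to points of the metric space\<close>

locale encoded_instance =
  fixes X :: "'a set" and d :: "'a \<Rightarrow> 'a \<Rightarrow> real" and C L :: "'a set" and k :: nat and l \<epsilon> :: real
    and cs fs :: "'a list"
  assumes inst: "k_service_instance X d C L k l" and eps: "0 < \<epsilon>" "\<epsilon> \<le> 1"
    and cs: "lists_set cs C" and fs: "lists_set fs L"
begin

abbreviation "m \<equiv> length cs"
abbreviation "f \<equiv> length fs"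
abbreviation "D \<equiv> dist_query d cs fs"
abbreviation "point \<equiv> (!) (cs @ fs)"

sublocale machine D m f k l \<epsilon> .
sublocale Metric_space X d using inst by (simp add: k_service_instance_def)

lemma inst': "finite L" "L \<subseteq> X" "finite C" "C \<subseteq> X" "0 < k" "k \<le> f" "1 \<le> l"
  using inst fs by (auto simp: k_service_instance_def lists_set_def distinct_card)

text \<open>The starting point counts as a sample, so one round less than the rounded threshold is
  performed.\<close>

definition "rounds = nat \<lceil>bound\<rceil> - 1"

lemma bound_ge: "2 \<le> bound"
proof -
  have "1 \<le> real k / \<epsilon>" using inst'(5) eps by (simp add: field_simps)
  then have "2 powr 1 \<le> (1 + real k / \<epsilon>) powr 1" by (intro powr_mono2) auto
  also have "\<dots> \<le> (1 + real k / \<epsilon>) powr (42 * l\<^sup>2)"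
    using \<open>1 \<le> real k / \<epsilon>\<close> one_le_power[OF inst'(7), of 2] by (intro powr_mono) auto
  finally show ?thesis by (simp add: bound_def)
qed

lemma Suc_rounds: "Suc rounds = nat \<lceil>bound\<rceil>" "bound \<le> Suc rounds" "real (Suc rounds) \<le> bound + 1"
proof -
  have "2 \<le> \<lceil>bound\<rceil>" using bound_ge by linarith
  then show *: "Suc rounds = nat \<lceil>bound\<rceil>" unfolding rounds_def by linarith
  show "bound \<le> Suc rounds" "real (Suc rounds) \<le> bound + 1" unfolding * using bound_ge by linarith+
qed

lemma rounds_iff: "real (Suc n) < bound \<longleftrightarrow> n < rounds"
proof -
  have "real (Suc n) < bound \<longleftrightarrow> int (Suc n) < \<lceil>bound\<rceil>" by (simp add: less_ceiling_iff)
  also have "\<dots> \<longleftrightarrow> Suc n < Suc rounds" unfolding Suc_rounds using bound_ge by linarith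
  finally show ?thesis by simp
qed

lemma D_eq: "i < m + f \<Longrightarrow> j < m + f \<Longrightarrow> D i j = d (point i) (point j)"
  by (simp add: dist_query_def Let_def)

text \<open>Position 0 is a point even if there are no clients: it is then a facility, because
  \<open>0 < k \<le> f\<close>.\<close>

lemma valid_positions:
  assumes "set T \<subseteq> insert 0 {..<m}" shows "set T \<subseteq> {..<m + f}" "point ` set T \<subseteq> X"
proof -
  show *: "set T \<subseteq> {..<m + f}" using assms inst'(5,6) by fastforce
  have "point p \<in> X" if "p < m + f" for p
  proof -
    have "point p \<in> set (cs @ fs)" using that by (intro nth_mem) simp
    then show ?thesis using cs fs inst' by (auto simp: lists_set_def)
  qed
  then show "point ` set T \<subseteq> X" using * by blast
qed

lemma fs_nth: "g < f \<Longrightarrow> fs ! g \<in> L" "inj_on ((!) fs) {..<f}"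
  using fs by (auto simp: lists_set_def inj_on_def nth_eq_iff_index_eq)

lemma bij_clients: "bij_betw point {..<m} C"
  using cs by (intro bij_betw_cong[THEN iffD2, OF _ bij_betw_nth])
    (auto simp: lists_set_def nth_append)

lemma center_list_valid:
  "distinct (center_list T j)" "set (center_list T j) \<subseteq> {..<f}"
  using greedy_distinct[of "{}" f] inst'(6) unfolding center_list_def by auto

lemma output_nth:
  assumes "enumerated T s" "j < length T ^ k"
  shows "(\<lambda>i. fs ! nats s ''out'' (j * k + i)) ` {..<k} = (!) fs ` set (center_list T j)"
proof -
  have "(\<lambda>i. fs ! nats s ''out'' (j * k + i)) ` {..<k} = (\<lambda>i. fs ! (center_list T j ! i)) ` {..<k}"
    using assms by (intro image_cong) (auto simp: enumerated_def)
  also have "\<dots> = (!) fs ` ((!) (center_list T j) ` {..<k})" by (simp add: image_image)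
  also have "(!) (center_list T j) ` {..<k} = set (center_list T j)"
    using length_center_list[of T j] by (force simp: set_conv_nth)
  finally show ?thesis .
qed

lemma output_list_enumerated:
  assumes "enumerated T s"
  shows "set (output_list fs k s) = (\<lambda>j. (!) fs ` set (center_list T j)) ` {..<length T ^ k}"
    and "length (output_list fs k s) = length T ^ k"
  using assms output_nth[OF assms] by (auto simp: output_list_def enumerated_def)

lemma output_valid:
  assumes "enumerated T s" "S \<in> set (output_list fs k s)"
  shows "k_center_set L k S"
proof -
  obtain j where j: "S = (!) fs ` set (center_list T j)"
    using assms output_list_enumerated by auto
  have "inj_on ((!) fs) (set (center_list T j))"
    using fs_nth(2) center_list_valid(2) by (rule inj_on_subset)
  then have "card S = k"
    unfolding j by (simp add: card_image distinct_card[OF center_list_valid(1)])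
  moreover have "S \<subseteq> L" unfolding j using center_list_valid(2) fs_nth(1) by auto
  ultimately show ?thesis by (simp add: k_center_set_def)
qed

end

section \<open>Analysis for a fixed clustering\<close>

locale encoded_clustering = encoded_instance +
  fixes P :: "nat \<Rightarrow> 'a set" and ctr :: "nat \<Rightarrow> 'a"
  assumes clust: "clustering C k P" and inj_ctr: "inj_on ctr {1..k}" and ctr_L: "ctr ` {1..k} \<subseteq> L"
begin

sublocale ci: clustered_instance X d C P ctr k l \<epsilon>
proof unfold_locales
  show "ctr i \<in> X" if "i \<in> {1..k}" for i
    using ctr_L inst'(2) that by blast
qed (use inst' eps clust in auto)

definition "pot T = real (ci.uncovered (point ` set T))"

lemma wgt_eq:
  assumes "set T \<subseteq> insert 0 {..<m}" "j < m"
  shows "wgt T j = ci.wt (point ` set T) (point j)"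
proof -
  have "(\<lambda>p. D j p powr l) ` set T = (\<lambda>p. d (point j) (point p) powr l) ` set T"
    using valid_positions(1)[OF assms(1)] assms(2) by (intro image_cong refl) (auto simp: D_eq)
  then show ?thesis by (simp add: wgt_def ci.wt_def image_image)
qed

lemma sum_wgt:
  assumes "set T \<subseteq> insert 0 {..<m}"
  shows "(\<Sum>j<m. wgt T j * h (point j)) = (\<Sum>x\<in>C. ci.wt (point ` set T) x * h x)"
proof -
  have "(\<Sum>j<m. wgt T j * h (point j)) = (\<Sum>j<m. ci.wt (point ` set T) (point j) * h (point j))"
    using assms by (intro sum.cong) (auto simp: wgt_eq)
  also have "\<dots> = (\<Sum>x\<in>C. ci.wt (point ` set T) x * h x)"
    by (rule sum.reindex_bij_betw[OF bij_clients])
  finally show ?thesis .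
qed

lemma pot_step:
  assumes T: "T \<noteq> []" "set T \<subseteq> insert 0 {..<m}"
  shows "(\<Sum>j<m. wgt T j * pot (T @ [j])) \<le> (1 - ci.q / k) * pot T * (\<Sum>j<m. wgt T j)"
proof -
  let ?S = "point ` set T"
  have "(\<Sum>j<m. wgt T j * pot (T @ [j])) = (\<Sum>j<m. wgt T j * real (ci.uncovered (insert (point j) ?S)))"
    by (simp add: pot_def)
  also have "\<dots> = (\<Sum>x\<in>C. ci.wt ?S x * real (ci.uncovered (insert x ?S)))"
    by (rule sum_wgt[OF T(2)])
  also have "\<dots> \<le> (1 - ci.q / k) * real (ci.uncovered ?S) * (\<Sum>x\<in>C. ci.wt ?S x)"
    by (rule ci.sampling_step) (use T valid_positions(2) in auto)
  also have "(\<Sum>x\<in>C. ci.wt ?S x) = (\<Sum>j<m. wgt T j)"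
    using sum_wgt[OF T(2), of "\<lambda>_. 1"] by simp
  finally show ?thesis by (simp add: pot_def)
qed

text \<open>If all weights vanish, every cluster is already covered, so it is harmless that the
  selection falls back on position 0.\<close>

lemma pot_zero:
  assumes T: "T \<noteq> []" "set T \<subseteq> insert 0 {..<m}" and z: "(\<Sum>j<m. wgt T j) = 0"
  shows "pot (T @ [0]) \<le> (1 - ci.q / k) * pot T"
proof -
  let ?S = "point ` set T"
  have "(\<Sum>x\<in>C. ci.wt ?S x) = 0" using sum_wgt[OF T(2), of "\<lambda>_. 1"] z by simp
  then have "ci.uncovered ?S = 0"
    using ci.weight_pos[of ?S] T valid_positions(2)[OF T(2)] by fastforce
  moreover have "ci.uncovered (point ` set (T @ [0])) \<le> ci.uncovered ?S"
    by (rule ci.uncovered_mono) auto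
  ultimately show ?thesis by (simp add: pot_def)
qed

text \<open>Since all tuples over the sample are tried, it suffices that some order of the
  representatives works. Two clusters may share a sample point; only the facilities have to be
  distinct.\<close>

lemma covered_output:
  assumes e: "enumerated T s" and T: "T \<noteq> []" "set T \<subseteq> insert 0 {..<m}"
    and unc: "ci.uncovered (point ` set T) = 0" and h: "h = 2 \<or> h = 1 \<and> C \<subseteq> L"
  shows "\<exists>S\<in>set (output_list fs k s). Psi d l k S P \<le> ((1 + h) powr l + \<epsilon>) * ci.opt"
proof -
  define J where "J = {i \<in> {1..k}. P i \<noteq> {}}"
  have "\<exists>a x. a < length T \<and> x \<in> ci.core i \<and>
      ci.csize i * d x (point (T ! a)) powr l \<le> ci.\<tau> * (ci.cost i + ci.opt / k)" if i: "i \<in> J" for i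
  proof -
    have "{i \<in> {1..k}. \<not> ci.covered (point ` set T) i} = {}"
      using unc unfolding ci.uncovered_def by (subst (asm) card_eq_0_iff) simp
    then have "ci.covered (point ` set T) i" "P i \<noteq> {}" using i by (auto simp: J_def)
    then obtain p x where p: "p \<in> point ` set T" "x \<in> ci.core i"
        "ci.csize i * d x p powr l \<le> ci.\<tau> * (ci.cost i + ci.opt / k)"
      unfolding ci.covered_def by blast
    then obtain a where "a < length T" "p = point (T ! a)" by (metis imageE in_set_conv_nth)
    then show ?thesis using p(2,3) by blast
  qed
  then obtain a0 x where ax: "\<And>i. i \<in> J \<Longrightarrow> a0 i < length T" "\<And>i. i \<in> J \<Longrightarrow> x i \<in> ci.core i"
      "\<And>i. i \<in> J \<Longrightarrow> ci.csize i * d (x i) (point (T ! a0 i)) powr l \<le> ci.\<tau> * (ci.cost i + ci.opt / k)"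
    by metis
  \<comment> \<open>An empty cluster is represented by the starting sample. It costs nothing, and
    its facility matters only for distinctness.\<close>
  define a where "a i = (if i \<in> J then a0 i else 0)" for i
  have a_len: "a i < length T" for i using ax(1) T(1) by (simp add: a_def)
  have xP: "x i \<in> P i" if "i \<in> J" for i using ax(2)[OF that] ci.core_subset by auto
  have PX: "P i \<subseteq> X" "P i \<subseteq> C" if "i \<in> J" for i using that ci.PX ci.PC by (auto simp: J_def)
  \<comment> \<open>The targets are unknown to the program and only certify distances: the optimal
    centers in general, the core clients themselves if \<open>C \<subseteq> L\<close>. The latter
    are distinct because the clusters are disjoint.\<close>
  have "\<exists>t. inj_on t {1..k} \<and> t ` {1..k} \<subseteq> L \<and> (\<forall>i\<in>J. d (x i) (t i) \<le> (h - 1) * d (x i) (ctr i))"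
  proof (cases "h = 2")
    case True
    then show ?thesis using inj_ctr ctr_L by (intro exI[of _ ctr]) auto
  next
    case False
    then have h1: "h = 1" "C \<subseteq> L" using h by auto
    have injx: "inj_on x J"
    proof (rule inj_onI, rule ccontr)
      fix i j assume ij: "i \<in> J" "j \<in> J" "x i = x j" "i \<noteq> j"
      then have "P i \<inter> P j = {}" using ci.disj by (simp add: disjoint_family_on_def J_def)
      then show False using xP[OF ij(1)] xP[OF ij(2)] ij(3) by auto
    qed
    have xL: "x ` J \<subseteq> L" using xP PX(2) h1(2) by blast
    have JI: "J \<subseteq> {1..k}" by (auto simp: J_def)
    have "card {1..k} \<le> card L" using inst by (simp add: k_service_instance_def)
    from inj_on_extend[OF finite_atLeastAtMost inst'(1) JI injx xL this]
    obtain t where t: "inj_on t {1..k}" "t ` {1..k} \<subseteq> L" "\<And>i. i \<in> J \<Longrightarrow> t i = x i" by blast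
    have "d (x i) (t i) \<le> (h - 1) * d (x i) (ctr i)" if "i \<in> J" for i
      using t(3)[OF that] xP[OF that] PX[OF that] by (auto simp: h1)
    then show ?thesis using t by blast
  qed
  then obtain t where t: "inj_on t {1..k}" "t ` {1..k} \<subseteq> L"
      "\<And>i. i \<in> J \<Longrightarrow> d (x i) (t i) \<le> (h - 1) * d (x i) (ctr i)" by blast
  have "\<forall>i\<in>{1..k}. \<exists>g. g < f \<and> fs ! g = t i"
    using t(2) fs by (auto simp: lists_set_def in_set_conv_nth image_subset_iff)
  then obtain u where u: "\<And>i. i \<in> {1..k} \<Longrightarrow> u i < f \<and> fs ! u i = t i" by metis
  have "inj_on u {1..k}" using t(1) u unfolding inj_on_def by metis
  moreover have "u ` {1..k} \<subseteq> {..<f} - {}" using u by auto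
  ultimately obtain js where js: "distinct js" "set js = {1..k}"
    "\<And>j. j < length js \<Longrightarrow> position_cost (T ! a (js ! j))
        (greedy f (map (\<lambda>i. position_cost (T ! a i)) js) {} ! j) \<le> position_cost (T ! a (js ! j)) (u (js ! j))"
    using exists_greedy_order[of "{1..k}" u f "{}" "\<lambda>i. position_cost (T ! a i)"] by auto
  have len: "length js = k" using js(1,2) by (metis card_atLeastAtMost diff_Suc_1 distinct_card)
  \<comment> \<open>The order \<open>js\<close> is spelled out by the digits of some
    \<open>j\<close>, so its greedy list is one of the outputs.\<close>
  obtain j where j: "j < length T ^ k" "\<And>i. i < k \<Longrightarrow> j div length T ^ i mod length T = a (js ! i)"
    using exists_digits[of k "\<lambda>i. a (js ! i)" "length T"] a_len by metis
  define G where "G = center_list T j"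
  have G: "G = greedy f (map (\<lambda>i. position_cost (T ! a i)) js) {}"
  proof -
    have "map (\<lambda>i. position_cost (T ! (j div length T ^ i mod length T))) [0..<k] = map (\<lambda>i. position_cost (T ! a i)) js"
      by (rule nth_equalityI) (use len j(2) in auto)
    then show ?thesis by (simp add: G_def center_list_def)
  qed
  have G_props: "length G = k" "distinct G" "set G \<subseteq> {..<f}"
    using center_list_valid by (simp_all add: G_def)
  have bij: "bij_betw ((!) js) {..<k} {1..k}" using js(1,2) len by (intro bij_betw_nth) auto
  define g where "g i = fs ! (G ! inv_into {..<k} ((!) js) i)" for i
  have g_js: "g (js ! n) = fs ! (G ! n)" if "n < k" for n
    using bij that by (simp add: g_def bij_betw_def inv_into_f_f)
  have bijG: "bij_betw ((!) G) {..<k} (set G)" using G_props by (intro bij_betw_nth) auto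
  have "bij_betw ((!) fs) (set G) ((!) fs ` set G)"
    by (rule inj_on_imp_bij_betw[OF inj_on_subset[OF fs_nth(2) G_props(3)]])
  note bij_betw_trans[OF bij_betw_trans[OF bij_betw_inv_into[OF bij] bijG] this]
  moreover have "g = (!) fs \<circ> ((!) G \<circ> inv_into {..<k} ((!) js))" by (simp add: fun_eq_iff g_def)
  ultimately  have bij_g: "bij_betw g {1..k} ((!) fs ` set G)"
    by (simp only:)
  have inj_g: "inj_on g {1..k}" and img: "g ` {1..k} = (!) fs ` set G"
    using bij_g by (simp_all add: bij_betw_def)
  have gL: "g i \<in> L" if "i \<in> {1..k}" for i
  proof -
    have "g i \<in> (!) fs ` set G" unfolding img[symmetric] by (rule imageI[OF that])
    then obtain n where "n \<in> set G" "g i = fs ! n" by (rule imageE)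
    then show ?thesis using G_props(3) fs_nth(1)[of n] by auto
  qed
  \<comment> \<open>The path runs from \<open>y\<close> through the center, the core client and the
    sample point to \<open>g i\<close>; its last leg is at most the distance from the sample point
    to the target, which is again compared through the core client.\<close>
  have dist: "d y (g i) \<le> d y (ctr i) + h * d (x i) (ctr i) + 2 * d (x i) (point (T ! a i))"
    if i: "i \<in> J" and y: "y \<in> P i" for i y
  proof -
    have ik: "i \<in> {1..k}" using i by (simp add: J_def)
    obtain n where n: "n < k" "i = js ! n"
      using ik js(2) len by (metis in_set_conv_nth)
    let ?p = "point (T ! a i)"
    have Ta: "T ! a i < m + f" using valid_positions(1)[OF T(2)] a_len[of i] nth_mem by blast
    have Gn: "G ! n < f" using G_props n(1) nth_mem by blast
    have "position_cost (T ! a i) (G ! n) \<le> position_cost (T ! a i) (u i)"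
      using js(3)[of n] n len by (simp add: G)
    then have pg: "d ?p (g i) \<le> d ?p (t i)"
      using Ta Gn u[OF ik] g_js[OF n(1)] n(2) by (simp add: position_cost_def D_eq nth_append)
    have "ctr i \<in> L" "t i \<in> L" using ik ctr_L t(2) by blast+
    then have X: "y \<in> X" "x i \<in> X" "ctr i \<in> X" "?p \<in> X" "g i \<in> X" "t i \<in> X"
      using y xP[OF i] PX[OF i] gL[OF ik] inst'(2) valid_positions(2)[OF T(2)] a_len[of i] by auto
    have "d y (g i) \<le> d y (ctr i) + d (ctr i) (g i)" using X triangle by auto
    moreover have "d (ctr i) (g i) \<le> d (ctr i) (x i) + d (x i) (g i)" using X triangle by auto
    moreover have "d (x i) (g i) \<le> d (x i) ?p + d ?p (g i)" using X triangle by auto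
    moreover have "d ?p (t i) \<le> d ?p (x i) + d (x i) (t i)" using X triangle by auto
    ultimately have "d y (g i) \<le> d y (ctr i) + d (x i) (ctr i) + 2 * d (x i) ?p + d (x i) (t i)"
      using pg commute[of "ctr i" "x i"] commute[of ?p "x i"] by linarith
    then show ?thesis using t(3)[OF i] by (simp add: algebra_simps)
  qed
  have "(\<Sum>i=1..k. \<Sum>y\<in>P i. d y (g i) powr l) \<le> ((1 + h) powr l + \<epsilon>) * ci.opt"
  proof (rule ci.covered_cost_bound)
    fix i assume "i \<in> {1..k}" "P i \<noteq> {}"
    then have i: "i \<in> J" by (simp add: J_def)
    show "\<exists>c. \<exists>x\<in>ci.core i. 0 \<le> c \<and> ci.csize i * c powr l \<le> ci.\<tau> * (ci.cost i + ci.opt / k) \<and>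
        (\<forall>y\<in>P i. 0 \<le> d y (g i) \<and> d y (g i) \<le> d y (ctr i) + h * d x (ctr i) + 2 * c)"
      using ax(2,3)[OF i] dist[OF i] i
      by (intro exI[of _ "d (x i) (point (T ! a i))"] bexI[of _ "x i"]) (auto simp: a_def)
  qed (use h in auto)
  moreover have "(!) fs ` set G \<in> set (output_list fs k s)"
    unfolding output_list_enumerated[OF e] G_def using j(1) by auto
  ultimately show ?thesis
    using Psi_le[OF inj_g, of d l P] unfolding img by (intro bexI[of _ "(!) fs ` set G"]) auto
qed

text \<open>One function serves two purposes: \<open>top\<close> on stores of the wrong form yields
  halting and valid output as soon as the expectation is finite, and the indicator yields the
  failure probability. The indicator is below \<open>pot\<close> because a nonzero
  \<open>pot\<close> is at least 1.\<close>

lemma success_ev: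
  assumes h: "h = 2 \<or> h = 1 \<and> C \<subseteq> L"
  shows "ev D (run_time m f k rounds) algorithm
    (\<lambda>s. if \<exists>T. length T = Suc rounds \<and> enumerated T s
      then indicator {s. \<not> (\<exists>S\<in>set (output_list fs k s). Psi d l k S P \<le> ((1 + h) powr l + \<epsilon>) * ci.opt)} s
      else top) (input_store m f k l \<epsilon>) \<le> ennreal (1 / 2)"
proof -
  have "ev D (run_time m f k rounds) algorithm
    (\<lambda>s. if \<exists>T. length T = Suc rounds \<and> enumerated T s
      then indicator {s. \<not> (\<exists>S\<in>set (output_list fs k s). Psi d l k S P \<le> ((1 + h) powr l + \<epsilon>) * ci.opt)} s
      else top) (input_store m f k l \<epsilon>) \<le> ennreal ((1 - ci.q / k) ^ rounds * pot [0])"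
  proof (rule algorithm_ev[OF rounds_iff _ ci.q_bounds(2) pot_step pot_zero])
    fix T s assume T: "enumerated T s" "length T = Suc rounds" "set T \<subseteq> insert 0 {..<m}"
    then have Tne: "T \<noteq> []" by auto
    let ?ind = "indicator {s. \<not> (\<exists>S\<in>set (output_list fs k s). Psi d l k S P \<le> ((1 + h) powr l + \<epsilon>) * ci.opt)} s :: ennreal"
    have "?ind \<le> ennreal (pot T)"
    proof (cases "ci.uncovered (point ` set T) = 0")
      case True
      then have "?ind = 0" using covered_output[OF T(1) Tne T(3) True h] by simp
      then show ?thesis by simp
    next
      case False
      then have "1 \<le> pot T" by (simp add: pot_def)
      then have "(1::ennreal) \<le> ennreal (pot T)" by simp
      then show ?thesis by (auto simp: indicator_def)
    qed
    then show "(if \<exists>T. length T = Suc rounds \<and> enumerated T s then ?ind else top) \<le> ennreal (pot T)"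
      using T by auto
  qed (auto simp: pot_def)
  also have "\<dots> \<le> ennreal (1 / 2)"
  proof (rule ennreal_leI)
    have "(1 - ci.q / k) ^ rounds * pot [0] \<le> (1 - ci.q / k) ^ rounds * k"
      using ci.uncovered_le ci.q_bounds(2) by (intro mult_left_mono) (auto simp: pot_def)
    also have "\<dots> \<le> 1 / 2"
      using ci.sampling_rounds[of rounds] Suc_rounds(2) by (simp add: bound_def ci.R_def)
    finally show "(1 - ci.q / k) ^ rounds * pot [0] \<le> 1 / 2" .
  qed
  finally show ?thesis .
qed

lemma halts_and_valid:
  "halts_within D (run_time m f k rounds) (algorithm, input_store m f k l \<epsilon>)"
  "cfg \<in> set_pmf (steps D (run_time m f k rounds) (algorithm, input_store m f k l \<epsilon>)) \<Longrightarrow>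
     \<exists>T. length T = Suc rounds \<and> enumerated T (snd cfg)"
proof -
  have "ev D (run_time m f k rounds) algorithm
    (\<lambda>s. if \<exists>T. length T = Suc rounds \<and> enumerated T s
      then indicator {s. \<not> (\<exists>S\<in>set (output_list fs k s). Psi d l k S P \<le> ((1 + 2) powr l + \<epsilon>) * ci.opt)} s
      else top) (input_store m f k l \<epsilon>) < top"
    by (rule le_less_trans[OF success_ev[of 2] ennreal_less_top]) simp
  note fin = ev_finite_imp[OF this]
  show "halts_within D (run_time m f k rounds) (algorithm, input_store m f k l \<epsilon>)" by (rule fin(1))
  show "\<exists>T. length T = Suc rounds \<and> enumerated T (snd cfg)"
    if "cfg \<in> set_pmf (steps D (run_time m f k rounds) (algorithm, input_store m f k l \<epsilon>))"
    using fin(2)[OF that] by (rule contrapos_pp) (simp only: if_False less_irrefl simp_thms)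
qed

lemma success_prob:
  assumes h: "h = 2 \<or> h = 1 \<and> C \<subseteq> L"
  shows "1 / 2 \<le> measure_pmf.prob (output_after algorithm (run_time m f k rounds) d cs fs k l \<epsilon>)
    {out. \<exists>S\<in>set out. Psi d l k S P \<le> ((1 + h) powr l + \<epsilon>) * ci.opt}"
proof -
  let ?A = "{out. \<exists>S\<in>set out. Psi d l k S P \<le> ((1 + h) powr l + \<epsilon>) * ci.opt}"
  let ?B = "{s. \<not> (\<exists>S\<in>set (output_list fs k s). Psi d l k S P \<le> ((1 + h) powr l + \<epsilon>) * ci.opt)}"
  let ?M = "steps D (run_time m f k rounds) (algorithm, input_store m f k l \<epsilon>)"
  let ?O = "output_after algorithm (run_time m f k rounds) d cs fs k l \<epsilon>"
  have O: "?O = map_pmf (\<lambda>cfg. output_list fs k (snd cfg)) ?M"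
    by (simp add: output_after_def input_config_def)
  have "emeasure (measure_pmf ?O) (- ?A) = (\<integral>\<^sup>+out. indicator (- ?A) out \<partial>measure_pmf ?O)"
    by simp
  also have "\<dots> = (\<integral>\<^sup>+cfg. indicator (- ?A) (output_list fs k (snd cfg)) \<partial>measure_pmf ?M)"
    unfolding O by (rule nn_integral_map_pmf)
  also have "\<dots> = (\<integral>\<^sup>+cfg. (if \<exists>T. length T = Suc rounds \<and> enumerated T (snd cfg)
      then indicator ?B (snd cfg) else top) \<partial>measure_pmf ?M)"
    by (rule nn_integral_cong_AE)
      (use halts_and_valid(2) in \<open>auto simp: AE_measure_pmf_iff indicator_def\<close>)
  also have "\<dots> \<le> ennreal (1 / 2)"
    using success_ev[OF h] unfolding ev_eq_nn_integral[OF halts_and_valid(1)] .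
  finally have "ennreal (measure_pmf.prob ?O (- ?A)) \<le> ennreal (1 / 2)"
    by (simp only: measure_pmf.emeasure_eq_measure)
  then have "measure_pmf.prob ?O (- ?A) \<le> 1 / 2"
    by (rule ennreal_le_iff[THEN iffD1, rotated]) simp
  moreover have "measure_pmf.prob ?O (- ?A) = 1 - measure_pmf.prob ?O ?A"
    using measure_pmf.prob_compl[of ?A ?O] by (simp add: Compl_eq_Diff_UNIV)
  ultimately show ?thesis by linarith
qed

end

section \<open>Collected guarantees and explicit bounds\<close>

context encoded_instance
begin

lemma clustering_results:
  assumes "clustering C k P"
  defines "t \<equiv> run_time m f k rounds"
  shows "halts_within D t (input_config algorithm cs fs k l \<epsilon>)"
    and "out \<in> set_pmf (output_after algorithm t d cs fs k l \<epsilon>) \<Longrightarrow>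
      length out = Suc rounds ^ k \<and> (\<forall>S\<in>set out. k_center_set L k S)"
    and "1 / 2 \<le> measure_pmf.prob (output_after algorithm t d cs fs k l \<epsilon>)
      {out. \<exists>S\<in>set out. Psi d l k S P \<le> (3 powr l + \<epsilon>) * Psi_opt d l L k P}"
    and "C \<subseteq> L \<Longrightarrow> 1 / 2 \<le> measure_pmf.prob (output_after algorithm t d cs fs k l \<epsilon>)
      {out. \<exists>S\<in>set out. Psi d l k S P \<le> (2 powr l + \<epsilon>) * Psi_opt d l L k P}"
proof -
  have "k \<le> card L" using inst by (simp add: k_service_instance_def)
  then obtain ctr where ctr: "inj_on ctr {1..k}" "ctr ` {1..k} \<subseteq> L"
    "Psi_opt d l L k P = (\<Sum>i=1..k. \<Sum>x\<in>P i. d x (ctr i) powr l)"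
    using Psi_opt_attained[OF inst'(1)] by blast
  interpret encoded_clustering X d C L k l \<epsilon> cs fs P ctr
    by unfold_locales (use assms ctr in auto)
  have opt: "Psi_opt d l L k P = ci.opt" by (simp add: ctr(3) ci.opt_def ci.cost_def)
  show "halts_within D t (input_config algorithm cs fs k l \<epsilon>)"
    using halts_and_valid(1) by (simp add: input_config_def t_def)
  show "length out = Suc rounds ^ k \<and> (\<forall>S\<in>set out. k_center_set L k S)"
    if out: "out \<in> set_pmf (output_after algorithm t d cs fs k l \<epsilon>)"
  proof -
    obtain cfg where cfg: "cfg \<in> set_pmf (steps D t (algorithm, input_store m f k l \<epsilon>))"
      "out = output_list fs k (snd cfg)"
      using out by (auto simp: output_after_def input_config_def)
    obtain T where "length T = Suc rounds" "enumerated T (snd cfg)"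
      using halts_and_valid(2)[OF cfg(1)[unfolded t_def]] by blast
    then show ?thesis
      using output_valid output_list_enumerated(2) by (metis cfg(2))
  qed
  show "1 / 2 \<le> measure_pmf.prob (output_after algorithm t d cs fs k l \<epsilon>)
      {out. \<exists>S\<in>set out. Psi d l k S P \<le> (3 powr l + \<epsilon>) * Psi_opt d l L k P}"
    using success_prob[of 2] by (simp add: opt t_def)
  show "1 / 2 \<le> measure_pmf.prob (output_after algorithm t d cs fs k l \<epsilon>)
      {out. \<exists>S\<in>set out. Psi d l k S P \<le> (2 powr l + \<epsilon>) * Psi_opt d l L k P}" if "C \<subseteq> L"
    using success_prob[of 1] that by (simp add: opt t_def)
qed

text \<open>\<open>1 + k / \<epsilon>\<close> is at most the square of \<open>bound_base\<close>,
  which turns the exponent 42 of the threshold into 84. Rounding up and the additional 1 cost at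
  most one more factor of the base, within the margin up to 88.\<close>

lemma rounds_bounds:
  "real (Suc rounds ^ k) \<le> bound_base k \<epsilon> powr (88 * real k * l\<^sup>2)"
  "real (Suc (Suc rounds) ^ k) \<le> bound_base k \<epsilon> powr (88 * real k * l\<^sup>2)"
proof -
  let ?b = "bound_base k \<epsilon>"
  have b2: "2 \<le> ?b" "real k / \<epsilon> \<le> ?b" by (simp_all add: bound_base_def)
  have l1: "1 \<le> l\<^sup>2" using one_le_power[OF inst'(7)] .
  have "1 + real k / \<epsilon> \<le> ?b + ?b" using b2 by linarith
  also have "\<dots> \<le> ?b powr 2" using b2 by (simp add: power2_eq_square)
  finally have R: "1 + real k / \<epsilon> \<le> ?b powr 2" .
  have R0: "0 \<le> real k / \<epsilon>" using eps by simp
  have "bound \<le> (?b powr 2) powr (42 * l\<^sup>2)"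
    unfolding bound_def using R R0 by (intro powr_mono2) auto
  also have "\<dots> = ?b powr (84 * l\<^sup>2)" by (simp add: powr_powr)
  finally have bd: "bound \<le> ?b powr (84 * l\<^sup>2)" .
  have "real (Suc (Suc rounds)) \<le> bound + 2" using Suc_rounds(3) by simp
  also have "\<dots> \<le> ?b * bound"
  proof -
    have "2 * bound \<le> ?b * bound" using b2 bound_ge by (intro mult_right_mono) auto
    then show ?thesis using bound_ge by linarith
  qed
  also have "\<dots> \<le> ?b powr 1 * ?b powr (84 * l\<^sup>2)" using b2 bd bound_ge by (intro mult_mono) auto
  also have "\<dots> = ?b powr (1 + 84 * l\<^sup>2)" by (simp only: powr_add)
  also have "\<dots> \<le> ?b powr (88 * l\<^sup>2)" using b2 l1 by (intro powr_mono) auto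
  finally have "real (Suc (Suc rounds)) ^ k \<le> (?b powr (88 * l\<^sup>2)) ^ k" by (intro power_mono) auto
  also have "\<dots> = ?b powr (88 * real k * l\<^sup>2)"
    using b2 by (simp add: powr_realpow[symmetric] powr_powr mult_ac)
  finally show two: "real (Suc (Suc rounds) ^ k) \<le> ?b powr (88 * real k * l\<^sup>2)" by simp
  have "real (Suc rounds ^ k) \<le> real (Suc (Suc rounds) ^ k)"
    by (intro of_nat_mono power_mono) auto
  then show "real (Suc rounds ^ k) \<le> ?b powr (88 * real k * l\<^sup>2)" using two by linarith
qed

text \<open>The cube in \<open>run_time_le\<close> gives 264 = 3 * 88. The constant 400 is twice
  200, since a point that is both client and facility has two positions but counts once in
  \<open>C \<union> L\<close>.\<close>

lemma run_time_bound:
  "real (run_time m f k rounds) \<le> 400 * real (card (C \<union> L)) * bound_base k \<epsilon> powr (264 * real k * l\<^sup>2)"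
proof -
  have mf: "m = card C" "f = card L" using cs fs by (auto simp: lists_set_def distinct_card)
  have "card C \<le> card (C \<union> L)" "card L \<le> card (C \<union> L)" using inst'(1,3) by (auto intro: card_mono)
  then have n: "m + f \<le> 2 * card (C \<union> L)" using mf by linarith
  let ?K = "Suc (Suc rounds) ^ k"
  let ?Z = "bound_base k \<epsilon> powr (88 * real k * l\<^sup>2)"
  have "run_time m f k rounds \<le> 200 * (m + f) * ?K ^ 3"
    using inst'(5,6) by (intro run_time_le) auto
  also have "\<dots> \<le> 200 * (2 * card (C \<union> L)) * ?K ^ 3" using n by (intro mult_le_mono) auto
  finally have "real (run_time m f k rounds) \<le> real (200 * (2 * card (C \<union> L)) * ?K ^ 3)"
    by (rule of_nat_mono)
  also have "\<dots> = 400 * real (card (C \<union> L)) * real ?K ^ 3" by simp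
  also have "\<dots> \<le> 400 * real (card (C \<union> L)) * ?Z ^ 3"
    using rounds_bounds(2) by (intro mult_left_mono power_mono) auto
  also have "?Z ^ 3 = bound_base k \<epsilon> powr (264 * real k * l\<^sup>2)"
  proof -
    have "0 < bound_base k \<epsilon>" by (simp add: bound_base_def)
    then show ?thesis by (simp add: powr_realpow[symmetric] powr_powr mult.assoc)
  qed
  finally show ?thesis .
qed

end

theorem theorem2:
  shows "\<exists>(p :: com) (a :: real) (b :: real) (c :: real).
    \<forall>(X :: 'a set) d C L k l \<epsilon> cs fs.
      k_service_instance X d C L k l \<and> 0 < \<epsilon> \<and> \<epsilon> \<le> 1 \<and> lists_set cs C \<and> lists_set fs L \<longrightarrow>
      (\<exists>t :: nat.
        real t \<le> c * real (card (C \<union> L)) * bound_base k \<epsilon> powr (b * real k * l\<^sup>2) \<and>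
        halts_within (dist_query d cs fs) t (input_config p cs fs k l \<epsilon>) \<and>
        (\<forall>out \<in> set_pmf (output_after p t d cs fs k l \<epsilon>).
           real (length out) \<le> bound_base k \<epsilon> powr (a * real k * l\<^sup>2) \<and>
           (\<forall>S \<in> set out. k_center_set L k S)) \<and>
        (\<forall>P. clustering C k P \<longrightarrow>
           measure_pmf.prob (output_after p t d cs fs k l \<epsilon>)
             {out. \<exists>S \<in> set out. Psi d l k S P \<le> (3 powr l + \<epsilon>) * Psi_opt d l L k P} \<ge> 1/2 \<and>
           (C \<subseteq> L \<longrightarrow>
             measure_pmf.prob (output_after p t d cs fs k l \<epsilon>)
               {out. \<exists>S \<in> set out. Psi d l k S P \<le> (2 powr l + \<epsilon>) * Psi_opt d l L k P} \<ge> 1/2)))"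
proof (rule exI[of _ algorithm], rule exI[of _ 88], rule exI[of _ 264], rule exI[of _ 400],
    intro allI impI)
  fix X :: "'a set" and d C L k and l \<epsilon> :: real and cs fs
  assume "k_service_instance X d C L k l \<and> 0 < \<epsilon> \<and> \<epsilon> \<le> 1 \<and> lists_set cs C \<and> lists_set fs L"
  then interpret encoded_instance X d C L k l \<epsilon> cs fs
    by unfold_locales auto
  let ?t = "run_time m f k rounds"
  \<comment> \<open>Halting and the form of the output do not mention a clustering, but were
    obtained from an expectation bound for one; any clustering serves, here one with a single
    part.\<close>
  have "clustering C k (\<lambda>i. if i = 1 then C else {})"
    using inst'(5) by (auto simp: clustering_def disjoint_family_on_def)
  note trivial = clustering_results(1,2)[OF this]
  show "\<exists>t :: nat.
        real t \<le> 400 * real (card (C \<union> L)) * bound_base k \<epsilon> powr (264 * real k * l\<^sup>2) \<and>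
        halts_within (dist_query d cs fs) t (input_config algorithm cs fs k l \<epsilon>) \<and>
        (\<forall>out \<in> set_pmf (output_after algorithm t d cs fs k l \<epsilon>).
           real (length out) \<le> bound_base k \<epsilon> powr (88 * real k * l\<^sup>2) \<and>
           (\<forall>S \<in> set out. k_center_set L k S)) \<and>
        (\<forall>P. clustering C k P \<longrightarrow>
           measure_pmf.prob (output_after algorithm t d cs fs k l \<epsilon>)
             {out. \<exists>S \<in> set out. Psi d l k S P \<le> (3 powr l + \<epsilon>) * Psi_opt d l L k P} \<ge> 1/2 \<and>
           (C \<subseteq> L \<longrightarrow>
             measure_pmf.prob (output_after algorithm t d cs fs k l \<epsilon>)
               {out. \<exists>S \<in> set out. Psi d l k S P \<le> (2 powr l + \<epsilon>) * Psi_opt d l L k P} \<ge> 1/2))"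
    using run_time_bound trivial rounds_bounds(1) clustering_results(3,4)
    by (intro exI[of _ ?t] conjI ballI allI impI) simp_all
qed

end
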